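(* Let $\mathfrak{O}$ be the ring of integers of a quadratic number field, let $f>0$ be a rational integer, and let $R=\mathfrak{O}_f$ be the unique order of index $f$ in $\mathfrak{O}$. Let $I$ be a non-zero ideal of $R$ and let $f'$ be the positive rational integer such that $\varrho(I)=\mathfrak{O}_{f'}$. Then the following hold. (i) $|\varrho(I)^{\times}\backslash V_2(I)/\mathrm{SL}_2(R)| = [(R/\mathrm{Fitt}_1(I))^{\times}:\epsilon(I)] = \dfrac{\varphi(f/f')}{2^{\epsilon(f,f')}}$, where $\varphi$ is the Euler totient function and $\epsilon(f,f')=1$ if $\mathfrak{O}_{f'}$ has a unit of norm $-1$ and $f/f'>2$, and $\epsilon(f,f')=0$ otherwise. (ii) $\mathrm{Aut}_R(I)\backslash V_2(I)/\mathrm{GL}_2(R)=V_2(I)/\mathrm{GL}_2(R)$ (i.e. $\mathrm{Aut}_R(I)$ acts trivially on $V_2(I)/\mathrm{GL}_2(R)$). The determinant map induces a bijection of $V_2(I)/\mathrm{GL}_2(R)$ onto the quotient of $(R/\mathrm{Fitt}_1(I))^{\times}$ by the image of $R^{\times}$ under the natural map $R\to R/\mathrm{Fitt}_1(I)$. (iii) If $f/f'$ has at least three distinct odd rational prime divisors, then $\mathrm{GL}_2(R)$ does not act transitively on $V_2(I)$.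
   Context: $\mathfrak{O}_{f'}$ is the unique subring of index $f'$ in $\mathfrak{O}$; norms are over $\mathbb{Q}$. $\varrho(I)=\{r\in\mathfrak{O}: rI\subseteq I\}$ is the ring of multipliers of $I$ (an order of the quadratic field). $V_2(I)$ is the set of generating pairs of $I$ (every ideal of $R$ can be generated by two elements). $\mathrm{GL}_2(R)$ and $\mathrm{SL}_2(R)$ act on $V_2(I)$ by right multiplication of row vectors by matrices; the group $\mathrm{Aut}_R(I)$ of $R$-module automorphisms of $I$ acts on the left diagonally, $\phi(a,b)=(\phi(a),\phi(b))$, and $\varrho(I)^\times$ acts through multiplication. Fitting ideals: if $F\xrightarrow{\psi} G\to M\to 0$ is exact with $F,G$ free $R$-modules and $G$ of finite rank $g$, then $\mathrm{Fitt}_i(M)$ is the ideal generated by the $(g-i)\times(g-i)$ minors of a matrix of $\psi$ (the ideal of $0\times 0$ minors being $R$). The module $\bigwedge^2 I$ is cyclic with annihilator $\mathrm{Fitt}_1(I)$, generated by $m_1\wedge m_2$ for any $\mathbf m=(m_1,m_2)\in V_2(I)$; $\det_{\mathbf m}(\mathbf m')\in (R/\mathrm{Fitt}_1(I))^\times$ is defined for $\mathbf m'\in V_2(I)$ by $m_1'\wedge m_2'=\det_{\mathbf m}(\mathbf m')(m_1\wedge m_2)$. The "determinant map" is $\mathbf m'\mapsto\det_{\mathbf m}(\mathbf m')$ for a fixed $\mathbf m\in V_2(I)$. For $u\in\varrho(I)^\times$, $\det(u):=\det_{\mathbf m}(u\mathbf m)$ does not depend on $\mathbf m$, and $\epsilon(I):=\{\det(u):u\in\varrho(I)^\times\}$,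 a subgroup of $(R/\mathrm{Fitt}_1(I))^\times$. *)

theory Defs
  imports
    "HOL-Algebra.Subrings"
    "HOL-Algebra.QuotRing"
    "HOL-Algebra.Module"
    "HOL-Computational_Algebra.Polynomial"
    "HOL-Number_Theory.Totient"
    "HOL-Library.Poly_Mapping"
    "Jordan_Normal_Form.Determinant"
begin

text \<open>
  All rings occurring here are subrings of an ambient field of characteristic 0, given by a type
  of class field_char_0; they are represented by their carrier sets, and \<open>ring_of\<close> turns such a
  set into a ring record with the operations of the ambient field.
\<close>

definition ring_of :: "'a::comm_ring_1 set \<Rightarrow> 'a ring" where
  "ring_of S = \<lparr>carrier = S, monoid.mult = (*), monoid.one = 1, ring.zero = 0, ring.add = (+)\<rparr>"

subsection \<open>Quadratic fields and their orders\<close>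

definition rat_basis :: "'a::field_char_0 set \<Rightarrow> 'a \<Rightarrow> 'a \<Rightarrow> bool" where
  "rat_basis K b1 b2 \<longleftrightarrow>
     K = {of_rat p * b1 + of_rat q * b2 | p q. True} \<and>
     (\<forall>p q. of_rat p * b1 + of_rat q * b2 = 0 \<longrightarrow> p = 0 \<and> q = 0)"

definition quadratic_field :: "'a::field_char_0 set \<Rightarrow> bool" where
  "quadratic_field K \<longleftrightarrow> subfield K (ring_of UNIV) \<and> (\<exists>b1 b2. rat_basis K b1 b2)"

text \<open>The norm over the rationals: the determinant of multiplication by \<open>x\<close>, the columns of \<open>A\<close>
  being the coordinates of the images of the basis elements.\<close>

definition field_norm :: "'a::field_char_0 set \<Rightarrow> 'a \<Rightarrow> rat" where
  "field_norm K x = (THE n. \<exists>b1 b2 A. rat_basis K b1 b2 \<and> A \<in> carrier_mat 2 2 \<and>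
     x * b1 = of_rat (A $$ (0,0)) * b1 + of_rat (A $$ (1,0)) * b2 \<and>
     x * b2 = of_rat (A $$ (0,1)) * b1 + of_rat (A $$ (1,1)) * b2 \<and>
     n = det A)"

definition ring_of_integers :: "'a::field_char_0 set \<Rightarrow> 'a set" where
  "ring_of_integers K = {x \<in> K. algebraic_int x}"

text \<open>The index of additive groups; an infinite index is recorded as 0.\<close>

definition add_index :: "'a::comm_ring_1 set \<Rightarrow> 'a set \<Rightarrow> nat" where
  "add_index B S = card (a_rcosets\<^bsub>ring_of B\<^esub> S)"

text \<open>For a quadratic field \<open>K\<close> and \<open>f > 0\<close> there is exactly one such subring.\<close>

definition quad_order :: "'a::field_char_0 set \<Rightarrow> nat \<Rightarrow> 'a set" where
  "quad_order K f = (THE S. subring S (ring_of (ring_of_integers K)) \<and>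
     add_index (ring_of_integers K) S = f)"

definition multiplier_ring :: "'a::field_char_0 set \<Rightarrow> 'a set \<Rightarrow> 'a set" where
  "multiplier_ring K I = {r \<in> ring_of_integers K. \<forall>x\<in>I. r * x \<in> I}"

subsection \<open>Fitting ideals\<close>

text \<open>
  A presentation \<open>F \<rightarrow> G \<rightarrow> M \<rightarrow> 0\<close> of an \<open>R\<close>-submodule \<open>M\<close> of the ambient field, with
  \<open>G\<close> the free module of rank \<open>g\<close>. The map \<open>G \<rightarrow> M\<close> sends the standard basis to the entries of
  \<open>ms\<close>; the free module \<open>F\<close>, of arbitrary rank, enters through the set \<open>C\<close> of images in \<open>G\<close>
  of its basis elements, that is, the columns of the matrix of \<open>F \<rightarrow> G\<close>. (Repeated columns do
  not affect the ideals of minors.)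
\<close>

definition free_vecs :: "'a::comm_ring_1 set \<Rightarrow> nat \<Rightarrow> 'a vec set" where
  "free_vecs R g = {v \<in> carrier_vec g. set\<^sub>v v \<subseteq> R}"

definition presentation ::
  "'a::comm_ring_1 set \<Rightarrow> 'a set \<Rightarrow> nat \<Rightarrow> 'a vec \<Rightarrow> 'a vec set \<Rightarrow> bool" where
  "presentation R M g ms C \<longleftrightarrow>
     ms \<in> carrier_vec g \<and>
     M = {v \<bullet> ms | v. v \<in> free_vecs R g} \<and>
     {v \<in> free_vecs R g. v \<bullet> ms = 0} =
       {A *\<^sub>v c | A c k. A \<in> carrier_mat g k \<and> set (cols A) \<subseteq> C \<and> c \<in> free_vecs R k} \<and>
     C \<subseteq> free_vecs R g"

text \<open>If \<open>i \<ge> g\<close>, then \<open>g - i = 0\<close> and the only minor is the empty one, equal to 1.\<close>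

definition minors_ideal ::
  "'a::comm_ring_1 set \<Rightarrow> nat \<Rightarrow> 'a vec set \<Rightarrow> nat \<Rightarrow> 'a set" where
  "minors_ideal R g C i = (let n = g - i in
     Idl\<^bsub>ring_of R\<^esub> {det (Matrix.mat n n (\<lambda>(p, q). vec_index (c q) (\<rho> p))) | \<rho> c.
       \<rho> \<in> {..<n} \<rightarrow> {..<g} \<and> inj_on \<rho> {..<n} \<and> c \<in> {..<n} \<rightarrow> C \<and> inj_on c {..<n}})"

text \<open>By Fitting's lemma the ideal is the same for all presentations of a finitely generated
  module.\<close>

definition fitting_ideal :: "nat \<Rightarrow> 'a::comm_ring_1 set \<Rightarrow> 'a set \<Rightarrow> 'a set" where
  "fitting_ideal i R M =
     (THE J. \<forall>g ms C. presentation R M g ms C \<longrightarrow> J = minors_ideal R g C i)"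

subsection \<open>The exterior square of a module\<close>

text \<open>The exterior square of \<open>M\<close> is the free \<open>R\<close>-module on \<open>M \<times> M\<close> modulo the submodule
  generated by the relations that make \<open>(a, b) \<mapsto> a \<and> b\<close> bilinear and alternating. The
  multiplicative part of the record of a module plays no role.\<close>

definition free_on_pairs :: "'a::comm_ring_1 set \<Rightarrow> 'a set \<Rightarrow> ('a, ('a \<times> 'a) \<Rightarrow>\<^sub>0 'a) module" where
  "free_on_pairs R M =
     \<lparr>carrier = {x. Poly_Mapping.keys x \<subseteq> M \<times> M \<and> (\<forall>k. Poly_Mapping.lookup x k \<in> R)},
      monoid.mult = undefined, monoid.one = undefined, ring.zero = 0, ring.add = (+),
      module.smult = (\<lambda>r. Poly_Mapping.map ((*) r))\<rparr>"

definition alternating_relators ::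
  "'a::comm_ring_1 set \<Rightarrow> 'a set \<Rightarrow> (('a \<times> 'a) \<Rightarrow>\<^sub>0 'a) set" where
  "alternating_relators R M = (let e = (\<lambda>a b. Poly_Mapping.single (a, b) (1::'a)) in
     {e (a + b) c - e a c - e b c | a b c. a \<in> M \<and> b \<in> M \<and> c \<in> M} \<union>
     {e a (b + c) - e a b - e a c | a b c. a \<in> M \<and> b \<in> M \<and> c \<in> M} \<union>
     {e (r * a) b - Poly_Mapping.single (a, b) r | r a b. r \<in> R \<and> a \<in> M \<and> b \<in> M} \<union>
     {e a (r * b) - Poly_Mapping.single (a, b) r | r a b. r \<in> R \<and> a \<in> M \<and> b \<in> M} \<union>
     {e a a | a. a \<in> M})"

definition alternating_submodule ::
  "'a::comm_ring_1 set \<Rightarrow> 'a set \<Rightarrow> (('a \<times> 'a) \<Rightarrow>\<^sub>0 'a) set" where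
  "alternating_submodule R M = \<Inter>{N. submodule N (ring_of R) (free_on_pairs R M) \<and>
     alternating_relators R M \<subseteq> N}"

definition ext_square ::
  "'a::comm_ring_1 set \<Rightarrow> 'a set \<Rightarrow> ('a, (('a \<times> 'a) \<Rightarrow>\<^sub>0 'a) set) module" where
  "ext_square R M = (let F = free_on_pairs R M; N = alternating_submodule R M in
     \<lparr>carrier = a_rcosets\<^bsub>F\<^esub> N,
      monoid.mult = undefined, monoid.one = undefined, ring.zero = N, ring.add = set_add F,
      module.smult = (\<lambda>r Y. \<Union>y\<in>Y. N +>\<^bsub>F\<^esub> (r \<odot>\<^bsub>F\<^esub> y))\<rparr>)"

definition wedge ::
  "'a::comm_ring_1 set \<Rightarrow> 'a set \<Rightarrow> 'a \<Rightarrow> 'a \<Rightarrow> (('a \<times> 'a) \<Rightarrow>\<^sub>0 'a) set" where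
  "wedge R M a b =
     alternating_submodule R M +>\<^bsub>free_on_pairs R M\<^esub> Poly_Mapping.single (a, b) 1"

subsection \<open>Generating pairs, group actions and the determinant\<close>

definition gen_pairs :: "'a::comm_ring_1 set \<Rightarrow> 'a set \<Rightarrow> ('a \<times> 'a) set" where
  "gen_pairs R I = {(a, b). a \<in> I \<and> b \<in> I \<and> Idl\<^bsub>ring_of R\<^esub> {a, b} = I}"

definition GL2 :: "'a::comm_ring_1 set \<Rightarrow> 'a mat set" where
  "GL2 R = {A \<in> carrier_mat 2 2. elements_mat A \<subseteq> R \<and>
     (\<exists>B \<in> carrier_mat 2 2. elements_mat B \<subseteq> R \<and> A * B = 1\<^sub>m 2 \<and> B * A = 1\<^sub>m 2)}"

definition SL2 :: "'a::comm_ring_1 set \<Rightarrow> 'a mat set" where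
  "SL2 R = {A \<in> carrier_mat 2 2. elements_mat A \<subseteq> R \<and> det A = 1}"

definition row_mult :: "'a::comm_ring_1 \<times> 'a \<Rightarrow> 'a mat \<Rightarrow> 'a \<times> 'a" where
  "row_mult m A = (fst m * A $$ (0,0) + snd m * A $$ (1,0),
                   fst m * A $$ (0,1) + snd m * A $$ (1,1))"

definition module_auts :: "'a::comm_ring_1 set \<Rightarrow> 'a set \<Rightarrow> ('a \<Rightarrow> 'a) set" where
  "module_auts R I = {\<phi>. bij_betw \<phi> I I \<and> (\<forall>x\<in>I. \<forall>y\<in>I. \<phi> (x + y) = \<phi> x + \<phi> y) \<and>
     (\<forall>r\<in>R. \<forall>x\<in>I. \<phi> (r * x) = r * \<phi> x)}"

text \<open>Orbits of a set \<open>\<Phi>\<close> of maps, acting diagonally on the left, and a set \<open>H\<close> of matrices,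
  acting on the right. For groups acting in this way, \<open>pairs_mod \<Phi> V H\<close> is the double coset
  space of \<open>V\<close>.\<close>

definition orbit_rel :: "('a::comm_ring_1 \<Rightarrow> 'a) set \<Rightarrow> ('a \<times> 'a) set \<Rightarrow> 'a mat set \<Rightarrow>
    (('a \<times> 'a) \<times> ('a \<times> 'a)) set" where
  "orbit_rel \<Phi> V H =
     {(m, m'). m \<in> V \<and> m' \<in> V \<and> (\<exists>\<phi>\<in>\<Phi>. \<exists>A\<in>H. m' = row_mult (map_prod \<phi> \<phi> m) A)}"

definition pairs_mod :: "('a::comm_ring_1 \<Rightarrow> 'a) set \<Rightarrow> ('a \<times> 'a) set \<Rightarrow> 'a mat set \<Rightarrow>
    ('a \<times> 'a) set set" where
  "pairs_mod \<Phi> V H = V // orbit_rel \<Phi> V H"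

definition unit_mults :: "'a::comm_ring_1 set \<Rightarrow> ('a \<Rightarrow> 'a) set" where
  "unit_mults S = (*) ` Units (ring_of S)"

abbreviation fitting_quot :: "'a::comm_ring_1 set \<Rightarrow> 'a set \<Rightarrow> 'a set ring" where
  "fitting_quot R I \<equiv> ring_of R Quot fitting_ideal 1 R I"

text \<open>The scalar multiplication of \<open>R/Fitt\<^sub>1(I)\<close> on the exterior square is the one through
  representatives.\<close>

definition det_pair :: "'a::comm_ring_1 set \<Rightarrow> 'a set \<Rightarrow> 'a \<times> 'a \<Rightarrow> 'a \<times> 'a \<Rightarrow> 'a set" where
  "det_pair R I m m' = (THE d. d \<in> carrier (fitting_quot R I) \<and>
     (\<forall>r\<in>d. wedge R I (fst m') (snd m') =
        r \<odot>\<^bsub>ext_square R I\<^esub> wedge R I (fst m) (snd m)))"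

definition det_unit :: "'a::comm_ring_1 set \<Rightarrow> 'a set \<Rightarrow> 'a \<Rightarrow> 'a set" where
  "det_unit R I u = (THE d. \<forall>m\<in>gen_pairs R I. det_pair R I m (map_prod ((*) u) ((*) u) m) = d)"

definition eps_group :: "'a::field_char_0 set \<Rightarrow> 'a set \<Rightarrow> 'a set \<Rightarrow> 'a set set" where
  "eps_group K R I = det_unit R I ` Units (ring_of (multiplier_ring K I))"

definition unit_image :: "'a::comm_ring_1 set \<Rightarrow> 'a set \<Rightarrow> 'a set set" where
  "unit_image R I = (\<lambda>r. fitting_ideal 1 R I +>\<^bsub>ring_of R\<^esub> r) ` Units (ring_of R)"

text \<open>Here \<open>f'\<close> divides \<open>f\<close> in the situation of interest, so \<open>div\<close> is exact.\<close>

definition eps_exponent :: "'a::field_char_0 set \<Rightarrow> nat \<Rightarrow> nat \<Rightarrow> nat" where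
  "eps_exponent K f f' =
     (if (\<exists>u \<in> Units (ring_of (quad_order K f')). field_norm K u = -1) \<and> f div f' > 2
      then 1 else 0)"

end

theory Submission
  imports Defs
begin

text \<open>
  Put \<open>g = f / f'\<close>. The ideal \<open>I\<close> has the form \<open>al (\<int> + \<int> t)\<close> with \<open>t\<close> a root of a primitive polynomial
  \<open>a X\<^sup>2 + b X + c\<close>; its ring of multipliers is \<open>S = \<int> + \<int> a t\<close>, and \<open>R = \<int> + g S\<close>. The relations between two
  generators \<open>m1, m2\<close> are the multiples \<open>l (- m2, m1)\<close> with \<open>l\<close> in \<open>(R : I)\<close>, so \<open>Fitt\<^sub>1(I)\<close> is \<open>(R : I) I = g S\<close>,
  the last equality being the invertibility of \<open>I\<close> over \<open>S\<close>, and \<open>R/Fitt\<^sub>1(I)\<close> is \<open>\<int>/g\<close>. The integral determinant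
  \<open>D\<close> of two elements of \<open>I\<close> with respect to the basis \<open>al, al t\<close> is \<open>R\<close>-bilinear modulo \<open>g S\<close>; hence
  \<open>det\<^sub>m(m')\<close> is the class of \<open>D(m') / D(m)\<close>. Two generating pairs with congruent determinants are related by a
  matrix with determinant in \<open>1 + g S\<close>, and adding relations to its columns makes the determinant equal to
  \<open>1\<close>. A unit of \<open>S\<close> multiplies \<open>D\<close> by its norm \<open>\<plusminus>1\<close>. A unit \<open>r\<close> of \<open>R\<close> is congruent to an integer \<open>x\<close> modulo \<open>g S\<close>
  with \<open>x\<^sup>2\<close> congruent to its norm, and not every class of \<open>(\<int>/g)\<^sup>\<times>\<close> has square \<open>\<plusminus>1\<close> if \<open>g\<close> has a prime
  divisor other than \<open>2\<close> and \<open>3\<close> and a second odd one.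
\<close>

section \<open>Rings given by subsets of a commutative ring\<close>

text \<open>\<open>fitting_ideal\<close> is a description over all presentations, of any rank and
  with possibly infinite sets of columns, so its value can be named only after every presentation
  has been shown to give the same ideal. For ideals of a domain two bounds suffice. A minor lies in
  (R : I) I by Cramer's rule; conversely, two generators can be adjoined to any presentation without
  enlarging its ideal of minors, which therefore contains the entries of all relations between the
  two. The conjugate lattice makes the bounds meet: its products with \<open>I\<close> produce the
  coefficients \<open>a\<close>, \<open>b\<close>, \<open>c\<close>, which have gcd 1. In the
  exterior square, relations prove equalities but cannot show that a class is not 0; a linear form
  built from \<open>D\<close> does this. That every unit modulo \<open>g\<close> is a determinant
  needs a representative of its class prime to \<open>a\<close>. On the field side, the order of
  given index and the norm are descriptions too. They are evaluated in an integral basis, which is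
  found by identifying integrality with integral trace and norm; bounded denominators of powers give
  the harder implication.\<close>

lemma ring_of_simps [simp]:
  "carrier (ring_of S) = S" "monoid.mult (ring_of S) = (*)" "monoid.one (ring_of S) = 1"
  "ring.zero (ring_of S) = 0" "ring.add (ring_of S) = (+)"
  by (simp_all add: ring_of_def)

lemma a_r_coset_ring_of: "S +>\<^bsub>ring_of B\<^esub> x = (\<lambda>s. s + x) ` S"
  by (auto simp: a_r_coset_def r_coset_def ring_of_def)

lemma in_a_r_coset_ring_of: "y \<in> S +>\<^bsub>ring_of B\<^esub> x \<longleftrightarrow> y - x \<in> S"
  by (force simp: a_r_coset_ring_of image_iff)

locale subset_ring =
  fixes R :: "'a::comm_ring_1 set"
  assumes one_mem: "1 \<in> R"
    and diff_mem: "x \<in> R \<Longrightarrow> y \<in> R \<Longrightarrow> x - y \<in> R"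
    and mult_mem: "x \<in> R \<Longrightarrow> y \<in> R \<Longrightarrow> x * y \<in> R"
begin

lemma zero_mem: "0 \<in> R"
  using diff_mem[OF one_mem one_mem] by simp

lemma uminus_mem: "x \<in> R \<Longrightarrow> - x \<in> R"
  using diff_mem[OF zero_mem] by simp

lemma add_mem: "x \<in> R \<Longrightarrow> y \<in> R \<Longrightarrow> x + y \<in> R"
  using diff_mem[OF _ uminus_mem] by force

lemma sum_mem: "(\<And>i. i \<in> A \<Longrightarrow> f i \<in> R) \<Longrightarrow> sum f A \<in> R"
  by (induction A rule: infinite_finite_induct) (auto simp: zero_mem add_mem)

lemma prod_mem: "(\<And>i. i \<in> A \<Longrightarrow> f i \<in> R) \<Longrightarrow> prod f A \<in> R"
  by (induction A rule: infinite_finite_induct) (auto simp: one_mem mult_mem)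

lemma of_nat_mem: "of_nat n \<in> R"
  by (induction n) (auto simp: zero_mem one_mem add_mem)

lemma of_int_mem: "of_int n \<in> R"
  by (cases n rule: int_cases2) (auto simp: of_nat_mem uminus_mem)

lemma power_mem: "x \<in> R \<Longrightarrow> x ^ n \<in> R"
  by (induction n) (auto simp: one_mem mult_mem)

lemma det_mem:
  assumes "A \<in> carrier_mat n n" "\<And>i j. i < n \<Longrightarrow> j < n \<Longrightarrow> A $$ (i, j) \<in> R"
  shows "det A \<in> R"
  unfolding det_def'[OF assms(1)]
proof (rule sum_mem, rule mult_mem)
  fix p assume p: "p \<in> {p. p permutes {0..<n}}"
  show "signof p \<in> R"
    by (simp add: sign_def one_mem uminus_mem)
  show "(\<Prod>i = 0..<n. A $$ (i, p i)) \<in> R"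
  proof (rule prod_mem)
    fix i assume "i \<in> {0..<n}"
    with p show "A $$ (i, p i) \<in> R"
      by (intro assms(2)) (auto dest: permutes_in_image)
  qed
qed

lemma cofactor_mem:
  assumes "A \<in> carrier_mat n n" "\<And>i j. i < n \<Longrightarrow> j < n \<Longrightarrow> A $$ (i, j) \<in> R" "i < n" "j < n"
  shows "cofactor A i j \<in> R"
  unfolding cofactor_def
proof (rule mult_mem)
  show "(- 1) ^ (i + j) \<in> R"
    by (intro power_mem uminus_mem one_mem)
  show "det (mat_delete A i j) \<in> R"
    by (rule det_mem[of _ "n - 1"]) (use assms in \<open>auto simp: mat_delete_def\<close>)
qed

lemma cring_ring_of: "cring (ring_of R)"
proof (rule cringI)
  show "abelian_group (ring_of R)"
  proof (rule abelian_groupI)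
    fix x assume "x \<in> carrier (ring_of R)"
    then show "\<exists>y\<in>carrier (ring_of R). y \<oplus>\<^bsub>ring_of R\<^esub> x = \<zero>\<^bsub>ring_of R\<^esub>"
      by (auto intro!: bexI[of _ "- x"] simp: uminus_mem)
  qed (auto simp: add_mem zero_mem)
  show "Group.comm_monoid (ring_of R)"
    by unfold_locales (auto simp: mult_mem one_mem)
qed (auto simp: algebra_simps)

lemma a_inv_ring_of: "x \<in> R \<Longrightarrow> \<ominus>\<^bsub>ring_of R\<^esub> x = - x"
  by (rule abelian_group.minus_equality[OF ring.is_abelian_group[OF cring.axioms(1)[OF cring_ring_of]]])
    (auto simp: uminus_mem)

text \<open>Closure under negation comes from multiplication by \<open>- 1 \<in> R\<close>, and
  commutativity turns absorption on one side into absorption on both.\<close>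

lemma ideal_ring_of_iff:
  "ideal J (ring_of R) \<longleftrightarrow> J \<subseteq> R \<and> 0 \<in> J \<and> (\<forall>x\<in>J. \<forall>y\<in>J. x + y \<in> J) \<and> (\<forall>r\<in>R. \<forall>x\<in>J. r * x \<in> J)"
    (is "_ \<longleftrightarrow> ?Q")
proof
  assume "ideal J (ring_of R)"
  then interpret ideal J "ring_of R" .
  show ?Q
    using a_subset additive_subgroup.zero_closed[OF additive_subgroup_axioms]
      additive_subgroup.a_closed[OF additive_subgroup_axioms] I_l_closed by auto
next
  assume Q: ?Q
  interpret cring "ring_of R" by (rule cring_ring_of)
  have neg: "- x \<in> J" if "x \<in> J" for x
    using Q that uminus_mem[OF one_mem] by (metis mult_minus1)
  show "ideal J (ring_of R)"
  proof (rule idealI)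
    show "ring (ring_of R)" by (rule ring_axioms)
    show "subgroup J (add_monoid (ring_of R))"
    proof (rule add.subgroupI)
      fix x assume "x \<in> J"
      then show "\<ominus>\<^bsub>ring_of R\<^esub> x \<in> J"
        using Q neg a_inv_ring_of[of x] by auto
    qed (use Q in auto)
  qed (use Q in \<open>auto, (metis mult.commute)+\<close>)
qed

lemma ideal_sum_mem:
  assumes "ideal J (ring_of R)" "\<And>i. i \<in> A \<Longrightarrow> f i \<in> J"
  shows "sum f A \<in> J"
  using assms(2)
  by (induction A rule: infinite_finite_induct) (use assms(1) in \<open>auto simp: ideal_ring_of_iff\<close>)

lemma genideal_subset_iff:
  assumes "S \<subseteq> R" "ideal J (ring_of R)"
  shows "Idl\<^bsub>ring_of R\<^esub> S \<subseteq> J \<longleftrightarrow> S \<subseteq> J"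
  using assms cring.axioms(1)[OF cring_ring_of] ring.genideal_minimal ring.genideal_self
  by (metis (no_types, lifting) order.trans ring_of_simps(1))

lemma ideal_genideal: "S \<subseteq> R \<Longrightarrow> ideal (Idl\<^bsub>ring_of R\<^esub> S) (ring_of R)"
  using ring.genideal_ideal[OF cring.axioms(1)[OF cring_ring_of]] by simp

lemma genideal_pair:
  assumes "x \<in> R" "y \<in> R"
  shows "Idl\<^bsub>ring_of R\<^esub> {x, y} = {r * x + s * y | r s. r \<in> R \<and> s \<in> R}" (is "_ = ?J")
proof
  have "ideal ?J (ring_of R)"
    unfolding ideal_ring_of_iff
  proof (intro conjI ballI)
    show "?J \<subseteq> R" using assms by (auto intro!: add_mem mult_mem)
    show "0 \<in> ?J" using zero_mem by force
    show "u + v \<in> ?J" if "u \<in> ?J" "v \<in> ?J" for u v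
    proof -
      obtain r s r' s' where "u = r * x + s * y" "v = r' * x + s' * y"
        "r \<in> R" "s \<in> R" "r' \<in> R" "s' \<in> R" using \<open>u \<in> ?J\<close> \<open>v \<in> ?J\<close> by blast
      then have "u + v = (r + r') * x + (s + s') * y" by (simp add: algebra_simps)
      with \<open>r \<in> R\<close> \<open>s \<in> R\<close> \<open>r' \<in> R\<close> \<open>s' \<in> R\<close> show ?thesis using add_mem by blast
    qed
    show "t * u \<in> ?J" if "t \<in> R" "u \<in> ?J" for t u
    proof -
      obtain r s where "u = r * x + s * y" "r \<in> R" "s \<in> R" using \<open>u \<in> ?J\<close> by blast
      then have "t * u = (t * r) * x + (t * s) * y" by (simp add: algebra_simps)
      with \<open>r \<in> R\<close> \<open>s \<in> R\<close> \<open>t \<in> R\<close> show ?thesis using mult_mem by blast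
    qed
  qed
  moreover have "x \<in> ?J"
    using one_mem zero_mem by (intro CollectI exI[of _ 1] exI[of _ 0]) simp
  moreover have "y \<in> ?J"
    using one_mem zero_mem by (intro CollectI exI[of _ 0] exI[of _ 1]) simp
  ultimately show "Idl\<^bsub>ring_of R\<^esub> {x, y} \<subseteq> ?J"
    using assms by (simp add: genideal_subset_iff)
next
  have "ideal (Idl\<^bsub>ring_of R\<^esub> {x, y}) (ring_of R)" using assms by (simp add: ideal_genideal)
  moreover have "x \<in> Idl\<^bsub>ring_of R\<^esub> {x, y}" "y \<in> Idl\<^bsub>ring_of R\<^esub> {x, y}"
    using assms ring.genideal_self[OF cring.axioms(1)[OF cring_ring_of], of "{x, y}"] by auto
  ultimately show "?J \<subseteq> Idl\<^bsub>ring_of R\<^esub> {x, y}"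
    unfolding ideal_ring_of_iff by blast
qed

end

section \<open>Fitting ideals of submodules of a field\<close>

lemma scalar_prod_sum: "w \<in> carrier_vec n \<Longrightarrow> v \<bullet> w = (\<Sum>i<n. v $ i * w $ i)"
  by (auto simp: scalar_prod_def lessThan_atLeast0)

section \<open>Cramer's rule and determinants of relations\<close>

lemma det_mult_relations:
  fixes M :: "'a::comm_ring_1 mat"
  assumes M: "M \<in> carrier_mat g g" and k: "k < g"
    and rel: "\<And>j. j < g \<Longrightarrow> j \<noteq> k \<Longrightarrow> (\<Sum>l<g. M $$ (l, j) * ms l) = 0"
    and i: "i < g"
  shows "det M * ms i = cofactor M i k * (\<Sum>l<g. M $$ (l, k) * ms l)"
proof -
  have adj: "adj_mat M $$ (j, i) = cofactor M i j" if "j < g" for j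
    using that i M by (auto simp: adj_mat_def)
  have *: "(\<Sum>j<g. M $$ (l, j) * cofactor M i j) = (if l = i then det M else 0)" if "l < g" for l
  proof -
    have "(\<Sum>j<g. M $$ (l, j) * cofactor M i j) = (M * adj_mat M) $$ (l, i)"
      using that i M adj_mat(1)[OF M] adj
      by (auto simp: scalar_prod_def lessThan_atLeast0 intro!: sum.cong)
    then show ?thesis using adj_mat(2)[OF M] that i by simp
  qed
  have "det M * ms i = (\<Sum>l<g. (if l = i then det M else 0) * ms l)"
    using i by (simp add: if_distrib[of "\<lambda>x. x * _"] cong: if_cong)
  also have "\<dots> = (\<Sum>l<g. \<Sum>j<g. cofactor M i j * (M $$ (l, j) * ms l))"
    by (intro sum.cong refl) (simp flip: * add: sum_distrib_left sum_distrib_right mult_ac)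
  also have "\<dots> = (\<Sum>j<g. cofactor M i j * (\<Sum>l<g. M $$ (l, j) * ms l))"
    by (subst sum.swap) (simp add: sum_distrib_left)
  also have "\<dots> = (\<Sum>j<g. if j = k then cofactor M i k * (\<Sum>l<g. M $$ (l, k) * ms l) else 0)"
    by (intro sum.cong refl) (use rel in auto)
  finally show ?thesis using k by simp
qed

text \<open>\<open>rel_dets_in R J g ms\<close> is a form of \<open>Fitt\<^sub>1 \<subseteq> J\<close> that does not mention generators of the
  module of relations.\<close>

definition rel_dets_in :: "'a::comm_ring_1 set \<Rightarrow> 'a set \<Rightarrow> nat \<Rightarrow> (nat \<Rightarrow> 'a) \<Rightarrow> bool" where
  "rel_dets_in R J g ms \<longleftrightarrow> (\<forall>M k. M \<in> carrier_mat g g \<longrightarrow> k < g \<longrightarrow>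
     (\<forall>i<g. \<forall>j<g. M $$ (i, j) \<in> R) \<longrightarrow>
     (\<forall>j<g. j \<noteq> k \<longrightarrow> (\<Sum>i<g. M $$ (i, j) * ms i) = 0) \<longrightarrow> det M \<in> J)"

text \<open>Left multiplication by the unipotent matrix \<open>E\<close> realises these row
  operations. They are the base change that eliminates a generator expressible by the preceding
  ones.\<close>

lemma det_add_multiples_of_last_row:
  fixes M :: "'a::idom mat"
  assumes M: "M \<in> carrier_mat (Suc g) (Suc g)"
  shows "det (Matrix.mat (Suc g) (Suc g)
      (\<lambda>(i, j). if i < g then M $$ (i, j) + q i * M $$ (g, j) else M $$ (i, j))) = det M"
    (is "det ?N = _")
proof -
  define E where "E = Matrix.mat (Suc g) (Suc g)
      (\<lambda>(i, j). if i = j then 1 else if j = g then q i else 0 :: 'a)"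
  have E: "E \<in> carrier_mat (Suc g) (Suc g)" by (simp add: E_def)
  have "?N = E * M"
  proof (rule eq_matI)
    fix i j assume ij: "i < dim_row (E * M)" "j < dim_col (E * M)"
    then have i: "i < Suc g" and j: "j < Suc g" using E M by auto
    have "(E * M) $$ (i, j) = (\<Sum>k<Suc g. E $$ (i, k) * M $$ (k, j))"
      using i j E M by (auto simp: scalar_prod_def lessThan_atLeast0 intro!: sum.cong)
    also have "\<dots> = (\<Sum>k<g. E $$ (i, k) * M $$ (k, j)) + E $$ (i, g) * M $$ (g, j)"
      by simp
    also have "(\<Sum>k<g. E $$ (i, k) * M $$ (k, j)) = (\<Sum>k<g. if k = i then M $$ (k, j) else 0)"
      by (intro sum.cong refl) (use i in \<open>auto simp: E_def\<close>)
    finally show "?N $$ (i, j) = (E * M) $$ (i, j)"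
      using i j by (auto simp: E_def less_Suc_eq)
  qed (use E M in auto)
  then have "det ?N = det E * det M" using det_mult[OF E M] by simp
  also have "det E = prod_list (diag_mat E)"
    by (rule det_upper_triangular[OF _ E]) (auto simp: E_def)
  also have "diag_mat E = map (\<lambda>_. 1) [0..<Suc g]"
    unfolding diag_mat_def by (auto simp: E_def simp del: upt_Suc)
  also have "prod_list \<dots> = (1::'a)" by (simp only: map_replicate_const prod_list_replicate power_one)
  finally show ?thesis by simp
qed

lemma det_2x2:
  fixes A :: "'a::comm_ring_1 mat"
  assumes A: "A \<in> carrier_mat 2 2"
  shows "det A = A $$ (0, 0) * A $$ (1, 1) - A $$ (0, 1) * A $$ (1, 0)"
proof -
  have "det (mat_delete A i j) = mat_delete A i j $$ (0, 0)" for i j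
    by (rule det_single) (use A in \<open>auto simp: mat_delete_def\<close>)
  then have *: "det (mat_delete A i j) = A $$ (if i = 0 then 1 else 0, if j = 0 then 1 else 0)" for i j
    using A by (auto simp: mat_delete_def)
  show ?thesis
    by (subst laplace_expansion_row[OF A, of 0]) (auto simp: cofactor_def * numeral_2_eq_2)
qed

locale subset_field = subset_ring R for R :: "'a::field set"
begin

text \<open>A redundant generator does not enlarge the ideal of determinants. Substituting its
  expression \<open>y\<close> turns the first \<open>g\<close> entries of each relation into a
  relation of the old generators; expansion along the last row then leaves determinants of the old
  size.\<close>

lemma rel_dets_in_Suc:
  assumes J: "ideal J (ring_of R)" and T: "rel_dets_in R J g ms" and g: "g > 0"
    and q: "\<And>i. i < g \<Longrightarrow> q i \<in> R" and y: "ms g = (\<Sum>i<g. q i * ms i)"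
  shows "rel_dets_in R J (Suc g) ms"
  unfolding rel_dets_in_def
proof (intro allI impI)
  fix M k
  assume M: "M \<in> carrier_mat (Suc g) (Suc g)" and k: "k < Suc g"
    and MR: "\<forall>i<Suc g. \<forall>j<Suc g. M $$ (i, j) \<in> R"
    and rel: "\<forall>j<Suc g. j \<noteq> k \<longrightarrow> (\<Sum>i<Suc g. M $$ (i, j) * ms i) = 0"
  define N where "N = Matrix.mat (Suc g) (Suc g)
      (\<lambda>(i, j). if i < g then M $$ (i, j) + q i * M $$ (g, j) else M $$ (i, j))"
  have N: "N \<in> carrier_mat (Suc g) (Suc g)" by (simp add: N_def)
  have NR: "N $$ (i, j) \<in> R" if "i < Suc g" "j < Suc g" for i j
    using that MR q by (auto simp: N_def add_mem mult_mem)
  have Nrel: "(\<Sum>i<g. N $$ (i, j) * ms i) = 0" if "j < Suc g" "j \<noteq> k" for j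
  proof -
    have "(\<Sum>i<g. N $$ (i, j) * ms i)
        = (\<Sum>i<g. M $$ (i, j) * ms i) + M $$ (g, j) * (\<Sum>i<g. q i * ms i)"
      using that by (simp add: N_def algebra_simps sum.distrib sum_distrib_left)
    also have "\<dots> = (\<Sum>i<Suc g. M $$ (i, j) * ms i)" by (simp add: y)
    finally show ?thesis using rel that by simp
  qed
  have minor: "det (mat_delete N g j) \<in> J" if j: "j < Suc g" for j
  proof -
    have D: "mat_delete N g j \<in> carrier_mat g g" using N by (auto simp: mat_delete_def)
    define s where "s j' = (if j' < j then j' else Suc j')" for j'
    have idx: "mat_delete N g j $$ (i', j') = N $$ (i', s j')" if "i' < g" "j' < g" for i' j'
      using that N j by (auto simp: mat_delete_def s_def)
    have s: "s j' < Suc g" "s j' \<noteq> j" if "j' < g" for j'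
      using that j by (auto simp: s_def)
    \<comment> \<open>Position of the free column after deletion of column \<open>j\<close>. For
      \<open>j = k\<close> all remaining columns are relations and any index below \<open>g\<close>
      serves, hence 0.\<close>
    define k' where "k' = (if k < j then k else if k = j then 0 else k - 1)"
    have k': "k' < g" using k j g by (auto simp: k'_def)
    have sk: "s j' \<noteq> k" if "j' \<noteq> k'" for j'
      using that by (auto simp: s_def k'_def split: if_splits)
    show ?thesis
      using T[unfolded rel_dets_in_def, rule_format, OF D k'] idx s NR Nrel sk by simp
  qed
  have "det N = (\<Sum>j<Suc g. N $$ (g, j) * cofactor N g j)"
    by (rule laplace_expansion_row[OF N]) simp
  also have "\<dots> \<in> J"
  proof (rule ideal_sum_mem[OF J])
    fix j assume "j \<in> {..<Suc g}"
    then have j: "j < Suc g" by simp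
    have "N $$ (g, j) * (- 1) ^ (g + j) \<in> R"
      using NR[OF _ j] by (intro mult_mem power_mem uminus_mem one_mem) auto
    with J minor[OF j] have "(N $$ (g, j) * (- 1) ^ (g + j)) * det (mat_delete N g j) \<in> J"
      unfolding ideal_ring_of_iff by blast
    then show "N $$ (g, j) * cofactor N g j \<in> J" by (simp add: cofactor_def mult_ac)
  qed
  finally show "det M \<in> J"
    unfolding N_def det_add_multiples_of_last_row[OF M] .
qed

text \<open>Adjoining \<open>a\<close> and \<open>b\<close> to the generators compares two
  generating systems in one matrix. Its first \<open>g\<close> columns are the relations
  \<open>ms j - p j a - p' j b = 0\<close>, the next is the free column \<open>(x', y')\<close>, the
  last is the relation \<open>(x, y)\<close>. Block triangularity leaves the 2 x 2
  determinant.\<close>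

lemma rel_dets_in_pair:
  assumes J: "ideal J (ring_of R)" and T: "rel_dets_in R J g ms" and g: "g > 0"
    and p: "\<And>j. j < g \<Longrightarrow> p j \<in> R \<and> p' j \<in> R \<and> ms j = p j * a + p' j * b"
    and q: "\<And>i. i < g \<Longrightarrow> q i \<in> R \<and> q' i \<in> R"
    and ab: "a = (\<Sum>i<g. q i * ms i)" "b = (\<Sum>i<g. q' i * ms i)"
    and R: "x \<in> R" "x' \<in> R" "y \<in> R" "y' \<in> R" and rel: "x * a + y * b = 0"
  shows "x' * y - y' * x \<in> J"
proof -
  define ms' where "ms' = ms(g := a, Suc g := b)"
  have "rel_dets_in R J g ms'"
    using T by (auto simp: rel_dets_in_def ms'_def)
  then have "rel_dets_in R J (Suc g) ms'"
    by (rule rel_dets_in_Suc[OF J _ g, of _ q]) (use q ab in \<open>auto simp: ms'_def\<close>)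
  then have T': "rel_dets_in R J (Suc (Suc g)) ms'"
    \<comment> \<open>\<open>a\<close> now has index \<open>g\<close>; the expression of
      \<open>b\<close> uses it with coefficient 0.\<close>
    by (rule rel_dets_in_Suc[OF J, of _ _ "q'(g := 0)"])
      (use q ab zero_mem in \<open>auto simp: ms'_def\<close>)
  define A3 where "A3 = Matrix.mat 2 g (\<lambda>(i, j). if i = 0 then - p j else - p' j)"
  define A4 where "A4 = Matrix.mat 2 2
      (\<lambda>(i, j). if j = 0 then (if i = 0 then x' else y') else (if i = 0 then x else y))"
  define M where "M = four_block_mat (1\<^sub>m g) (0\<^sub>m g 2) A3 A4"
  have M: "M \<in> carrier_mat (Suc (Suc g)) (Suc (Suc g))"
    unfolding M_def carrier_mat_def by (simp add: A4_def)
  have idx: "M $$ (i, j) = (if i < g then (if i = j then 1 else 0) else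
      if j < g then (if i = g then - p j else - p' j)
      else if j = g then (if i = g then x' else y') else (if i = g then x else y))"
    if "i < Suc (Suc g)" "j < Suc (Suc g)" for i j
    using that by (auto simp: M_def A3_def A4_def)
  have "det M = det (1\<^sub>m g :: 'a mat) * det A4"
    unfolding M_def by (rule det_four_block_mat_upper_right_zero[of _ _ _ 2])
      (auto simp: A3_def A4_def)
  also have "det A4 = x' * y - y' * x"
    by (subst det_2x2[of A4]) (auto simp: A4_def algebra_simps)
  finally have det: "det M = x' * y - y' * x" by simp
  have "det M \<in> J"
  proof (rule T'[unfolded rel_dets_in_def, rule_format, OF M, of g])
    fix i j assume "i < Suc (Suc g)" "j < Suc (Suc g)"
    then show "M $$ (i, j) \<in> R"
      using p R by (auto simp: idx one_mem zero_mem uminus_mem)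
  next
    fix j assume j: "j < Suc (Suc g)" "j \<noteq> g"
    have "(\<Sum>i<g. M $$ (i, j) * ms' i) = (\<Sum>i<g. if i = j then ms i else 0)"
      by (intro sum.cong refl) (use j in \<open>auto simp: idx ms'_def\<close>)
    then have "(\<Sum>i<Suc (Suc g). M $$ (i, j) * ms' i)
        = (if j < g then ms j else 0) + M $$ (g, j) * a + M $$ (Suc g, j) * b"
      by (simp add: ms'_def)
    then show "(\<Sum>i<Suc (Suc g). M $$ (i, j) * ms' i) = 0"
      using j p rel by (auto simp: idx)
  qed simp
  with det show ?thesis by simp
qed

section \<open>Minors of an arbitrary presentation\<close>

lemma free_vecs_iff: "v \<in> free_vecs R n \<longleftrightarrow> v \<in> carrier_vec n \<and> (\<forall>i<n. v $ i \<in> R)"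
  by (auto simp: free_vecs_def vec_set_def)

text \<open>Excludes \<open>g = 0\<close>, for which the size \<open>g - 1\<close> of the minors
  would be truncated to 0.\<close>

lemma presentation_rank_pos:
  assumes "presentation R I g ms C" "I \<noteq> {0}"
  shows "g > 0"
proof (rule ccontr)
  assume "\<not> g > 0"
  with assms(1) have "ms \<in> carrier_vec 0" and Ieq: "I = {v \<bullet> ms | v. v \<in> free_vecs R 0}"
    by (simp_all add: presentation_def)
  then have "I = {0}"
    by (auto simp: free_vecs_iff scalar_prod_def intro!: exI[of _ "vec 0 undefined"])
  with assms(2) show False by simp
qed

lemma in_span_of_columns:
  assumes "v \<in> C" "v \<in> carrier_vec g"
  shows "v \<in> {A *\<^sub>v c | A c k. A \<in> carrier_mat g k \<and> set (cols A) \<subseteq> C \<and> c \<in> free_vecs R k}"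
proof -
  have "v = mat_of_cols g [v] *\<^sub>v vec 1 (\<lambda>_. 1)"
    using assms by (intro eq_vecI) (auto simp: scalar_prod_def mat_of_cols_def)
  moreover have "vec 1 (\<lambda>_. 1) \<in> free_vecs R 1" by (auto simp: free_vecs_iff one_mem)
  moreover have "set (cols (mat_of_cols g [v])) \<subseteq> C" using assms by simp
  moreover have "mat_of_cols g [v] \<in> carrier_mat g 1"
    using mat_of_cols_carrier(1)[of g "[v]"] by simp
  ultimately show ?thesis
    by (intro CollectI exI[of _ "mat_of_cols g [v]"] exI[of _ "vec 1 (\<lambda>_. 1)"] exI[of _ 1]) simp
qed

lemma presentation_entry_mem:
  assumes "presentation R I g ms C" "j < g"
  shows "ms $ j \<in> I"
proof -
  have "ms $ j = unit_vec g j \<bullet> ms" using assms by (simp add: presentation_def)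
  moreover have "unit_vec g j \<in> free_vecs R g"
    by (auto simp: free_vecs_iff unit_vec_def one_mem zero_mem)
  ultimately show ?thesis using assms(1) unfolding presentation_def by blast
qed

text \<open>Completing the minor by the unit vector of the omitted row gives a \<open>g\<close> x
  \<open>g\<close> matrix \<open>M\<close> with the same determinant, all of whose other columns are
  relations. By Cramer's rule \<open>det M / ms' n\<close> multiplies every generator into
  \<open>R\<close>, so the minor is an element of (R : I) times
  \<open>ms' n \<in> I\<close>.\<close>

lemma minor_mem:
  fixes I :: "'a set"
  assumes pres: "presentation R I g ms C" and I: "I \<noteq> {0}" and n: "n = g - 1"
    and \<rho>: "\<rho> \<in> {..<n} \<rightarrow> {..<g}" "inj_on \<rho> {..<n}" and c: "c \<in> {..<n} \<rightarrow> C"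
    and F: "0 \<in> F" "\<And>l x. \<forall>m\<in>I. l * m \<in> R \<Longrightarrow> x \<in> I \<Longrightarrow> l * x \<in> F"
  shows "det (Matrix.mat n n (\<lambda>(p, q). c q $ \<rho> p)) \<in> F"
proof -
  have ms: "ms \<in> carrier_vec g" and Ieq: "I = {v \<bullet> ms | v. v \<in> free_vecs R g}"
    and C: "C \<subseteq> free_vecs R g"
    and L: "{v \<in> free_vecs R g. v \<bullet> ms = 0} =
       {A *\<^sub>v c | A c k. A \<in> carrier_mat g k \<and> set (cols A) \<subseteq> C \<and> c \<in> free_vecs R k}"
    using pres by (auto simp: presentation_def)
  have Crel: "v \<bullet> ms = 0" if "v \<in> C" for v
  proof -
    have "v \<in> carrier_vec g" using that C by (auto simp: free_vecs_def)
    from in_span_of_columns[OF that this] show ?thesis using L by blast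
  qed
  have "g > 0" by (rule presentation_rank_pos[OF pres I])
  then have gn: "g = Suc n" using n by simp
  obtain i where i: "{..<g} - \<rho> ` {..<n} = {i}"
  proof -
    have "card ({..<g} - \<rho> ` {..<n}) = 1"
      using \<rho> gn by (subst card_Diff_subset) (auto simp: card_image)
    then show thesis using that by (auto simp: card_1_singleton_iff)
  qed
  \<comment> \<open>\<open>r\<close> lists the selected rows first and the omitted row
    \<open>i\<close> last, so that the minor sits in the upper left corner of
    \<open>M\<close>.\<close>
  define r where "r p = (if p < n then \<rho> p else i)" for p
  have rimg: "r ` {..<g} = {..<g}"
  proof -
    have "r ` {..<g} = \<rho> ` {..<n} \<union> {i}"
      unfolding gn by (auto simp: r_def lessThan_Suc)
    then show ?thesis using i \<rho> by auto
  qed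
  then have r: "bij_betw r {..<g} {..<g}"
    by (simp add: bij_betw_def eq_card_imp_inj_on)
  define ms' where "ms' p = ms $ r p" for p
  define M where "M = Matrix.mat g g (\<lambda>(p, q). if q < n then c q $ r p else if p = n then 1 else 0)"
  have M: "M \<in> carrier_mat g g" by (simp add: M_def)
  have cq: "c q \<in> carrier_vec g" "\<And>l. l < g \<Longrightarrow> c q $ l \<in> R" "c q \<in> C" if "q < n" for q
    using c C that by (fastforce simp: free_vecs_def vec_set_def)+
  have MR: "M $$ (p, q) \<in> R" if "p < g" "q < g" for p q
    using that cq(2)[of q] rimg by (auto simp: M_def one_mem zero_mem)
  have rel: "(\<Sum>l<g. M $$ (l, j) * ms' l) = 0" if "j < g" "j \<noteq> n" for j
  proof -
    have j: "j < n" using that gn by simp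
    have "(\<Sum>l<g. M $$ (l, j) * ms' l) = (\<Sum>l<g. c j $ r l * ms $ r l)"
      using that j by (auto simp: M_def ms'_def)
    also have "\<dots> = (\<Sum>l<g. c j $ l * ms $ l)"
      by (rule sum.reindex_bij_betw[OF r])
    also have "\<dots> = c j \<bullet> ms" using ms by (simp add: scalar_prod_sum)
    finally show ?thesis using Crel cq j by simp
  qed
  have "(\<Sum>l<g. M $$ (l, n) * ms' l) = ms' n"
    by (simp add: M_def gn)
  with det_mult_relations[OF M _ rel, of n]
  have adj: "det M * ms' p = cofactor M p n * ms' n" if "p < g" for p
    using that gn by simp
  have "det M = (\<Sum>p<g. M $$ (p, n) * cofactor M p n)"
    by (rule laplace_expansion_column[OF M]) (simp add: gn)
  also have "\<dots> = cofactor M n n" by (simp add: M_def gn)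
  also have "mat_delete M n n = Matrix.mat n n (\<lambda>(p, q). c q $ \<rho> p)"
    by (rule eq_matI) (auto simp: M_def gn r_def mat_delete_def)
  then have "cofactor M n n = det (Matrix.mat n n (\<lambda>(p, q). c q $ \<rho> p))"
    by (simp add: cofactor_def)
  finally have det: "det M = det (Matrix.mat n n (\<lambda>(p, q). c q $ \<rho> p))" .
  have Isum: "\<exists>v. (\<forall>p<g. v p \<in> R) \<and> x = (\<Sum>p<g. v p * ms' p)" if x: "x \<in> I" for x
  proof -
    obtain v where v: "v \<in> free_vecs R g" "x = v \<bullet> ms" using x Ieq by blast
    then have "x = (\<Sum>p<g. v $ r p * ms $ r p)"
      using ms by (simp add: scalar_prod_sum sum.reindex_bij_betw[OF r, of "\<lambda>p. v $ p * ms $ p"])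
    moreover have "v $ r p \<in> R" if "p < g" for p
      using v rimg that by (fastforce simp: free_vecs_def vec_set_def)
    ultimately show ?thesis unfolding ms'_def by (intro exI[of _ "\<lambda>p. v $ r p"]) simp
  qed
  have msI: "ms' p \<in> I" if "p < g" for p
  proof -
    have "r p < g" using rimg that by blast
    then show ?thesis unfolding ms'_def by (rule presentation_entry_mem[OF pres])
  qed
  have "det M \<in> F"
  proof (cases "ms' n = 0")
    \<comment> \<open>\<open>det M\<close> kills all generators, one of which is not 0; in a field
      it vanishes.\<close>
    case True
    have "\<exists>p<g. ms' p \<noteq> 0"
    proof (rule ccontr)
      assume "\<not> ?thesis"
      then have "x = 0" if "x \<in> I" for x using Isum[OF that] by force
      moreover have "ms' n \<in> I" using msI gn by simp
      ultimately show False using I by force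
    qed
    then obtain p where "p < g" "ms' p \<noteq> 0" by blast
    with adj[of p] True F(1) show ?thesis by simp
  next
    case False
    define l where "l = det M / ms' n"
    have lms: "l * ms' p \<in> R" if "p < g" for p
    proof -
      have "l * ms' p = cofactor M p n"
        using adj[OF that] False by (simp add: l_def field_simps)
      then show ?thesis using cofactor_mem[OF M MR that] gn by simp
    qed
    have "l * x \<in> R" if "x \<in> I" for x
    proof -
      obtain v where v: "\<And>p. p < g \<Longrightarrow> v p \<in> R" "x = (\<Sum>p<g. v p * ms' p)"
        using Isum[OF \<open>x \<in> I\<close>] by blast
      then have "l * x = (\<Sum>p<g. v p * (l * ms' p))" by (simp add: sum_distrib_left mult_ac)
      also have "\<dots> \<in> R" by (intro sum_mem mult_mem v lms) auto
      finally show ?thesis .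
    qed
    then have "l * ms' n \<in> F" using F(2) msI[of n] gn by blast
    then show ?thesis using False by (simp add: l_def)
  qed
  with det show ?thesis by simp
qed

text \<open>By multilinearity of the determinant, minors of arbitrary relations lie in the ideal of minors
  of generating relations.\<close>

lemma minors_ideal_rel_dets_in:
  assumes pres: "presentation R I g ms C" and g: "g > 0"
  shows "rel_dets_in R (minors_ideal R g C 1) g (($) ms)"
proof -
  have ms: "ms \<in> carrier_vec g" and C: "C \<subseteq> free_vecs R g"
    and L: "{v \<in> free_vecs R g. v \<bullet> ms = 0} =
       {A *\<^sub>v c | A c k. A \<in> carrier_mat g k \<and> set (cols A) \<subseteq> C \<and> c \<in> free_vecs R k}"
    using pres by (auto simp: presentation_def)
  define n where "n = g - 1"
  have gn: "g = Suc n" using g by (simp add: n_def)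
  define G where "G = {det (Matrix.mat n n (\<lambda>(p, q). vec_index (c q) (\<rho> p))) | \<rho> c.
       \<rho> \<in> {..<n} \<rightarrow> {..<g} \<and> inj_on \<rho> {..<n} \<and> c \<in> {..<n} \<rightarrow> C \<and> inj_on c {..<n}}"
  define J where "J = Idl\<^bsub>ring_of R\<^esub> G"
  have Jeq: "minors_ideal R g C 1 = J"
    by (simp add: minors_ideal_def Let_def J_def G_def n_def)
  have CR: "v $ l \<in> R" if "v \<in> C" "l < g" for v l
    using that C by (fastforce simp: free_vecs_def vec_set_def)
  have "G \<subseteq> R"
  proof
    fix d assume "d \<in> G"
    then obtain \<rho> c where *: "d = det (Matrix.mat n n (\<lambda>(p, q). vec_index (c q) (\<rho> p)))"
      "\<rho> \<in> {..<n} \<rightarrow> {..<g}" "c \<in> {..<n} \<rightarrow> C" unfolding G_def by blast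
    have "vec_index (c q) (\<rho> p) \<in> R" if "p < n" "q < n" for p q
      by (rule CR) (use *(2,3) that in \<open>auto simp: Pi_iff\<close>)
    then show "d \<in> R" unfolding * by (intro det_mem[of _ n]) auto
  qed
  then have J: "ideal J (ring_of R)" "G \<subseteq> J"
    unfolding J_def using ideal_genideal genideal_subset_iff[of G "Idl\<^bsub>ring_of R\<^esub> G"] by auto
  \<comment> \<open>If all columns except \<open>k\<close> are in \<open>C\<close>, expansion along
    column \<open>k\<close> leaves minors of generating relations.\<close>
  have base: "det M \<in> J" if M: "M \<in> carrier_mat g g" and k: "k < g"
    and MR: "\<forall>i<g. \<forall>j<g. M $$ (i, j) \<in> R" and MC: "\<And>j. j < g \<Longrightarrow> j \<noteq> k \<Longrightarrow> col M j \<in> C" for M k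
  proof -
    have minor: "det (mat_delete M i k) \<in> J" if i: "i < g" for i
    proof -
      define \<rho> where "\<rho> p = (if p < i then p else Suc p)" for p
      define c where "c q = col M (if q < k then q else Suc q)" for q
      have D: "mat_delete M i k \<in> carrier_mat n n" using M gn by (auto simp: mat_delete_def)
      have eq: "mat_delete M i k = Matrix.mat n n (\<lambda>(p, q). vec_index (c q) (\<rho> p))"
        using M gn i k by (intro eq_matI) (auto simp: mat_delete_def \<rho>_def c_def)
      show ?thesis
      proof (cases "inj_on c {..<n}")
        case True
        have "\<rho> \<in> {..<n} \<rightarrow> {..<g}" "inj_on \<rho> {..<n}" "c \<in> {..<n} \<rightarrow> C"
          using gn k MC by (auto simp: \<rho>_def c_def inj_on_def split: if_splits)
        with True have "det (mat_delete M i k) \<in> G" unfolding eq G_def by blast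
        with J(2) show ?thesis by blast
      next
        \<comment> \<open>\<open>minors_ideal\<close> admits only distinct columns; a minor with a
          repeated column is 0.\<close>
        case False
        then obtain p q where pq: "p < n" "q < n" "p \<noteq> q" "c p = c q"
          by (auto simp: inj_on_def)
        have "det (mat_delete M i k) = 0"
          by (rule det_identical_columns[OF D pq(3,1,2)]) (use pq in \<open>auto simp: eq intro!: eq_vecI\<close>)
        then show ?thesis using J(1) by (simp add: ideal_ring_of_iff)
      qed
    qed
    have "det M = (\<Sum>i<g. M $$ (i, k) * cofactor M i k)"
      by (rule laplace_expansion_column[OF M k])
    also have "\<dots> \<in> J"
    proof (rule ideal_sum_mem[OF J(1)])
      fix i assume "i \<in> {..<g}"
      then have i: "i < g" by simp
      have "M $$ (i, k) * (- 1) ^ (i + k) \<in> R"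
        using MR i k by (intro mult_mem power_mem uminus_mem one_mem) auto
      with J(1) minor[OF i] have "(M $$ (i, k) * (- 1) ^ (i + k)) * det (mat_delete M i k) \<in> J"
        unfolding ideal_ring_of_iff by blast
      then show "M $$ (i, k) * cofactor M i k \<in> J" by (simp add: cofactor_def mult_ac)
    qed
    finally show ?thesis .
  qed
  \<comment> \<open>Induction on the number \<open>t\<close> of leading columns that may be
    arbitrary relations. The last of these is a combination of columns in \<open>C\<close>, and
    linearity in that column gives the matrices \<open>N l\<close> with one arbitrary relation
    fewer.\<close>
  have step: "det M \<in> J" if "t \<le> g" "M \<in> carrier_mat g g" "k < g" "\<forall>i<g. \<forall>j<g. M $$ (i, j) \<in> R"
    "\<And>j. j < g \<Longrightarrow> j \<noteq> k \<Longrightarrow> t \<le> j \<Longrightarrow> col M j \<in> C"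
    "\<And>j. j < t \<Longrightarrow> j \<noteq> k \<Longrightarrow> col M j \<bullet> ms = 0" for t M k
    using that
  proof (induction t arbitrary: M)
    case 0
    then show ?case by (intro base[of M k]) auto
  next
    case (Suc t)
    note M = Suc.prems(2) and MR = Suc.prems(4)
    have t: "t < g" using Suc.prems by simp
    show ?case
    proof (cases "t = k")
      case True
      show ?thesis
      proof (rule Suc.IH[OF _ M Suc.prems(3) MR])
        show "col M j \<in> C" if "j < g" "j \<noteq> k" "t \<le> j" for j
          using that True by (intro Suc.prems(5)) auto
        show "col M j \<bullet> ms = 0" if "j < t" "j \<noteq> k" for j
          using that by (intro Suc.prems(6)) auto
      qed (use t in simp)
    next
      case False
      then have "col M t \<in> {v \<in> free_vecs R g. v \<bullet> ms = 0}"
        using Suc.prems(6)[of t] M MR t by (auto simp: free_vecs_def vec_set_def)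
      then obtain A c r where A: "col M t = A *\<^sub>v c" "A \<in> carrier_mat g r" "set (cols A) \<subseteq> C"
        "c \<in> free_vecs R r"
        unfolding L by blast
      have c: "c \<in> carrier_vec r" "\<And>l. l < r \<Longrightarrow> c $ l \<in> R"
        using A(4) by (fastforce simp: free_vecs_def vec_set_def)+
      have colA: "col A l \<in> C" if "l < r" for l
        using A(2,3) that by (metis carrier_matD(2) cols_length cols_nth nth_mem subsetD)
      define N where "N l = Matrix.mat g g (\<lambda>(i, j). if j = t then A $$ (i, l) else M $$ (i, j))" for l
      have N: "N l \<in> carrier_mat g g" for l by (simp add: N_def)
      have colN: "col (N l) j = (if j = t then col A l else col M j)" if "j < g" "l < r" for l j
        using that M A(2) t by (auto simp: N_def intro!: eq_vecI)
      have detNJ: "det (N l) \<in> J" if l: "l < r" for l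
      proof (rule Suc.IH[OF _ N Suc.prems(3)])
        have "A $$ (i, l) \<in> R" if "i < g" for i
          using CR[OF colA[OF l] that] A(2) l that by simp
        then show "\<forall>i<g. \<forall>j<g. N l $$ (i, j) \<in> R"
          using MR by (auto simp: N_def)
        show "col (N l) j \<in> C" if "j < g" "j \<noteq> k" "t \<le> j" for j
          using that colN[OF that(1) l] colA[OF l] Suc.prems(5)[of j] by (cases "j = t") auto
        show "col (N l) j \<bullet> ms = 0" if "j < t" "j \<noteq> k" for j
          using that colN[of j l] t l Suc.prems(6)[of j] by auto
      qed (use t in simp)
      have "cofactor (N l) i t = cofactor M i t" if "i < g" for i l
      proof -
        have "mat_delete (N l) i t = mat_delete M i t"
          using M that t by (intro eq_matI) (auto simp: mat_delete_def N_def)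
        then show ?thesis by (simp add: cofactor_def)
      qed
      then have detN: "det (N l) = (\<Sum>i<g. A $$ (i, l) * cofactor M i t)" for l
        by (subst laplace_expansion_column[OF N t]) (use t in \<open>auto simp: N_def\<close>)
      have "det M = (\<Sum>i<g. M $$ (i, t) * cofactor M i t)"
        by (rule laplace_expansion_column[OF M t])
      also have "\<dots> = (\<Sum>i<g. (\<Sum>l<r. A $$ (i, l) * c $ l) * cofactor M i t)"
      proof (intro sum.cong refl arg_cong2[of _ _ _ _ "(*)"])
        fix i assume "i \<in> {..<g}"
        then have "M $$ (i, t) = (A *\<^sub>v c) $ i" using A(1) M t by (metis carrier_matD index_col lessThan_iff)
        then show "M $$ (i, t) = (\<Sum>l<r. A $$ (i, l) * c $ l)"
          using \<open>i \<in> {..<g}\<close> A(2) c(1) by (auto simp: scalar_prod_sum)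
      qed
      also have "\<dots> = (\<Sum>l<r. c $ l * det (N l))"
        unfolding detN sum_distrib_left sum_distrib_right
        by (subst sum.swap) (simp add: mult_ac)
      also have "\<dots> \<in> J"
        using J(1) c(2) detNJ by (intro ideal_sum_mem[OF J(1)]) (auto simp: ideal_ring_of_iff)
      finally show ?thesis .
    qed
  qed
  show ?thesis
    unfolding Jeq rel_dets_in_def
  proof (intro allI impI)
    fix M k assume M: "M \<in> carrier_mat g g" "k < g" "\<forall>i<g. \<forall>j<g. M $$ (i, j) \<in> R"
      and rel: "\<forall>j<g. j \<noteq> k \<longrightarrow> (\<Sum>i<g. M $$ (i, j) * ms $ i) = 0"
    show "det M \<in> J"
      by (rule step[of g, OF _ M]) (use rel M ms in \<open>auto simp: scalar_prod_sum\<close>)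
  qed
qed

text \<open>\<open>upper\<close> places (R : I) I, and with it every minor, inside \<open>F\<close>.
  In \<open>lower\<close>, unit vectors \<open>(x', y')\<close> turn the determinants into the
  entries of the relations between \<open>a\<close> and \<open>b\<close>, which are the 1 x 1 minors
  for two generators; so \<open>F\<close> has to lie in the ideal generated by these
  entries.\<close>

theorem fitting_ideal_1_eq:
  fixes I :: "'a set"
  assumes ab: "I = {r * a + s * b | r s. r \<in> R \<and> s \<in> R}" and I: "I \<noteq> {0}"
    and F: "ideal F (ring_of R)"
    and upper: "\<And>l x. \<forall>m\<in>I. l * m \<in> R \<Longrightarrow> x \<in> I \<Longrightarrow> l * x \<in> F"
    and lower: "\<And>J. ideal J (ring_of R) \<Longrightarrow>
      (\<And>x y x' y'. x \<in> R \<Longrightarrow> y \<in> R \<Longrightarrow> x' \<in> R \<Longrightarrow> y' \<in> R \<Longrightarrow> x * a + y * b = 0 \<Longrightarrow> x' * y - y' * x \<in> J)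
      \<Longrightarrow> F \<subseteq> J"
  shows "fitting_ideal 1 R I = F"
proof -
  have minors: "F = minors_ideal R g C 1" if pres: "presentation R I g ms C" for g ms C
  proof
    have ms: "ms \<in> carrier_vec g" and Ieq: "I = {v \<bullet> ms | v. v \<in> free_vecs R g}"
      and C: "C \<subseteq> free_vecs R g"
      using pres by (auto simp: presentation_def)
    have g: "g > 0" by (rule presentation_rank_pos[OF pres I])
    define n where "n = g - 1"
    define G where "G = {det (Matrix.mat n n (\<lambda>(p, q). vec_index (c q) (\<rho> p))) | \<rho> c.
       \<rho> \<in> {..<n} \<rightarrow> {..<g} \<and> inj_on \<rho> {..<n} \<and> c \<in> {..<n} \<rightarrow> C \<and> inj_on c {..<n}}"
    have Jeq: "minors_ideal R g C 1 = Idl\<^bsub>ring_of R\<^esub> G"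
      by (simp add: minors_ideal_def Let_def G_def n_def)
    have "G \<subseteq> F"
      unfolding G_def using minor_mem[OF pres I n_def, of _ _ F] F upper
      by (auto simp: ideal_ring_of_iff)
    moreover from this F have "G \<subseteq> R" by (auto simp: ideal_ring_of_iff)
    ultimately show "minors_ideal R g C 1 \<subseteq> F"
      unfolding Jeq using genideal_subset_iff F by blast
    have J: "ideal (minors_ideal R g C 1) (ring_of R)"
      unfolding Jeq by (rule ideal_genideal) fact
    have comb: "\<exists>q. (\<forall>i<g. q i \<in> R) \<and> x = (\<Sum>i<g. q i * ms $ i)" if x: "x \<in> I" for x
    proof -
      obtain v where v: "v \<in> free_vecs R g" "x = v \<bullet> ms" using x Ieq by blast
      then have "\<forall>i<g. v $ i \<in> R" by (auto simp: free_vecs_def vec_set_def)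
      moreover have "x = (\<Sum>i<g. v $ i * ms $ i)" using v ms by (simp add: scalar_prod_sum)
      ultimately show ?thesis by (intro exI[of _ "($) v"]) simp
    qed
    have "ms $ j \<in> I" if "j < g" for j
      by (rule presentation_entry_mem[OF pres that])
    then have "\<forall>j. \<exists>p p'. j < g \<longrightarrow> p \<in> R \<and> p' \<in> R \<and> ms $ j = p * a + p' * b"
      using ab by blast
    then obtain p p' where p: "\<And>j. j < g \<Longrightarrow> p j \<in> R \<and> p' j \<in> R \<and> ms $ j = p j * a + p' j * b"
      by metis
    have "a \<in> I" unfolding ab using one_mem zero_mem by (intro CollectI exI[of _ 1] exI[of _ 0]) simp
    then obtain q where q: "\<forall>i<g. q i \<in> R" "a = (\<Sum>i<g. q i * ms $ i)" using comb by blast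
    have "b \<in> I" unfolding ab using one_mem zero_mem by (intro CollectI exI[of _ 0] exI[of _ 1]) simp
    then obtain q' where q': "\<forall>i<g. q' i \<in> R" "b = (\<Sum>i<g. q' i * ms $ i)" using comb by blast
    show "F \<subseteq> minors_ideal R g C 1"
    proof (rule lower[OF J])
      fix x y x' y' assume xy: "x \<in> R" "y \<in> R" "x' \<in> R" "y' \<in> R" "x * a + y * b = 0"
      show "x' * y - y' * x \<in> minors_ideal R g C 1"
        by (rule rel_dets_in_pair[OF J minors_ideal_rel_dets_in[OF pres g] g p _ q(2) q'(2) xy(1,3,2,4,5)])
          (use q(1) q'(1) in auto)
    qed
  qed
  \<comment> \<open>Without a presentation every set would satisfy the description in
    \<open>fitting_ideal\<close>. The generators \<open>a\<close> and \<open>b\<close>, with all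
    their relations as columns, provide one.\<close>
  have ex: "\<exists>g ms C. presentation R I g ms C"
  proof -
    define ms where "ms = vec 2 (\<lambda>i. if i = 0 then a else b)"
    define L where "L = {v \<in> free_vecs R 2. v \<bullet> ms = 0}"
    have ms: "ms \<in> carrier_vec 2" "ms $ 0 = a" "ms $ 1 = b"
      by (simp_all add: ms_def)
    have sp: "v \<bullet> ms = v $ 0 * a + v $ 1 * b" for v
      using ms by (simp add: scalar_prod_sum numeral_2_eq_2)
        have "I = {v \<bullet> ms | v. v \<in> free_vecs R 2}"
    proof (rule subset_antisym; rule subsetI)
      fix x assume "x \<in> I"
      then obtain r s where rs: "r \<in> R" "s \<in> R" "x = r * a + s * b" using ab by blast
      have "vec 2 (\<lambda>i. if i = 0 then r else s) \<in> free_vecs R 2"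
        using rs by (simp add: free_vecs_iff)
      then show "x \<in> {v \<bullet> ms | v. v \<in> free_vecs R 2}"
        using rs by (intro CollectI exI[of _ "vec 2 (\<lambda>i. if i = 0 then r else s)"]) (simp add: sp)
    next
      fix x assume "x \<in> {v \<bullet> ms | v. v \<in> free_vecs R 2}"
      then obtain v where "x = v $ 0 * a + v $ 1 * b" "v $ 0 \<in> R" "v $ 1 \<in> R"
        by (auto simp: sp free_vecs_iff)
      then show "x \<in> I" using ab by blast
    qed
    moreover have "L = {A *\<^sub>v c | A c k. A \<in> carrier_mat 2 k \<and> set (cols A) \<subseteq> L \<and> c \<in> free_vecs R k}"
    proof (rule subset_antisym; rule subsetI)
      fix v assume "v \<in> L"
      then have "v \<in> carrier_vec 2" by (simp add: L_def free_vecs_def)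
      with \<open>v \<in> L\<close> show "v \<in> {A *\<^sub>v c | A c k. A \<in> carrier_mat 2 k \<and> set (cols A) \<subseteq> L \<and> c \<in> free_vecs R k}"
        by (rule in_span_of_columns)
    next
      fix v assume "v \<in> {A *\<^sub>v c | A c k. A \<in> carrier_mat 2 k \<and> set (cols A) \<subseteq> L \<and> c \<in> free_vecs R k}"
      then obtain A c k where A: "v = A *\<^sub>v c" "A \<in> carrier_mat 2 k" "set (cols A) \<subseteq> L" "c \<in> free_vecs R k"
        by blast
      have colA: "col A l \<in> L" if "l < k" for l
        using A(2,3) that by (metis carrier_matD(2) cols_length cols_nth nth_mem subsetD)
      have A1: "A $$ (i, l) \<in> R" if "i < 2" "l < k" for i l
        using colA[OF that(2)] that A(2) by (auto simp: L_def free_vecs_iff)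
      have A2: "A $$ (0, l) * a + A $$ (1, l) * b = 0" if "l < k" for l
        using colA[OF that] that A(2) by (auto simp: L_def sp)
      have vi: "v $ i = (\<Sum>l<k. A $$ (i, l) * c $ l)" if "i < 2" for i
        using that A(1,2,4) by (auto simp: free_vecs_iff scalar_prod_sum)
      have "v \<bullet> ms = (\<Sum>l<k. c $ l * (A $$ (0, l) * a + A $$ (1, l) * b))"
        by (simp add: sp vi sum_distrib_left sum_distrib_right sum.distrib algebra_simps)
      also have "\<dots> = 0" using A2 by simp
      finally have "v \<bullet> ms = 0" .
      moreover have "v $ i \<in> R" if "i < 2" for i
        unfolding vi[OF that] using A1 A(4) that by (intro sum_mem mult_mem) (auto simp: free_vecs_iff)
      moreover have "v \<in> carrier_vec 2"
        unfolding A(1) by (rule mult_mat_vec_carrier[OF A(2)]) (use A(4) in \<open>simp add: free_vecs_iff\<close>)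
      ultimately show "v \<in> L" by (simp add: L_def free_vecs_iff)
    qed
    moreover have "L \<subseteq> free_vecs R 2" by (auto simp: L_def)
    ultimately have "presentation R I 2 ms L"
      unfolding presentation_def using ms(1) L_def by simp
    then show ?thesis by blast
  qed
  show ?thesis
    unfolding fitting_ideal_def
    by (rule the_equality) (use minors ex in auto)
qed

end

section \<open>Lattices in quadratic fields\<close>

text \<open>The lattice \<open>al (\<int> + \<int> t)\<close>, where \<open>t\<close> is a root of the primitive polynomial \<open>a X\<^sup>2 + b X + c\<close>. Its
  ring of multipliers is \<open>S = \<int> + \<int> a t\<close>; \<open>R\<close> is the subring of \<open>S\<close> of index \<open>g\<close>, and \<open>F = g S\<close>.\<close>

locale quad_lattice =
  fixes al t :: "'a::field_char_0" and a b c g :: int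
  assumes al: "al \<noteq> 0" and root: "of_int a * t\<^sup>2 + of_int b * t + of_int c = 0"
    and irrational: "\<And>x y :: int. of_int x + of_int y * t = 0 \<Longrightarrow> y = 0"
    and primitive: "\<exists>u v w. u * a + v * b + w * c = 1"
    and g_pos: "g > 0"
begin

text \<open>Scaling the root by the leading coefficient makes it integral: \<open>w\<close> is a
  root of X^2 + b X + a c.\<close>

definition w :: 'a where "w = of_int a * t"

definition S :: "'a set" where "S = {of_int x + of_int y * w | x y. True}"
definition R :: "'a set" where "R = {of_int x + of_int y * (of_int g * w) | x y. True}"
definition F :: "'a set" where "F = {of_int g * s | s. s \<in> S}"
definition I :: "'a set" where "I = {al * (of_int x + of_int y * t) | x y. True}"

definition coord1 :: "'a \<Rightarrow> int" where "coord1 z = (THE x. \<exists>y. z = al * (of_int x + of_int y * t))"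
definition coord2 :: "'a \<Rightarrow> int" where "coord2 z = (THE y. \<exists>x. z = al * (of_int x + of_int y * t))"
definition D :: "'a \<Rightarrow> 'a \<Rightarrow> int" where "D z z' = coord1 z * coord2 z' - coord2 z * coord1 z'"

section \<open>Arithmetic of the orders \<open>R\<close> and \<open>S\<close> and of the ideal
  \<open>F\<close>\<close>

lemma t_unique:
  assumes "of_int x + of_int y * t = of_int x' + of_int y' * t"
  shows "x = x' \<and> y = y'"
proof -
  have "of_int (x - x') + of_int (y - y') * t = 0"
    using assms by (simp add: algebra_simps)
  then have "y = y'" using irrational by fastforce
  with assms show ?thesis by simp
qed

lemma a_nonzero: "a \<noteq> 0"
proof
  assume a: "a = 0"
  then have "of_int c + of_int b * t = 0" using root by (simp add: add.commute)
  then have "c = 0 \<and> b = 0" using t_unique[of c b 0 0] by simp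
  with a primitive show False by simp
qed

lemma w_unique:
  assumes "of_int x + of_int y * w = of_int x' + of_int y' * w"
  shows "x = x' \<and> y = y'"
  using t_unique[of x "y * a" x' "y' * a"] assms a_nonzero by (simp add: w_def mult.assoc)

lemma w_mult_t: "w * t = - of_int b * t - of_int c"
  using root by (simp add: w_def power2_eq_square eq_neg_iff_add_eq_0 algebra_simps)

lemma w_mult_w: "w * w = - of_int b * w - of_int (a * c)"
proof -
  have "w * w = of_int a * (w * t)" by (simp add: w_def)
  also have "\<dots> = - of_int b * w - of_int (a * c)"
    unfolding w_mult_t by (simp add: w_def algebra_simps)
  finally show ?thesis .
qed

lemma S_mult:
  "(of_int x + of_int y * w) * (of_int x' + of_int y' * w)
    = of_int (x * x' - y * y' * a * c) + of_int (x * y' + y * x' - b * y * y') * w"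
proof -
  have "(of_int x + of_int y * w) * (of_int x' + of_int y' * w)
      = of_int (x * x') + of_int (x * y' + y * x') * w + of_int (y * y') * (w * w)"
    by (simp add: algebra_simps)
  then show ?thesis unfolding w_mult_w by (simp add: algebra_simps)
qed

lemma S_mult_I:
  "(of_int x + of_int y * w) * (al * (of_int p + of_int q * t))
    = al * (of_int (x * p - y * q * c) + of_int (x * q + a * y * p - b * y * q) * t)"
proof -
  have "(of_int x + of_int y * w) * (al * (of_int p + of_int q * t))
      = al * (of_int (x * p) + of_int (x * q) * t + of_int (y * p) * w + of_int (y * q) * (w * t))"
    by (simp add: algebra_simps)
  then show ?thesis unfolding w_mult_t by (simp add: w_def algebra_simps)
qed

sublocale S: subset_field S
proof
  show "1 \<in> S" unfolding S_def by (intro CollectI exI[of _ 1] exI[of _ 0]) simp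
next
  fix u v assume "u \<in> S" "v \<in> S"
  then obtain x y x' y' where uv: "u = of_int x + of_int y * w" "v = of_int x' + of_int y' * w"
    unfolding S_def by blast
  have "u - v = of_int (x - x') + of_int (y - y') * w" by (simp add: uv algebra_simps)
  then show "u - v \<in> S" unfolding S_def by blast
  show "u * v \<in> S" unfolding uv S_mult S_def by blast
qed

lemma F_subset_S: "F \<subseteq> S"
  unfolding F_def using S.of_int_mem S.mult_mem by blast

lemma w_mem: "w \<in> S"
  unfolding S_def by (intro CollectI exI[of _ 0] exI[of _ 1]) simp

text \<open>Elements of \<open>R\<close> can thus be replaced by integers in all computations modulo
  \<open>F\<close>.\<close>

lemma R_iff: "r \<in> R \<longleftrightarrow> (\<exists>x. r - of_int x \<in> F)"
proof
  assume "r \<in> R"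
  then obtain x y where "r = of_int x + of_int y * (of_int g * w)" unfolding R_def by blast
  then have "r - of_int x = of_int g * (of_int y * w)" by simp
  then show "\<exists>x. r - of_int x \<in> F"
    unfolding F_def using S.mult_mem[OF S.of_int_mem w_mem] by blast
next
  assume "\<exists>x. r - of_int x \<in> F"
  then obtain x y z where "r - of_int x = of_int g * (of_int y + of_int z * w)"
    unfolding F_def S_def by blast
  then have "r = of_int (x + g * y) + of_int z * (of_int g * w)" by (simp add: algebra_simps)
  then show "r \<in> R" unfolding R_def by blast
qed

lemma F_diff: "u \<in> F \<Longrightarrow> v \<in> F \<Longrightarrow> u - v \<in> F"
  unfolding F_def by (clarsimp simp flip: right_diff_distrib) (use S.diff_mem in blast)

lemma F_mult: "s \<in> S \<Longrightarrow> v \<in> F \<Longrightarrow> s * v \<in> F"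
  unfolding F_def by (clarsimp simp: mult.left_commute[of s]) (use S.mult_mem in blast)

lemma F_zero: "0 \<in> F"
  unfolding F_def using S.zero_mem by force

lemma F_uminus: "u \<in> F \<Longrightarrow> - u \<in> F"
  using F_diff[OF F_zero] by simp

lemma F_add: "u \<in> F \<Longrightarrow> v \<in> F \<Longrightarrow> u + v \<in> F"
  using F_diff[OF _ F_uminus] by force

lemma F_subset_R: "F \<subseteq> R"
  unfolding R_iff subset_iff by (metis diff_zero of_int_0)

lemma R_subset_S: "R \<subseteq> S"
  using F_subset_S S.add_mem[OF _ S.of_int_mem] unfolding R_iff subset_iff
  by (metis diff_add_cancel)

sublocale R: subset_field R
proof
  show "1 \<in> R" unfolding R_iff using F_zero by (intro exI[of _ 1]) simp
next
  fix u v assume "u \<in> R" "v \<in> R"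
  then obtain x y where xy: "u - of_int x \<in> F" "v - of_int y \<in> F" unfolding R_iff by blast
  have "u - v - of_int (x - y) = (u - of_int x) - (v - of_int y)" by simp
  also have "\<dots> \<in> F" using xy by (rule F_diff)
  finally show "u - v \<in> R" unfolding R_iff by blast
  have "u * v - of_int (x * y) = v * (u - of_int x) + of_int x * (v - of_int y)"
    by (simp add: algebra_simps)
  also have "\<dots> \<in> F"
    using xy \<open>v \<in> R\<close> R_subset_S by (intro F_add F_mult S.of_int_mem) auto
  finally show "u * v \<in> R" unfolding R_iff by blast
qed

lemma ideal_F: "ideal F (ring_of R)"
  unfolding R.ideal_ring_of_iff using F_subset_R F_zero F_add F_mult R_subset_S by blast

lemma of_int_mem_F_iff: "of_int z \<in> F \<longleftrightarrow> g dvd z"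
proof
  assume "of_int z \<in> F"
  then obtain x y where "of_int z = of_int g * (of_int x + of_int y * w)"
    unfolding F_def S_def by blast
  then have "of_int z + of_int 0 * w = of_int (g * x) + of_int (g * y) * w"
    by (simp add: algebra_simps)
  from w_unique[OF this] show "g dvd z" by simp
next
  assume "g dvd z"
  then show "of_int z \<in> F" unfolding F_def using S.of_int_mem by (auto elim!: dvdE)
qed

section \<open>The integral determinant \<open>D\<close> and its linearity modulo
  \<open>F\<close>\<close>

lemma coord [simp]:
  "coord1 (al * (of_int x + of_int y * t)) = x" "coord2 (al * (of_int x + of_int y * t)) = y"
  unfolding coord1_def coord2_def using al by (auto intro!: the_equality dest: t_unique)

lemma coord_I: "z \<in> I \<Longrightarrow> z = al * (of_int (coord1 z) + of_int (coord2 z) * t)"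
  unfolding I_def by auto

lemma I_mult: "s \<in> S \<Longrightarrow> z \<in> I \<Longrightarrow> s * z \<in> I"
  unfolding S_def I_def by (clarsimp simp only: S_mult_I) blast

lemma coord_add:
  assumes "z \<in> I" "z' \<in> I"
  shows "coord1 (z + z') = coord1 z + coord1 z'" "coord2 (z + z') = coord2 z + coord2 z'"
    and I_add: "z + z' \<in> I"
proof -
  have "z + z' = al * (of_int (coord1 z + coord1 z') + of_int (coord2 z + coord2 z') * t)"
    by (subst coord_I[OF assms(1)], subst coord_I[OF assms(2)]) (simp add: algebra_simps)
  then show "coord1 (z + z') = coord1 z + coord1 z'" "coord2 (z + z') = coord2 z + coord2 z'"
    "z + z' \<in> I"
    unfolding I_def by (simp_all only: coord) blast
qed

lemma I_comb: "r \<in> R \<Longrightarrow> s \<in> R \<Longrightarrow> z \<in> I \<Longrightarrow> z' \<in> I \<Longrightarrow> r * z + s * z' \<in> I"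
  using I_add I_mult R_subset_S by blast

lemma D_add_left: "z \<in> I \<Longrightarrow> z' \<in> I \<Longrightarrow> D (z + z') v = D z v + D z' v"
  by (simp add: D_def coord_add algebra_simps)

lemma D_add_right: "z \<in> I \<Longrightarrow> z' \<in> I \<Longrightarrow> D v (z + z') = D v z + D v z'"
  by (simp add: D_def coord_add algebra_simps)

lemma D_self [simp]: "D z z = 0"
  by (simp add: D_def)

lemma D_swap: "D z z' = - D z' z"
  by (simp add: D_def)

text \<open>For \<open>r = n + k g w\<close> the integer \<open>n\<close> acts exactly. The part
  \<open>k g w\<close> changes the first term by a multiple of \<open>g\<close> and the second by
  \<open>k g w D(z, z')\<close>; both changes lie in g S.\<close>

lemma D_mult_left:
  assumes r: "r \<in> R" and z: "z \<in> I" "z' \<in> I"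
  shows "of_int (D (r * z) z') - r * of_int (D z z') \<in> F"
proof -
  obtain n k where r': "r = of_int n + of_int (k * g) * w"
    using r unfolding R_def by (auto simp: mult.assoc)
  obtain x y where z: "z = al * (of_int x + of_int y * t)" using z(1) unfolding I_def by blast
  define x' y' where "x' = coord1 z'" and "y' = coord2 z'"
  have "D (r * z) z' = n * D z z' + k * g * (- c * y * y' - a * x * x' + b * x' * y)"
    unfolding r' z S_mult_I by (simp only: D_def coord x'_def y'_def) (simp add: algebra_simps)
  note eq = this
  have "of_int (D (r * z) z') - r * of_int (D z z')
      = of_int g * (of_int (k * (- c * y * y' - a * x * x' + b * x' * y)) + of_int (- k * D z z') * w)"
    unfolding eq unfolding r' by (simp add: algebra_simps)
  then show ?thesis unfolding F_def S_def by blast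
qed

lemma D_mult_right:
  assumes r: "r \<in> R" and z: "z \<in> I" "z' \<in> I"
  shows "of_int (D z (r * z')) - r * of_int (D z z') \<in> F"
  using F_uminus[OF D_mult_left[OF r z(2,1)]] by (simp add: D_swap[of z])

lemma D_row_mult:
  assumes R: "p \<in> R" "q \<in> R" "r \<in> R" "s \<in> R" and m: "m1 \<in> I" "m2 \<in> I"
  shows "of_int (D (m1 * p + m2 * r) (m1 * q + m2 * s)) - (p * s - q * r) * of_int (D m1 m2) \<in> F"
proof -
  have I: "m1 * u \<in> I" "m2 * u \<in> I" if "u \<in> R" for u
    using I_mult[of u] that m R_subset_S by (auto simp: mult.commute)
  have *: "of_int (D (z * u) (z' * v)) - u * v * of_int (D z z') \<in> F"
    if "u \<in> R" "v \<in> R" "z \<in> I" "z' \<in> I" for u v z z'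
  proof -
    have "z' * v \<in> I" using I_mult[of v z'] that R_subset_S by (auto simp: mult.commute)
    then have "of_int (D (u * z) (z' * v)) - u * of_int (D z (z' * v)) \<in> F"
      using that by (intro D_mult_left) auto
    moreover have "u * (of_int (D z (v * z')) - v * of_int (D z z')) \<in> F"
      using that R_subset_S by (intro F_mult D_mult_right) auto
    ultimately have "(of_int (D (u * z) (z' * v)) - u * of_int (D z (z' * v)))
        + u * (of_int (D z (v * z')) - v * of_int (D z z')) \<in> F" by (rule F_add)
    then show ?thesis by (simp add: algebra_simps)
  qed
  have "D (m1 * p + m2 * r) (m1 * q + m2 * s)
      = D (m1 * p) (m1 * q) + D (m1 * p) (m2 * s) + (D (m2 * r) (m1 * q) + D (m2 * r) (m2 * s))"
    using I R I_add by (simp add: D_add_left D_add_right)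
  then have "of_int (D (m1 * p + m2 * r) (m1 * q + m2 * s)) - (p * s - q * r) * of_int (D m1 m2)
      = ((of_int (D (m1 * p) (m1 * q)) - p * q * of_int (D m1 m1))
        + (of_int (D (m1 * p) (m2 * s)) - p * s * of_int (D m1 m2)))
      + ((of_int (D (m2 * r) (m1 * q)) - r * q * of_int (D m2 m1))
        + (of_int (D (m2 * r) (m2 * s)) - r * s * of_int (D m2 m2)))"
    by (simp add: D_swap[of m2 m1] algebra_simps)
  also have "\<dots> \<in> F" using R m by (intro F_add *)
  finally show ?thesis .
qed

text \<open>Generation as an \<open>R\<close>-module, which makes sense before \<open>I\<close> is
  known to lie in \<open>R\<close>. For \<open>I \<subseteq> R\<close> it agrees with
  \<open>gen_pairs\<close>.\<close>

definition gen :: "'a \<Rightarrow> 'a \<Rightarrow> bool" where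
  "gen m1 m2 \<longleftrightarrow> m1 \<in> I \<and> m2 \<in> I \<and> (\<forall>z\<in>I. \<exists>p\<in>R. \<exists>r\<in>R. z = m1 * p + m2 * r)"

lemma I_basis: "al \<in> I" "al * t \<in> I"
  unfolding I_def by (rule CollectI, rule exI[of _ 1], rule exI[of _ 0], simp)
    (rule CollectI, rule exI[of _ 0], rule exI[of _ 1], simp)

lemma coord_basis [simp]: "coord1 al = 1" "coord2 al = 0" "coord1 (al * t) = 0" "coord2 (al * t) = 1"
  using coord[of 1 0] coord[of 0 1] by simp_all

lemma D_basis [simp]: "D al (al * t) = 1"
  by (simp add: D_def)

lemma gen_basis: "gen al (al * t)"
  unfolding gen_def
proof (intro conjI ballI I_basis)
  fix z assume "z \<in> I"
  then have "z = al * of_int (coord1 z) + al * t * of_int (coord2 z)"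
    by (subst coord_I) (auto simp: algebra_simps)
  then show "\<exists>p\<in>R. \<exists>r\<in>R. z = al * p + al * t * r" using R.of_int_mem by blast
qed

text \<open>The basis, of determinant 1, is a combination of \<open>m1\<close> and
  \<open>m2\<close>. The determinant of the coefficients inverts \<open>D m1 m2\<close> modulo
  \<open>F\<close>, and it is congruent to an integer.\<close>

lemma D_unit:
  assumes "gen m1 m2"
  obtains e where "g dvd D m1 m2 * e - 1"
proof -
  obtain p r q s where R: "p \<in> R" "r \<in> R" "q \<in> R" "s \<in> R"
    and eq: "al = m1 * p + m2 * r" "al * t = m1 * q + m2 * s"
    using assms I_basis unfolding gen_def by blast
  have m: "m1 \<in> I" "m2 \<in> I" using assms by (auto simp: gen_def)
  have "of_int (D (m1 * p + m2 * r) (m1 * q + m2 * s)) - (p * s - q * r) * of_int (D m1 m2) \<in> F"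
    by (rule D_row_mult) fact+
  then have "1 - (p * s - q * r) * of_int (D m1 m2) \<in> F" by (simp flip: eq)
  then have 1: "(p * s - q * r) * of_int (D m1 m2) - 1 \<in> F" using F_uminus by fastforce
  obtain e where "p * s - q * r - of_int e \<in> F"
    using R_iff R R.diff_mem R.mult_mem by meson
  then have "of_int (D m1 m2) * (p * s - q * r - of_int e) \<in> F" by (intro F_mult S.of_int_mem)
  with 1 have "(p * s - q * r) * of_int (D m1 m2) - 1 - of_int (D m1 m2) * (p * s - q * r - of_int e) \<in> F"
    by (rule F_diff)
  then have "of_int (D m1 m2 * e - 1) \<in> F" by (simp add: algebra_simps)
  then show thesis using that of_int_mem_F_iff by blast
qed

lemma D_coprime: "gen m1 m2 \<Longrightarrow> Rings.coprime (D m1 m2) g"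
proof -
  assume "gen m1 m2"
  then obtain e where "g dvd D m1 m2 * e - 1" by (rule D_unit)
  then obtain k where "D m1 m2 * e - 1 = g * k" by (rule dvdE)
  then have "D m1 m2 * e - g * k = 1" by simp
  then show ?thesis by (metis coprimeI dvd_diff dvd_mult2)
qed

lemma D_cancel:
  assumes "gen m1 m2" "s \<in> S" "s * of_int (D m1 m2) \<in> F"
  shows "s \<in> F"
proof -
  obtain e where "g dvd D m1 m2 * e - 1" using D_unit assms(1) by blast
  then have "s * of_int (D m1 m2 * e - 1) \<in> F"
    using assms(2) by (intro F_mult) (simp_all add: of_int_mem_F_iff del: of_int_diff of_int_mult)
  moreover have "of_int e * (s * of_int (D m1 m2)) \<in> F" by (intro F_mult S.of_int_mem assms(3))
  ultimately have "of_int e * (s * of_int (D m1 m2)) - s * of_int (D m1 m2 * e - 1) \<in> F"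
    using F_diff by blast
  then show ?thesis by (simp add: algebra_simps)
qed

text \<open>\<open>colon = (R : I)\<close>; the relations between \<open>m1\<close> and \<open>m2\<close> are the vectors \<open>l (- m2, m1)\<close> with \<open>l\<close> in
  \<open>colon\<close>, so that \<open>F = colon \<cdot> I\<close> is the first Fitting ideal.\<close>

definition colon :: "'a set" where "colon = {l. \<forall>z\<in>I. l * z \<in> R}"

text \<open>\<open>F\<close> is the conductor of \<open>S\<close> in \<open>R\<close>: if v and w v
  are both in \<open>R\<close>, comparison of the coefficients of \<open>w\<close> shows that v is
  in g S. This applies to v = l z, because \<open>w z\<close> is again in \<open>I\<close>.\<close>

lemma colon_mult_mem_F:
  assumes "l \<in> colon" "z \<in> I"
  shows "l * z \<in> F"
proof -
  obtain x y where 1: "l * z = of_int x + of_int (y * g) * w"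
    using assms unfolding colon_def R_def by (fastforce simp: mult.assoc)
  have "l * (w * z) \<in> R" using assms I_mult[OF w_mem] unfolding colon_def by blast
  then obtain x' y' where "l * (w * z) = of_int x' + of_int (y' * g) * w"
    unfolding R_def by (auto simp: mult.assoc)
  moreover have "l * (w * z) = (of_int 0 + of_int 1 * w) * (l * z)" by simp
  then have "l * (w * z) = of_int (- y * g * a * c) + of_int (x - b * y * g) * w"
    unfolding 1 S_mult by (simp add: algebra_simps)
  ultimately have "x - b * y * g = y' * g" using w_unique by metis
  then have "x = g * (y' + b * y)" by (simp add: algebra_simps)
  then have "l * z = of_int g * (of_int (y' + b * y) + of_int y * w)"
    unfolding 1 by (simp add: algebra_simps)
  then show ?thesis unfolding F_def S_def by blast
qed

lemma colonI: "l * al \<in> R \<Longrightarrow> l * (al * t) \<in> R \<Longrightarrow> l \<in> colon"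
  unfolding colon_def
proof (intro CollectI ballI)
  fix z assume R: "l * al \<in> R" "l * (al * t) \<in> R" and "z \<in> I"
  then have "l * z = of_int (coord1 z) * (l * al) + of_int (coord2 z) * (l * (al * t))"
    by (subst coord_I) (auto simp: algebra_simps)
  with R show "l * z \<in> R" by (simp add: R.add_mem R.mult_mem R.of_int_mem)
qed

lemma colon_diff: "l \<in> colon \<Longrightarrow> l' \<in> colon \<Longrightarrow> l - l' \<in> colon"
  unfolding colon_def by (auto simp: left_diff_distrib R.diff_mem)

lemma colon_mult: "s \<in> S \<Longrightarrow> l \<in> colon \<Longrightarrow> s * l \<in> colon"
  unfolding colon_def using I_mult by (auto simp: mult.assoc mult.left_commute[of s])

lemma colon_add: "l \<in> colon \<Longrightarrow> l' \<in> colon \<Longrightarrow> l + l' \<in> colon"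
  unfolding colon_def by (auto simp: distrib_right R.add_mem)

text \<open>This is the invertibility of \<open>I\<close>. The products of \<open>l1\<close> and
  \<open>l2\<close> with the basis are g a, g w, g w' and g c, where w' = - b - w is the conjugate
  of \<open>w\<close>. Since g w + g w' = - g b, primitivity of a, b, c yields \<open>g\<close>,
  hence all of g S.\<close>

lemma F_in_colon_basis:
  assumes "v \<in> F"
  obtains l l' where "l \<in> colon" "l' \<in> colon" "v = l * al + l' * (al * t)"
proof -
  obtain s where s: "s \<in> S" "v = of_int g * s" using assms unfolding F_def by blast
  obtain u1 u2 u3 where u: "u1 * a + u2 * b + u3 * c = 1" using primitive by blast
  have gw: "of_int g * w \<in> R" using F_subset_R w_mem unfolding F_def by blast
  \<comment> \<open>With t' the conjugate root, \<open>l1\<close> and \<open>l2\<close> are g a / al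
    and g a t' / al: up to a scalar, the basis of the conjugate lattice.\<close>
  define l1 where "l1 = of_int (g * a) / al"
  define l2 where "l2 = (- of_int (g * b) - of_int g * w) / al"
  have l1: "l1 * al = of_int (g * a)" "l1 * (al * t) = of_int g * w"
    using al by (simp_all add: l1_def w_def)
  have l2: "l2 * al = - of_int (g * b) - of_int g * w"
    using al by (simp add: l2_def)
  have "l2 * (al * t) = (- of_int (g * b) - of_int g * w) * t"
    unfolding l2[symmetric] by simp
  also have "\<dots> = - of_int (g * b) * t - of_int g * (w * t)"
    by (simp add: algebra_simps)
  also have "\<dots> = of_int (g * c)" unfolding w_mult_t by (simp add: algebra_simps)
  finally have l2t: "l2 * (al * t) = of_int (g * c)" .
  have "l1 \<in> colon" using gw R.of_int_mem by (intro colonI) (simp_all only: l1)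
  moreover have "l2 \<in> colon"
    using gw R.of_int_mem R.uminus_mem R.diff_mem by (intro colonI) (simp_all only: l2 l2t)
  ultimately have "s * (of_int u1 * l1 - of_int u2 * l2) \<in> colon" "s * (of_int u3 * l2 - of_int u2 * l1) \<in> colon"
    using s(1) by (intro colon_mult colon_diff S.of_int_mem; simp)+
  moreover have "v = s * (of_int u1 * l1 - of_int u2 * l2) * al + s * (of_int u3 * l2 - of_int u2 * l1) * (al * t)"
  proof -
    have "s * (of_int u1 * l1 - of_int u2 * l2) * al + s * (of_int u3 * l2 - of_int u2 * l1) * (al * t)
      = s * (of_int u1 * (l1 * al) - of_int u2 * (l2 * al)
          + (of_int u3 * (l2 * (al * t)) - of_int u2 * (l1 * (al * t))))"
      by (simp add: algebra_simps)
    also have "\<dots> = s * (of_int g * of_int (u1 * a + u2 * b + u3 * c))"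
      unfolding l1 l2 l2t by (simp add: algebra_simps)
    finally show ?thesis unfolding u s(2) by simp
  qed
  ultimately show thesis using that by blast
qed

lemma F_in_colon_gen:
  assumes "gen m1 m2" "v \<in> F"
  obtains l l' where "l \<in> colon" "l' \<in> colon" "v = l * m1 + l' * m2"
proof -
  obtain l l' where l: "l \<in> colon" "l' \<in> colon" "v = l * al + l' * (al * t)"
    using F_in_colon_basis[OF assms(2)] by blast
  obtain p r q s where R: "p \<in> R" "r \<in> R" "q \<in> R" "s \<in> R"
    and eq: "al = m1 * p + m2 * r" "al * t = m1 * q + m2 * s"
    using assms I_basis unfolding gen_def by blast
  have "v = l * (m1 * p + m2 * r) + l' * (m1 * q + m2 * s)"
    unfolding eq[symmetric] by (rule l(3))
  then have "v = (p * l + q * l') * m1 + (r * l + s * l') * m2"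
    by (simp add: algebra_simps)
  moreover have "p * l + q * l' \<in> colon" "r * l + s * l' \<in> colon"
    using l R R_subset_S by (auto intro!: colon_add colon_mult)
  ultimately show thesis using that by blast
qed

lemma fitting: "fitting_ideal 1 R I = F"
proof (rule R.fitting_ideal_1_eq[of _ al "al * t"])
  show "I = {r * al + s * (al * t) | r s. r \<in> R \<and> s \<in> R}"
  proof (intro subset_antisym subsetI)
    fix z assume "z \<in> I"
    then show "z \<in> {r * al + s * (al * t) | r s. r \<in> R \<and> s \<in> R}"
      using gen_basis unfolding gen_def by (force simp: mult.commute)
  next
    fix z assume "z \<in> {r * al + s * (al * t) | r s. r \<in> R \<and> s \<in> R}"
    then show "z \<in> I" using I_comb[OF _ _ I_basis] by blast
  qed
  show "I \<noteq> {0}" using I_basis al by auto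
  show "l * x \<in> F" if "\<forall>m\<in>I. l * m \<in> R" "x \<in> I" for l x
    using colon_mult_mem_F that unfolding colon_def by blast
  show "F \<subseteq> J" if J: "ideal J (ring_of R)"
    and rel: "\<And>x y x' y'. x \<in> R \<Longrightarrow> y \<in> R \<Longrightarrow> x' \<in> R \<Longrightarrow> y' \<in> R \<Longrightarrow>
      x * al + y * (al * t) = 0 \<Longrightarrow> x' * y - y' * x \<in> J" for J
  proof
    fix v assume "v \<in> F"
    then obtain l l' where l: "l \<in> colon" "l' \<in> colon" "v = l * al + l' * (al * t)"
      using F_in_colon_basis by blast
    have R: "k * al \<in> R" "k * (al * t) \<in> R" if "k \<in> colon" for k
      using that I_basis unfolding colon_def by auto
    \<comment> \<open>The relations attached to \<open>l\<close> and \<open>l'\<close> are paired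
      with unit vectors, so that the determinant is one of their entries up to sign.\<close>
    have "l * al \<in> J"
      using rel[of "- (l * (al * t))" "l * al" 1 0] R[OF l(1)] R.one_mem R.zero_mem R.uminus_mem by simp
    moreover have "l' * (al * t) \<in> J"
      using rel[of "- (l' * (al * t))" "l' * al" 0 1] R[OF l(2)] R.one_mem R.zero_mem R.uminus_mem by simp
    ultimately show "v \<in> J" using J l(3) by (simp add: R.ideal_ring_of_iff)
  qed
qed (rule ideal_F)

lemma gen_pairs_eq: "gen_pairs R I = {(m1, m2). gen m1 m2}" if "I \<subseteq> R"
proof -
  have "Idl\<^bsub>ring_of R\<^esub> {m1, m2} = I \<longleftrightarrow> (\<forall>z\<in>I. \<exists>p\<in>R. \<exists>r\<in>R. z = m1 * p + m2 * r)"
    if m: "m1 \<in> I" "m2 \<in> I" for m1 m2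
  proof -
    define J where "J = {r * m1 + s * m2 | r s. r \<in> R \<and> s \<in> R}"
    have J: "Idl\<^bsub>ring_of R\<^esub> {m1, m2} = J"
      unfolding J_def using m \<open>I \<subseteq> R\<close> by (intro R.genideal_pair) auto
    have in_J: "z \<in> J \<longleftrightarrow> (\<exists>p\<in>R. \<exists>r\<in>R. z = m1 * p + m2 * r)" for z
    proof
      assume "z \<in> J"
      then obtain r s where "z = r * m1 + s * m2" "r \<in> R" "s \<in> R" unfolding J_def by blast
      then show "\<exists>p\<in>R. \<exists>r\<in>R. z = m1 * p + m2 * r"
        by (intro bexI[of _ r] bexI[of _ s]) (simp_all add: mult.commute)
    next
      assume "\<exists>p\<in>R. \<exists>r\<in>R. z = m1 * p + m2 * r"
      then obtain p r where "z = m1 * p + m2 * r" "p \<in> R" "r \<in> R" by blast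
      then show "z \<in> J"
        unfolding J_def by (intro CollectI exI[of _ p] exI[of _ r]) (simp add: mult.commute)
    qed
    have "J \<subseteq> I" unfolding J_def using I_comb[OF _ _ m] by blast
    then have "J = I \<longleftrightarrow> (\<forall>z\<in>I. z \<in> J)" by blast
    then show ?thesis unfolding J in_J .
  qed
  then show ?thesis unfolding gen_pairs_def gen_def by blast
qed

text \<open>A matrix over \<open>R\<close> taking one pair to the other has determinant in \<open>1 + F\<close>; adding relations to its
  columns corrects the determinant, as \<open>F = colon m1' + colon m2'\<close>.\<close>

lemma SL2_transitive:
  assumes m: "gen m1 m2" and m': "gen m1' m2'" and D: "g dvd D m1' m2' - D m1 m2"
  obtains p q r s where "p \<in> R" "q \<in> R" "r \<in> R" "s \<in> R" "p * s - q * r = 1"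
    "m1' = m1 * p + m2 * r" "m2' = m1 * q + m2 * s"
proof -
  obtain p r q s where R: "p \<in> R" "r \<in> R" "q \<in> R" "s \<in> R"
    and eq: "m1' = m1 * p + m2 * r" "m2' = m1 * q + m2 * s"
    using m m' unfolding gen_def by blast
  have mI: "m1 \<in> I" "m2 \<in> I" using m by (auto simp: gen_def)
  have "of_int (D m1' m2') - (p * s - q * r) * of_int (D m1 m2) \<in> F"
    unfolding eq by (rule D_row_mult) fact+
  moreover have "of_int (D m1' m2' - D m1 m2) \<in> F" using D of_int_mem_F_iff by blast
  ultimately have "of_int (D m1' m2' - D m1 m2) - (of_int (D m1' m2') - (p * s - q * r) * of_int (D m1 m2)) \<in> F"
    using F_diff by blast
  then have "(p * s - q * r - 1) * of_int (D m1 m2) \<in> F" by (simp add: algebra_simps)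
  moreover have "p * s - q * r - 1 \<in> S"
    using R R_subset_S by (intro S.diff_mem S.mult_mem S.one_mem) auto
  ultimately have "- (p * s - q * r - 1) \<in> F" using D_cancel[OF m] F_uminus by blast
  then obtain l l' where l: "l \<in> colon" "l' \<in> colon" "- (p * s - q * r - 1) = l * m1' + l' * m2'"
    using F_in_colon_gen[OF m'] by blast
  have lR: "l * m1 \<in> R" "l * m2 \<in> R" "l' * m1 \<in> R" "l' * m2 \<in> R"
    using l mI unfolding colon_def by auto
  show thesis
  proof (rule that)
    \<comment> \<open>The added columns \<open>l' (m2, - m1)\<close> and \<open>l (- m2, m1)\<close>
      are relations. They are proportional to each other, so the term in \<open>l l'\<close> cancels
      and the determinant changes exactly by \<open>l m1' + l' m2'\<close>.\<close>
    show "p + l' * m2 \<in> R" "q - l * m2 \<in> R" "r - l' * m1 \<in> R" "s + l * m1 \<in> R"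
      using R lR by (auto intro: R.add_mem R.diff_mem)
    show "m1' = m1 * (p + l' * m2) + m2 * (r - l' * m1)" "m2' = m1 * (q - l * m2) + m2 * (s + l * m1)"
      by (simp_all add: eq algebra_simps)
    have "(p + l' * m2) * (s + l * m1) - (q - l * m2) * (r - l' * m1)
        = p * s - q * r + (l * (m1 * p + m2 * r) + l' * (m1 * q + m2 * s))"
      by (simp add: algebra_simps)
    also have "\<dots> = 1" unfolding eq[symmetric] l(3)[symmetric] by simp
    finally show "(p + l' * m2) * (s + l * m1) - (q - l * m2) * (r - l' * m1) = 1" .
  qed
qed

lemma gen_row_mult:
  assumes m: "gen m1 m2" and R: "p \<in> R" "q \<in> R" "r \<in> R" "s \<in> R" "u \<in> R"
    and u: "u * (p * s - q * r) = 1"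
  shows "gen (m1 * p + m2 * r) (m1 * q + m2 * s)"
  unfolding gen_def
proof (intro conjI ballI)
  have mI: "m1 \<in> I" "m2 \<in> I" using m by (auto simp: gen_def)
  show "m1 * p + m2 * r \<in> I" "m1 * q + m2 * s \<in> I"
    using I_comb[OF R(1,3) mI] I_comb[OF R(2,4) mI] by (simp_all add: mult.commute)
  fix z assume "z \<in> I"
  then obtain x y where xy: "x \<in> R" "y \<in> R" "z = m1 * x + m2 * y" using m unfolding gen_def by blast
  have "z = (u * (p * s - q * r)) * (m1 * x + m2 * y)" using u xy by simp
  also have "\<dots> = (m1 * p + m2 * r) * (u * (s * x - q * y)) + (m1 * q + m2 * s) * (u * (p * y - r * x))"
    by (simp add: algebra_simps)
  finally show "\<exists>p'\<in>R. \<exists>r'\<in>R. z = (m1 * p + m2 * r) * p' + (m1 * q + m2 * s) * r'"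
    using R xy by (intro bexI[of _ "u * (s * x - q * y)"] bexI[of _ "u * (p * y - r * x)"])
      (auto intro!: R.mult_mem R.diff_mem)
qed

definition S_units :: "'a set" where "S_units = {u \<in> S. \<exists>v\<in>S. u * v = 1}"

lemma gen_unit_mult:
  assumes u: "u \<in> S_units" and m: "gen m1 m2"
  shows "gen (u * m1) (u * m2)"
  unfolding gen_def
proof (intro conjI ballI)
  obtain v where v: "u \<in> S" "v \<in> S" "u * v = 1" using u by (auto simp: S_units_def)
  show "u * m1 \<in> I" "u * m2 \<in> I" using m v I_mult by (auto simp: gen_def)
  fix z assume "z \<in> I"
  then have "v * z \<in> I" using v I_mult by blast
  then obtain x y where xy: "x \<in> R" "y \<in> R" "v * z = m1 * x + m2 * y" using m unfolding gen_def by blast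
  have "z = u * (v * z)" using v by (simp flip: mult.assoc)
  also have "\<dots> = u * m1 * x + u * m2 * y" unfolding xy by (simp add: algebra_simps)
  finally show "\<exists>p\<in>R. \<exists>r\<in>R. z = u * m1 * p + u * m2 * r" using xy by blast
qed

text \<open>For \<open>s \<in> S\<close> this is the determinant of multiplication by
  \<open>s\<close> in the basis \<open>al\<close>, \<open>al t\<close>, hence the norm of
  \<open>s\<close> over the rationals.\<close>

definition nrm :: "'a \<Rightarrow> int" where "nrm s = D (s * al) (s * (al * t))"

lemma S_mult_coord:
  assumes "z \<in> I"
  shows "coord1 ((of_int x + of_int y * w) * z) = x * coord1 z - y * coord2 z * c"
    and "coord2 ((of_int x + of_int y * w) * z) = x * coord2 z + a * y * coord1 z - b * y * coord2 z"
proof -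
  obtain p q where z: "z = al * (of_int p + of_int q * t)" using assms unfolding I_def by blast
  show "coord1 ((of_int x + of_int y * w) * z) = x * coord1 z - y * coord2 z * c"
    "coord2 ((of_int x + of_int y * w) * z) = x * coord2 z + a * y * coord1 z - b * y * coord2 z"
    unfolding z S_mult_I coord by simp_all
qed

lemma nrm_eq: "nrm (of_int x + of_int y * w) = x * x - b * x * y + a * c * y * y"
  unfolding nrm_def D_def S_mult_coord[OF I_basis(1)] S_mult_coord[OF I_basis(2)]
  by (simp add: algebra_simps)

text \<open>Multiplication by \<open>s\<close> maps \<open>I\<close> to itself with determinant
  \<open>nrm s\<close>. In contrast to \<open>D_mult_left\<close>, where only one entry is
  multiplied, the identity is exact.\<close>

lemma D_S_mult:
  assumes "s \<in> S" "z \<in> I" "z' \<in> I"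
  shows "D (s * z) (s * z') = nrm s * D z z'"
proof -
  obtain x y where s: "s = of_int x + of_int y * w" using assms unfolding S_def by blast
  show ?thesis
    unfolding s nrm_eq D_def S_mult_coord[OF assms(2)] S_mult_coord[OF assms(3)]
    by (simp add: algebra_simps)
qed

lemma nrm_mult: "s \<in> S \<Longrightarrow> s' \<in> S \<Longrightarrow> nrm (s * s') = nrm s * nrm s'"
  using D_S_mult[of s "s' * al" "s' * (al * t)"] I_basis I_mult
  by (simp add: nrm_def mult.assoc)

lemma nrm_one [simp]: "nrm 1 = 1"
  by (simp add: nrm_def)

lemma nrm_unit: "u \<in> S_units \<Longrightarrow> nrm u = 1 \<or> nrm u = - 1"
proof -
  assume "u \<in> S_units"
  then obtain v where "u \<in> S" "v \<in> S" "u * v = 1" by (auto simp: S_units_def)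
  then have "nrm u * nrm v = 1" using nrm_mult[of u v] by simp
  then show ?thesis by (auto simp: zmult_eq_1_iff)
qed

lemma nrm_R:
  assumes "r - of_int x \<in> F"
  shows "g dvd nrm r - x * x"
proof -
  obtain y z where "r - of_int x = of_int g * (of_int y + of_int z * w)"
    using assms unfolding F_def S_def by blast
  then have r: "r = of_int (x + g * y) + of_int (g * z) * w" by (simp add: algebra_simps)
  have "nrm r - x * x = g * (y * (2 * x + g * y) - b * (x + g * y) * z + a * c * g * z * z)"
    unfolding r nrm_eq by (simp add: algebra_simps)
  then show ?thesis by simp
qed

text \<open>From \<open>s al \<in> I\<close> one has s = x + y t, and \<open>s al t \<in> I\<close>
  forces \<open>a\<close> to divide y b and y c. By primitivity \<open>a\<close> divides y.\<close>

lemma multiplier_iff: "s \<in> S \<longleftrightarrow> (\<forall>z\<in>I. s * z \<in> I)"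
proof
  assume *: "\<forall>z\<in>I. s * z \<in> I"
  then obtain x y where "s * al = al * (of_int x + of_int y * t)" using I_basis unfolding I_def by blast
  then have s: "s = of_int x + of_int y * t" using al by (simp add: mult.commute)
  obtain p q where "s * (al * t) = al * (of_int p + of_int q * t)" using * I_basis unfolding I_def by blast
  then have "s * t = of_int p + of_int q * t" using al by (simp add: mult.left_commute[of s])
  then have "of_int a * (of_int x + of_int y * t) * t = of_int a * (of_int p + of_int q * t)"
    unfolding s by (simp add: mult.assoc)
  moreover have "of_int a * (of_int x + of_int y * t) * t = of_int (a * x) * t + of_int y * (w * t)"
    by (simp add: w_def algebra_simps)
  ultimately have "of_int (- y * c) + of_int (a * x - b * y) * t = of_int (a * p) + of_int (a * q) * t"
    unfolding w_mult_t by (simp add: algebra_simps)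
  then have pq: "- y * c = a * p" "a * x - b * y = a * q" using t_unique by blast+
  have pq2: "b * y = a * (x - q)" using pq(2) by (simp add: algebra_simps)
  obtain u1 u2 u3 where u: "u1 * a + u2 * b + u3 * c = 1" using primitive by blast
  have "y = y * (u1 * a + u2 * b + u3 * c)" using u by simp
  also have "\<dots> = u1 * y * a + u2 * (b * y) - u3 * (- y * c)" by (simp add: algebra_simps)
  also have "\<dots> = a * (u1 * y + u2 * (x - q) - u3 * p)"
    unfolding pq(1) pq2 by (simp add: algebra_simps)
  finally obtain k where "y = a * k" by blast
  then have "s = of_int x + of_int k * w" by (simp add: s w_def)
  then show "s \<in> S" unfolding S_def by blast
qed (use I_mult in blast)

text \<open>Since g a t is in \<open>R\<close>, \<open>g a z\<close> is an \<open>R\<close>-multiple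
  of \<open>al\<close> for every z in \<open>I\<close>, so \<open>\<phi> al\<close> determines
  \<open>\<phi>\<close>. By bijectivity both \<open>u\<close> and \<open>1 / u\<close> preserve
  \<open>I\<close> and therefore lie in its ring of multipliers \<open>S\<close>.\<close>

lemma automorphism_unit:
  assumes bij: "bij_betw \<phi> I I" and lin: "\<And>r x. r \<in> R \<Longrightarrow> x \<in> I \<Longrightarrow> \<phi> (r * x) = r * \<phi> x"
  obtains u where "u \<in> S_units" "\<And>z. z \<in> I \<Longrightarrow> \<phi> z = u * z"
proof -
  define u where "u = \<phi> al / al"
  have \<phi>: "\<phi> z = u * z" if z: "z \<in> I" for z
  proof -
    obtain x y where z': "z = al * (of_int x + of_int y * t)" using z unfolding I_def by blast
    define r where "r = of_int (g * a * x) + of_int y * (of_int g * w)"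
    have r: "r \<in> R" unfolding r_def R_def by blast
    have zr: "of_int (g * a) * z = r * al" by (simp add: z' r_def w_def algebra_simps)
    have "of_int (g * a) * \<phi> z = \<phi> (of_int (g * a) * z)"
      using lin[OF R.of_int_mem z] by presburger
    also have "\<dots> = r * \<phi> al" unfolding zr by (rule lin[OF r I_basis(1)])
    also have "\<dots> = of_int (g * a) * (u * z)"
    proof -
      have "r * \<phi> al = u * (r * al)" using al by (simp add: u_def)
      then show ?thesis unfolding zr[symmetric] by (simp add: mult_ac)
    qed
    finally show ?thesis using g_pos a_nonzero by simp
  qed
  have "u \<in> S" unfolding multiplier_iff using \<phi> bij by (metis bij_betwE)
  obtain z where z: "z \<in> I" "u * z = al" using bij I_basis(1) \<phi> by (metis bij_betw_iff_bijections)
  then have "u \<noteq> 0" using al by auto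
  have "1 / u \<in> S" unfolding multiplier_iff
  proof
    fix z assume "z \<in> I"
    then obtain z' where "z' \<in> I" "u * z' = z" using bij \<phi> by (metis bij_betw_iff_bijections)
    moreover from this have "1 / u * z = z'" using \<open>u \<noteq> 0\<close> by (simp add: field_simps)
    ultimately show "1 / u * z \<in> I" by simp
  qed
  then have "u \<in> S_units" unfolding S_units_def using \<open>u \<in> S\<close> \<open>u \<noteq> 0\<close> by (auto intro!: bexI[of _ "1 / u"])
  then show thesis using that \<phi> by blast
qed

end

text \<open>\<open>k\<close> is the product of the primes of \<open>a\<close> that do not divide
  \<open>d\<close>. Such a prime divides \<open>k g\<close> but not \<open>d\<close>; a prime of
  \<open>a\<close> that divides \<open>d\<close> divides neither \<open>k\<close> nor
  \<open>g\<close>. In both cases it does not divide the sum.\<close>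

lemma coprime_shift:
  fixes d g a :: int
  assumes "Rings.coprime d g" "a \<noteq> 0"
  obtains k where "Rings.coprime (d + k * g) a"
proof -
  define P where "P = {p \<in> prime_factors a. \<not> p dvd d}"
  have P: "finite P" by (simp add: P_def)
  define k where "k = \<Prod>P"
  have "Rings.coprime (d + k * g) a"
  proof (rule ccontr)
    assume "\<not> ?thesis"
    then obtain r where r: "r dvd d + k * g" "r dvd a" "\<not> is_unit r" by (rule not_coprimeE)
    with assms(2) have "r \<noteq> 0" by auto
    then obtain p where "p dvd r" "prime p" using prime_divisor_exists r(3) by blast
    then have p: "prime p" "p dvd d + k * g" "p dvd a" using r by (auto intro: dvd_trans)
    show False
    proof (cases "p dvd d")
      case True
      then have "p dvd k * g" using p(2) by (simp add: dvd_add_right_iff)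
      moreover have "\<not> p dvd g" using True assms(1) p(1) 
        using coprime_common_divisor not_prime_unit by blast
      ultimately have "p dvd k" using p(1) prime_dvd_multD by blast
      then obtain q where "q \<in> P" "p dvd q" using prime_dvd_prod_iff[OF P p(1), of id] by (auto simp: k_def)
      then have "p = q" using p(1) by (auto simp: P_def intro: primes_dvd_imp_eq)
      with True \<open>q \<in> P\<close> show False by (simp add: P_def)
    next
      case False
      then have "p \<in> P" using p assms(2) by (simp add: P_def prime_factors_dvd)
      then have "p dvd k" unfolding k_def by (intro dvd_prodI P)
      then show False using False p(2) by (simp add: dvd_add_left_iff)
    qed
  qed
  then show thesis using that by blast
qed

context quad_lattice
begin

text \<open>If \<open>d\<close> is prime to \<open>g a\<close>, then \<open>al\<close> and \<open>d al t\<close> generate \<open>I\<close>, since \<open>g a t\<close> belongs to \<open>R\<close>.\<close>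

lemma gen_surj:
  assumes "Rings.coprime d g"
  obtains m1 m2 where "gen m1 m2" "g dvd D m1 m2 - d"
proof -
  \<comment> \<open>The class of \<open>d\<close> modulo \<open>g\<close> is represented by an
    \<open>e\<close> that is also prime to \<open>a\<close>.\<close>
  obtain k where "Rings.coprime (d + k * g) a" using coprime_shift[OF assms a_nonzero] .
  moreover define e where "e = d + k * g"
  moreover have "Rings.coprime e g" 
    using assms gcd_add_mult[of g k d]
    by (simp add: e_def coprime_iff_gcd_eq_1 gcd.commute add.commute)
  ultimately have "Rings.coprime e (g * a)" by simp
  then obtain u v where uv: "u * e + v * (g * a) = 1"
    by (metis bezout_int coprime_imp_gcd_eq_1)
  define m2 where "m2 = of_int e * (al * t)"
  have m2: "m2 \<in> I" unfolding m2_def using I_mult[OF S.of_int_mem I_basis(2)] .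
  have "gen al m2"
    unfolding gen_def
  proof (intro conjI ballI I_basis(1) m2)
    fix z assume "z \<in> I"
    \<comment> \<open>The second coordinate is split by \<open>u e + v g a = 1\<close>: the part
      with \<open>e\<close> is a multiple of \<open>m2\<close>, the part with \<open>g a\<close>
      becomes a multiple of \<open>g w\<close> times \<open>al\<close>.\<close>
    then have "z = al * of_int (coord1 z) + al * t * of_int (coord2 z * (u * e + v * (g * a)))"
      unfolding uv by (subst coord_I) (auto simp: algebra_simps)
    then have "z = al * (of_int (coord1 z) + of_int (v * coord2 z) * (of_int g * w)) + m2 * of_int (u * coord2 z)"
      by (simp add: m2_def w_def algebra_simps)
    moreover have "of_int (coord1 z) + of_int (v * coord2 z) * (of_int g * w) \<in> R"
      unfolding R_def by blast
    ultimately show "\<exists>p\<in>R. \<exists>r\<in>R. z = al * p + m2 * r"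
      using R.of_int_mem by blast
  qed
  moreover have "m2 = al * (of_int 0 + of_int e * t)" by (simp add: m2_def)
  then have "D al m2 = e" by (simp add: D_def del: of_int_0)
  then have "g dvd D al m2 - d" by (simp add: e_def)
  ultimately show thesis using that by blast
qed

end

section \<open>The exterior square\<close>

lemma carrier_free_on_pairs:
  "x \<in> carrier (free_on_pairs R M) \<longleftrightarrow>
     Poly_Mapping.keys x \<subseteq> M \<times> M \<and> (\<forall>k. Poly_Mapping.lookup x k \<in> R)"
  by (simp add: free_on_pairs_def)

lemma lookup_map_times: "Poly_Mapping.lookup (Poly_Mapping.map ((*) r) x) k = r * Poly_Mapping.lookup x k"
  for r :: "'a::comm_ring_1"
  by (simp add: Poly_Mapping.map.rep_eq when_def)

lemma keys_map_times: "Poly_Mapping.keys (Poly_Mapping.map ((*) r) x) \<subseteq> Poly_Mapping.keys x"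
  for r :: "'a::comm_ring_1"
  by (auto simp: in_keys_iff lookup_map_times)

lemma map_times_single [simp]:
  "Poly_Mapping.map ((*) r) (Poly_Mapping.single k s) = Poly_Mapping.single k (r * s)"
  for r :: "'a::comm_ring_1"
  by (rule poly_mapping_eqI) (simp add: lookup_map_times lookup_single when_def)

lemma map_times_zero [simp]: "Poly_Mapping.map ((*) r) 0 = 0"
  for r :: "'a::comm_ring_1"
  by (rule poly_mapping_eqI) (simp add: lookup_map_times)

lemma map_times_add:
  "Poly_Mapping.map ((*) r) (x + y) = Poly_Mapping.map ((*) r) x + Poly_Mapping.map ((*) r) y"
  for r :: "'a::comm_ring_1"
  by (rule poly_mapping_eqI) (simp add: lookup_map_times lookup_add algebra_simps)

lemma map_times_diff:
  "Poly_Mapping.map ((*) r) (x - y) = Poly_Mapping.map ((*) r) x - Poly_Mapping.map ((*) r) y"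
  for r :: "'a::comm_ring_1"
  by (rule poly_mapping_eqI) (simp add: lookup_map_times lookup_minus algebra_simps)

lemma map_times_minus_one: "Poly_Mapping.map ((*) (- 1)) x = - x"
  for x :: "_ \<Rightarrow>\<^sub>0 'a::comm_ring_1"
  by (rule poly_mapping_eqI) (simp add: lookup_map_times)

context subset_ring
begin

section \<open>Congruence modulo the alternating submodule\<close>

lemma alternating_submodule_closed:
  shows alternating_zero: "0 \<in> alternating_submodule R M"
    and alternating_add: "x \<in> alternating_submodule R M \<Longrightarrow> y \<in> alternating_submodule R M \<Longrightarrow>
      x + y \<in> alternating_submodule R M"
    and alternating_smult: "r \<in> R \<Longrightarrow> x \<in> alternating_submodule R M \<Longrightarrow>
      Poly_Mapping.map ((*) r) x \<in> alternating_submodule R M"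
    and alternating_relators_subset: "alternating_relators R M \<subseteq> alternating_submodule R M"
proof -
  have *: "0 \<in> N" "\<And>x y. x \<in> N \<Longrightarrow> y \<in> N \<Longrightarrow> x + y \<in> N"
    "\<And>r x. r \<in> R \<Longrightarrow> x \<in> N \<Longrightarrow> Poly_Mapping.map ((*) r) x \<in> N"
    if "submodule N (ring_of R) (free_on_pairs R M)" for N
    using subgroup.one_closed[OF submodule.axioms(1)[OF that]]
      subgroup.m_closed[OF submodule.axioms(1)[OF that]] submodule.smult_closed[OF that]
    by (auto simp: free_on_pairs_def)
  show "0 \<in> alternating_submodule R M" "alternating_relators R M \<subseteq> alternating_submodule R M"
    unfolding alternating_submodule_def using * by auto
  show "x + y \<in> alternating_submodule R M"
    if "x \<in> alternating_submodule R M" "y \<in> alternating_submodule R M"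
    using that * unfolding alternating_submodule_def by auto
  show "Poly_Mapping.map ((*) r) x \<in> alternating_submodule R M"
    if "r \<in> R" "x \<in> alternating_submodule R M"
    using that * unfolding alternating_submodule_def by auto
qed

lemma alternating_uminus: "x \<in> alternating_submodule R M \<Longrightarrow> - x \<in> alternating_submodule R M"
  using alternating_smult[OF uminus_mem[OF one_mem]] by (simp add: map_times_minus_one)

definition alt_cong :: "'a set \<Rightarrow> (('a \<times> 'a) \<Rightarrow>\<^sub>0 'a) \<Rightarrow> (('a \<times> 'a) \<Rightarrow>\<^sub>0 'a) \<Rightarrow> bool" where
  "alt_cong M x y \<longleftrightarrow> x - y \<in> alternating_submodule R M"

lemma alt_cong_trans [trans]: "alt_cong M x y \<Longrightarrow> alt_cong M y z \<Longrightarrow> alt_cong M x z"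
  unfolding alt_cong_def using alternating_add[of "x - y" M "y - z"] by simp

lemma alt_cong_refl: "alt_cong M x x"
  by (simp add: alt_cong_def alternating_zero)

lemma alt_cong_sym: "alt_cong M x y \<Longrightarrow> alt_cong M y x"
  unfolding alt_cong_def using alternating_uminus[of "x - y" M] by simp

lemma alt_cong_add: "alt_cong M x y \<Longrightarrow> alt_cong M x' y' \<Longrightarrow> alt_cong M (x + x') (y + y')"
  unfolding alt_cong_def using alternating_add[of "x - y" M "x' - y'"] by (simp add: algebra_simps)

lemma alt_cong_smult:
  "r \<in> R \<Longrightarrow> alt_cong M x y \<Longrightarrow> alt_cong M (Poly_Mapping.map ((*) r) x) (Poly_Mapping.map ((*) r) y)"
  unfolding alt_cong_def using alternating_smult[of r "x - y" M] by (simp add: map_times_diff)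

lemma coset_eq_iff:
  "alternating_submodule R M +>\<^bsub>free_on_pairs R M\<^esub> x = alternating_submodule R M +>\<^bsub>free_on_pairs R M\<^esub> y
    \<longleftrightarrow> alt_cong M x y"
proof -
  have coset: "z \<in> alternating_submodule R M +>\<^bsub>free_on_pairs R M\<^esub> x \<longleftrightarrow> alt_cong M z x" for z x
  proof
    assume "alt_cong M z x"
    then show "z \<in> alternating_submodule R M +>\<^bsub>free_on_pairs R M\<^esub> x"
      unfolding alt_cong_def a_r_coset_def r_coset_def free_on_pairs_def by (auto intro!: bexI[of _ "z - x"])
  qed (auto simp: alt_cong_def a_r_coset_def r_coset_def free_on_pairs_def)
  show ?thesis
  proof
    assume "alternating_submodule R M +>\<^bsub>free_on_pairs R M\<^esub> x = alternating_submodule R M +>\<^bsub>free_on_pairs R M\<^esub> y"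
    then show "alt_cong M x y" using coset alt_cong_refl by blast
  next
    assume "alt_cong M x y"
    then show "alternating_submodule R M +>\<^bsub>free_on_pairs R M\<^esub> x = alternating_submodule R M +>\<^bsub>free_on_pairs R M\<^esub> y"
      using coset alt_cong_trans alt_cong_sym by blast
  qed
qed

text \<open>The scalar multiplication of \<open>ext_square\<close> is a union over representatives;
  all of them yield the same coset, and the union is not empty.\<close>

lemma smult_wedge:
  assumes "r \<in> R"
  shows "r \<odot>\<^bsub>ext_square R M\<^esub> wedge R M a b
    = alternating_submodule R M +>\<^bsub>free_on_pairs R M\<^esub> Poly_Mapping.single (a, b) r"
proof -
  have *: "alternating_submodule R M +>\<^bsub>free_on_pairs R M\<^esub> Poly_Mapping.map ((*) r) y
      = alternating_submodule R M +>\<^bsub>free_on_pairs R M\<^esub> Poly_Mapping.single (a, b) r"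
    if "y \<in> wedge R M a b" for y
  proof -
    have "alt_cong M y (Poly_Mapping.single (a, b) 1)"
      using that by (auto simp: wedge_def alt_cong_def a_r_coset_def r_coset_def free_on_pairs_def)
    from alt_cong_smult[OF assms this] show ?thesis by (simp add: coset_eq_iff)
  qed
  have "wedge R M a b \<noteq> {}"
    using alternating_zero by (auto simp: wedge_def a_r_coset_def r_coset_def)
  with * show ?thesis by (auto simp: ext_square_def Let_def free_on_pairs_def)
qed

lemma wedge_eq_smult_iff:
  assumes "r \<in> R"
  shows "wedge R M a' b' = r \<odot>\<^bsub>ext_square R M\<^esub> wedge R M a b
    \<longleftrightarrow> alt_cong M (Poly_Mapping.single (a', b') 1) (Poly_Mapping.single (a, b) r)"
  unfolding smult_wedge[OF assms] by (simp add: wedge_def coset_eq_iff)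

lemma alt_relator:
  assumes "a \<in> M" "b \<in> M" "c \<in> M" "r \<in> R"
  shows "alt_cong M (Poly_Mapping.single (a + b, c) 1) (Poly_Mapping.single (a, c) 1 + Poly_Mapping.single (b, c) 1)"
    and "alt_cong M (Poly_Mapping.single (c, a + b) 1) (Poly_Mapping.single (c, a) 1 + Poly_Mapping.single (c, b) 1)"
    and "alt_cong M (Poly_Mapping.single (r * a, b) 1) (Poly_Mapping.single (a, b) r)"
    and "alt_cong M (Poly_Mapping.single (a, r * b) 1) (Poly_Mapping.single (a, b) r)"
    and "alt_cong M (Poly_Mapping.single (a, a) 1) 0"
  using alternating_relators_subset[of M] assms
  unfolding alt_cong_def alternating_relators_def Let_def diff_diff_eq2[symmetric] diff_diff_add[symmetric]
  by (simp_all, blast+)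

lemma single_smult:
  assumes "alt_cong M (Poly_Mapping.single k 1) x" "r \<in> R"
  shows "alt_cong M (Poly_Mapping.single k r) (Poly_Mapping.map ((*) r) x)"
  using alt_cong_smult[OF assms(2,1)] by simp

lemma alt_linear_left:
  assumes M: "\<And>r x. r \<in> R \<Longrightarrow> x \<in> M \<Longrightarrow> r * x \<in> M"
    and "a \<in> M" "b \<in> M" "c \<in> M" "u \<in> R" "v \<in> R" "k \<in> R"
  shows "alt_cong M (Poly_Mapping.single (u * a + v * b, c) k)
    (Poly_Mapping.single (a, c) (k * u) + Poly_Mapping.single (b, c) (k * v))"
proof -
  have "alt_cong M (Poly_Mapping.single (u * a + v * b, c) 1)
      (Poly_Mapping.single (u * a, c) 1 + Poly_Mapping.single (v * b, c) 1)"
    using assms by (intro alt_relator(1)[where r = 1] one_mem) auto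
  also have "alt_cong M \<dots> (Poly_Mapping.single (a, c) u + Poly_Mapping.single (b, c) v)"
    using assms by (intro alt_cong_add alt_relator(3)[where c = c]) auto
  finally show ?thesis using single_smult[OF _ \<open>k \<in> R\<close>] by (fastforce simp: map_times_add)
qed

lemma alt_linear_right:
  assumes M: "\<And>r x. r \<in> R \<Longrightarrow> x \<in> M \<Longrightarrow> r * x \<in> M"
    and "a \<in> M" "b \<in> M" "c \<in> M" "u \<in> R" "v \<in> R" "k \<in> R"
  shows "alt_cong M (Poly_Mapping.single (c, u * a + v * b) k)
    (Poly_Mapping.single (c, a) (k * u) + Poly_Mapping.single (c, b) (k * v))"
proof -
  have "alt_cong M (Poly_Mapping.single (c, u * a + v * b) 1)
      (Poly_Mapping.single (c, u * a) 1 + Poly_Mapping.single (c, v * b) 1)"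
    using assms by (intro alt_relator(2)[where r = 1] one_mem) auto
  also have "alt_cong M \<dots> (Poly_Mapping.single (c, a) u + Poly_Mapping.single (c, b) v)"
    using assms by (intro alt_cong_add alt_relator(4)[where c = c]) auto
  finally show ?thesis using single_smult[OF _ \<open>k \<in> R\<close>] by (fastforce simp: map_times_add)
qed

lemma alt_diag:
  assumes "a \<in> M" "k \<in> R"
  shows "alt_cong M (Poly_Mapping.single (a, a) k) 0"
  using single_smult[OF alt_relator(5)[OF assms(1,1,1) one_mem] assms(2)]
  by simp

lemma alt_swap:
  assumes M: "\<And>x y. x \<in> M \<Longrightarrow> y \<in> M \<Longrightarrow> x + y \<in> M" and ab: "a \<in> M" "b \<in> M" "k \<in> R"
  shows "alt_cong M (Poly_Mapping.single (b, a) k) (Poly_Mapping.single (a, b) (- k))"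
proof -
  let ?s = "\<lambda>x y. Poly_Mapping.single (x, y) (1::'a)"
  have "alt_cong M 0 (?s (a + b) (a + b))"
    by (rule alt_cong_sym, rule alt_diag) (use M ab one_mem in auto)
  also have "alt_cong M \<dots> (?s a (a + b) + ?s b (a + b))"
    using M ab by (intro alt_relator(1)[where r = k]) auto
  also have "alt_cong M \<dots> ((?s a a + ?s a b) + (?s b a + ?s b b))"
    using M ab by (intro alt_cong_add alt_relator(2)[where r = k]) auto
  also have "alt_cong M \<dots> ((0 + ?s a b) + (?s b a + 0))"
    using M ab one_mem by (intro alt_cong_add alt_diag alt_cong_refl) auto
  finally have "alt_cong M 0 (?s a b + ?s b a)" by simp
  from alt_cong_smult[OF ab(3) alt_cong_sym[OF this]]
  have "alt_cong M (Poly_Mapping.single (a, b) k + Poly_Mapping.single (b, a) k) 0"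
    by (simp add: map_times_add)
  then show ?thesis by (simp add: alt_cong_def single_uminus add.commute)
qed

lemma alt_row_mult:
  assumes M: "\<And>r x. r \<in> R \<Longrightarrow> x \<in> M \<Longrightarrow> r * x \<in> M" "\<And>x y. x \<in> M \<Longrightarrow> y \<in> M \<Longrightarrow> x + y \<in> M"
    and ab: "a \<in> M" "b \<in> M" and R: "p \<in> R" "q \<in> R" "r \<in> R" "s \<in> R"
  shows "alt_cong M (Poly_Mapping.single (p * a + r * b, q * a + s * b) 1)
    (Poly_Mapping.single (a, b) (p * s - q * r))"
proof -
  let ?s = "\<lambda>x y. Poly_Mapping.single (x, y)"
  have "alt_cong M (?s (p * a + r * b) (q * a + s * b) 1)
      (?s a (q * a + s * b) (1 * p) + ?s b (q * a + s * b) (1 * r))"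
    using M ab R one_mem by (intro alt_linear_left) auto
  also have "alt_cong M \<dots> ((?s a a (1 * p * q) + ?s a b (1 * p * s)) + (?s b a (1 * r * q) + ?s b b (1 * r * s)))"
    using M ab R by (intro alt_cong_add alt_linear_right) auto
  also have "alt_cong M \<dots> ((0 + ?s a b (1 * p * s)) + (?s a b (- (1 * r * q)) + 0))"
    using M ab R by (intro alt_cong_add alt_diag alt_cong_refl alt_swap) (auto intro: mult_mem)
  also have "\<dots> = ?s a b (p * s - q * r)"
    by (simp add: single_diff single_uminus mult_ac)
  finally show ?thesis .
qed

end

context quad_lattice
begin

text \<open>The linear form on the free module whose kernel modulo \<open>F\<close> contains the alternating relators;
  it shows that the annihilator of the exterior square is not larger than \<open>F\<close>.\<close>

definition D_form :: "(('a \<times> 'a) \<Rightarrow>\<^sub>0 'a) \<Rightarrow> 'a" where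
  "D_form x = (\<Sum>k\<in>Poly_Mapping.keys x. Poly_Mapping.lookup x k * of_int (D (fst k) (snd k)))"

lemma D_form_superset:
  assumes "finite A" "Poly_Mapping.keys x \<subseteq> A"
  shows "D_form x = (\<Sum>k\<in>A. Poly_Mapping.lookup x k * of_int (D (fst k) (snd k)))"
  unfolding D_form_def by (rule sum.mono_neutral_left) (use assms in \<open>auto simp: in_keys_iff\<close>)

lemma D_form_add: "D_form (x + y) = D_form x + D_form y"
proof -
  let ?A = "Poly_Mapping.keys x \<union> Poly_Mapping.keys y"
  have "Poly_Mapping.keys (x + y) \<subseteq> ?A" by (rule Poly_Mapping.keys_add)
  then show ?thesis
    by (simp add: D_form_superset[of ?A] lookup_add distrib_right sum.distrib)
qed

lemma D_form_smult: "D_form (Poly_Mapping.map ((*) r) x) = r * D_form x"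
  using keys_map_times[of r x]
  by (simp add: D_form_superset[of "Poly_Mapping.keys x"] lookup_map_times sum_distrib_left mult.assoc)

lemma D_form_uminus: "D_form (- x) = - D_form x"
  using D_form_smult[of "- 1" x] by (simp add: map_times_minus_one)

lemma D_form_diff: "D_form (x - y) = D_form x - D_form y"
  using D_form_add[of x "- y"] by (simp add: D_form_uminus)

lemma D_form_single [simp]: "D_form (Poly_Mapping.single k r) = r * of_int (D (fst k) (snd k))"
  by (simp add: D_form_superset[of "{k}"])

text \<open>The elements that \<open>D_form\<close> maps into \<open>F\<close> form a submodule
  containing the alternating relators, so it contains the intersection of all such
  submodules.\<close>

lemma alternating_submodule_D_form:
  assumes "x \<in> alternating_submodule R I"
  shows "D_form x \<in> F"
proof -
  define N where "N = {x \<in> carrier (free_on_pairs R I). D_form x \<in> F}"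
  have closed: "0 \<in> N" "\<And>x y. x \<in> N \<Longrightarrow> y \<in> N \<Longrightarrow> x + y \<in> N"
    "\<And>r x. r \<in> R \<Longrightarrow> x \<in> N \<Longrightarrow> Poly_Mapping.map ((*) r) x \<in> N"
  proof -
    show "0 \<in> N" by (simp add: N_def carrier_free_on_pairs R.zero_mem D_form_def F_zero)
    show "x + y \<in> N" if "x \<in> N" "y \<in> N" for x y
      using that Poly_Mapping.keys_add[of x y]
      by (auto simp: N_def carrier_free_on_pairs lookup_add R.add_mem D_form_add F_add)
    show "Poly_Mapping.map ((*) r) x \<in> N" if "r \<in> R" "x \<in> N" for r x
      using that keys_map_times[of r x] F_mult R_subset_S
      by (auto simp: N_def carrier_free_on_pairs lookup_map_times R.mult_mem D_form_smult)
  qed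
  have uminus: "- x \<in> N" if "x \<in> N" for x
    using closed(3)[OF R.uminus_mem[OF R.one_mem] that] by (simp add: map_times_minus_one)
  have N_carrier: "N \<subseteq> carrier (free_on_pairs R I)" by (auto simp: N_def)
  have "submodule N (ring_of R) (free_on_pairs R I)"
  proof
    show "N \<subseteq> carrier (add_monoid (free_on_pairs R I))" using N_carrier by simp
    show "x \<otimes>\<^bsub>add_monoid (free_on_pairs R I)\<^esub> y \<in> N" if "x \<in> N" "y \<in> N" for x y
      using closed(2)[OF that] by (simp add: free_on_pairs_def)
    show "\<one>\<^bsub>add_monoid (free_on_pairs R I)\<^esub> \<in> N" using closed(1) by (simp add: free_on_pairs_def)
    show "inv\<^bsub>add_monoid (free_on_pairs R I)\<^esub> x \<in> N" if "x \<in> N" for x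
    proof -
      have "inv\<^bsub>add_monoid (free_on_pairs R I)\<^esub> x = - x"
        unfolding m_inv_def
      proof (rule the_equality)
        show "- x \<in> carrier (add_monoid (free_on_pairs R I)) \<and>
          x \<otimes>\<^bsub>add_monoid (free_on_pairs R I)\<^esub> - x = \<one>\<^bsub>add_monoid (free_on_pairs R I)\<^esub> \<and>
          - x \<otimes>\<^bsub>add_monoid (free_on_pairs R I)\<^esub> x = \<one>\<^bsub>add_monoid (free_on_pairs R I)\<^esub>"
          using subsetD[OF N_carrier uminus[OF that]] by (intro conjI) (simp_all add: free_on_pairs_def)
      qed (auto simp: free_on_pairs_def eq_neg_iff_add_eq_0)
      then show ?thesis using uminus[OF that] by simp
    qed
    show "r \<odot>\<^bsub>free_on_pairs R I\<^esub> x \<in> N" if "r \<in> carrier (ring_of R)" "x \<in> N" for r x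
      using closed(3) that by (simp add: free_on_pairs_def)
  qed
  moreover have "alternating_relators R I \<subseteq> N"
  proof
    have single: "Poly_Mapping.single (a, b) r \<in> carrier (free_on_pairs R I)"
      if "a \<in> I" "b \<in> I" "r \<in> R" for a b r
      using that by (auto simp: carrier_free_on_pairs lookup_single when_def R.zero_mem split: if_splits)
    have diff: "x - y \<in> carrier (free_on_pairs R I)"
      if "x \<in> carrier (free_on_pairs R I)" "y \<in> carrier (free_on_pairs R I)" for x y
      using that Poly_Mapping.keys_diff[of x y] by (auto simp: carrier_free_on_pairs lookup_minus R.diff_mem)
    fix x assume x: "x \<in> alternating_relators R I"
    have "x \<in> carrier (free_on_pairs R I)"
      using x unfolding alternating_relators_def Let_def
      by (auto intro!: single diff I_add I_mult R.one_mem subsetD[OF R_subset_S])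
    moreover have "D_form x \<in> F"
      using x unfolding alternating_relators_def Let_def
      by (auto simp: D_form_diff D_add_left D_add_right D_mult_left D_mult_right F_zero)
    ultimately show "x \<in> N" by (simp add: N_def)
  qed
  ultimately have "alternating_submodule R I \<subseteq> N" unfolding alternating_submodule_def by blast
  then show ?thesis using assms by (auto simp: N_def)
qed

text \<open>For \<open>l\<close> in \<open>colon\<close> one has \<open>(l z) (z \<and> z') = z \<and> (l z) z' = z \<and> (l z') z = 0\<close>.\<close>

lemma F_annihilates:
  assumes m: "gen m1 m2" and v: "v \<in> F"
  shows "R.alt_cong I (Poly_Mapping.single (m1, m2) v) 0"
proof -
  have mI: "m1 \<in> I" "m2 \<in> I" using m by (auto simp: gen_def)
  obtain l l' where l: "l \<in> colon" "l' \<in> colon" "v = l * m1 + l' * m2"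
    using F_in_colon_gen[OF m v] by blast
  have lR: "l * m1 \<in> R" "l * m2 \<in> R" "l' * m1 \<in> R" "l' * m2 \<in> R"
    using l mI unfolding colon_def by auto
  have "R.alt_cong I (Poly_Mapping.single (m1, m2) (l * m1)) (Poly_Mapping.single (m1, (l * m1) * m2) 1)"
    by (rule R.alt_cong_sym, rule R.alt_relator(4)) (use lR mI in auto)
  also have "(l * m1) * m2 = (l * m2) * m1" by simp
  also have "R.alt_cong I (Poly_Mapping.single (m1, (l * m2) * m1) 1) (Poly_Mapping.single (m1, m1) (l * m2))"
    using lR mI by (intro R.alt_relator(4)) auto
  also have "R.alt_cong I \<dots> 0" using lR mI by (intro R.alt_diag)
  finally have 1: "R.alt_cong I (Poly_Mapping.single (m1, m2) (l * m1)) 0" .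
  have "R.alt_cong I (Poly_Mapping.single (m1, m2) (l' * m2)) (Poly_Mapping.single ((l' * m2) * m1, m2) 1)"
    by (rule R.alt_cong_sym, rule R.alt_relator(3)) (use lR mI in auto)
  also have "(l' * m2) * m1 = (l' * m1) * m2" by simp
  also have "R.alt_cong I (Poly_Mapping.single ((l' * m1) * m2, m2) 1) (Poly_Mapping.single (m2, m2) (l' * m1))"
    using lR mI by (intro R.alt_relator(3)) auto
  also have "R.alt_cong I \<dots> 0" using lR mI by (intro R.alt_diag)
  finally have 2: "R.alt_cong I (Poly_Mapping.single (m1, m2) (l' * m2)) 0" .
  from R.alt_cong_add[OF 1 2] show ?thesis by (simp add: l(3) single_add)
qed

text \<open>\<open>D_form\<close> gives one direction. For the other, the matrix of the second pair
  over the first has determinant congruent to \<open>r\<close> modulo \<open>F\<close>, after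
  cancelling \<open>D m1 m2\<close>, and \<open>F\<close> annihilates the wedge.\<close>

lemma wedge_eq_iff:
  assumes m: "gen m1 m2" and m': "gen m1' m2'" and r: "r \<in> R"
  shows "wedge R I m1' m2' = r \<odot>\<^bsub>ext_square R I\<^esub> wedge R I m1 m2
    \<longleftrightarrow> of_int (D m1' m2') - r * of_int (D m1 m2) \<in> F"
  unfolding R.wedge_eq_smult_iff[OF r]
proof
  assume "R.alt_cong I (Poly_Mapping.single (m1', m2') 1) (Poly_Mapping.single (m1, m2) r)"
  then have "D_form (Poly_Mapping.single (m1', m2') 1 - Poly_Mapping.single (m1, m2) r) \<in> F"
    unfolding R.alt_cong_def by (rule alternating_submodule_D_form)
  then show "of_int (D m1' m2') - r * of_int (D m1 m2) \<in> F" by (simp add: D_form_diff)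
next
  assume *: "of_int (D m1' m2') - r * of_int (D m1 m2) \<in> F"
  have mI: "m1 \<in> I" "m2 \<in> I" using m by (auto simp: gen_def)
  obtain p u q s where R: "p \<in> R" "u \<in> R" "q \<in> R" "s \<in> R"
    and eq: "m1' = m1 * p + m2 * u" "m2' = m1 * q + m2 * s"
    using m m' unfolding gen_def by blast
  have "of_int (D m1' m2') - (p * s - q * u) * of_int (D m1 m2) \<in> F"
    unfolding eq by (rule D_row_mult) fact+
  then have "(of_int (D m1' m2') - r * of_int (D m1 m2)) - (of_int (D m1' m2') - (p * s - q * u) * of_int (D m1 m2)) \<in> F"
    using F_diff * by blast
  then have "(p * s - q * u - r) * of_int (D m1 m2) \<in> F" by (simp add: algebra_simps)
  moreover have "p * s - q * u - r \<in> S"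
    using R r R_subset_S by (intro S.diff_mem S.mult_mem) auto
  ultimately have F: "p * s - q * u - r \<in> F" using D_cancel[OF m] by blast
  have "R.alt_cong I (Poly_Mapping.single (m1', m2') 1) (Poly_Mapping.single (m1, m2) (p * s - q * u))"
    unfolding eq mult.commute[of m1] mult.commute[of m2]
    by (rule R.alt_row_mult) (use R mI I_add I_mult R_subset_S in auto)
  also have "R.alt_cong I \<dots> (Poly_Mapping.single (m1, m2) r)"
    using F_annihilates[OF m F] by (simp add: R.alt_cong_def single_diff)
  finally show "R.alt_cong I (Poly_Mapping.single (m1', m2') 1) (Poly_Mapping.single (m1, m2) r)" .
qed

lemma F_coset_eq_iff: "F +>\<^bsub>ring_of R\<^esub> x = F +>\<^bsub>ring_of R\<^esub> y \<longleftrightarrow> x - y \<in> F"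
proof
  assume "F +>\<^bsub>ring_of R\<^esub> x = F +>\<^bsub>ring_of R\<^esub> y"
  moreover have "x \<in> F +>\<^bsub>ring_of R\<^esub> x" by (simp add: in_a_r_coset_ring_of F_zero)
  ultimately show "x - y \<in> F" by (simp add: in_a_r_coset_ring_of)
next
  assume xy: "x - y \<in> F"
  have "z - x \<in> F \<longleftrightarrow> z - y \<in> F" for z
    using F_add[OF _ xy, of "z - x"] F_diff[OF _ xy, of "z - y"] by auto
  then show "F +>\<^bsub>ring_of R\<^esub> x = F +>\<^bsub>ring_of R\<^esub> y" by (auto simp: in_a_r_coset_ring_of)
qed

text \<open>An \<open>r \<in> R\<close> satisfies the equation of wedges exactly if it is congruent
  to \<open>e\<close> modulo \<open>F\<close>, because \<open>D m1 m2\<close> can be cancelled. So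
  the whole coset of \<open>e\<close> qualifies, and no other coset does.\<close>

lemma det_pair_eq:
  assumes m: "gen m1 m2" and m': "gen m1' m2'" and e: "g dvd D m1' m2' - e * D m1 m2"
  shows "det_pair R I (m1, m2) (m1', m2') = F +>\<^bsub>ring_of R\<^esub> of_int e"
  unfolding det_pair_def fitting
proof (rule the_equality)
  have carrier: "carrier (ring_of R Quot F) = (\<lambda>x. F +>\<^bsub>ring_of R\<^esub> x) ` R"
    by (auto simp: FactRing_def A_RCOSETS_def' )
  have sub: "r \<in> R" if "x \<in> R" "r \<in> F +>\<^bsub>ring_of R\<^esub> x" for r x
    using R.add_mem[OF _ that(1), of "r - x"] that(2) F_subset_R by (auto simp: in_a_r_coset_ring_of)
  have e': "of_int (D m1' m2') - of_int e * of_int (D m1 m2) \<in> F"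
    using e of_int_mem_F_iff[of "D m1' m2' - e * D m1 m2"] by simp
  have key: "of_int (D m1' m2') - r * of_int (D m1 m2) \<in> F \<longleftrightarrow> r - of_int e \<in> F" if r: "r \<in> R" for r
  proof
    assume "r - of_int e \<in> F"
    then have "of_int (D m1 m2) * (r - of_int e) \<in> F" by (intro F_mult S.of_int_mem)
    from F_diff[OF e' this] show "of_int (D m1' m2') - r * of_int (D m1 m2) \<in> F"
      by (simp add: algebra_simps)
  next
    assume "of_int (D m1' m2') - r * of_int (D m1 m2) \<in> F"
    from F_diff[OF e' this] have "(r - of_int e) * of_int (D m1 m2) \<in> F" by (simp add: algebra_simps)
    moreover have "r - of_int e \<in> S" using r R_subset_S S.diff_mem S.of_int_mem by blast
    ultimately show "r - of_int e \<in> F" using D_cancel[OF m] by blast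
  qed
  show "F +>\<^bsub>ring_of R\<^esub> of_int e \<in> carrier (ring_of R Quot F) \<and>
    (\<forall>r\<in>F +>\<^bsub>ring_of R\<^esub> of_int e. wedge R I (fst (m1', m2')) (snd (m1', m2')) =
      r \<odot>\<^bsub>ext_square R I\<^esub> wedge R I (fst (m1, m2)) (snd (m1, m2)))"
    unfolding carrier using R.of_int_mem sub[OF R.of_int_mem] wedge_eq_iff[OF m m'] key
    by (auto simp: in_a_r_coset_ring_of)
  fix d assume d: "d \<in> carrier (ring_of R Quot F) \<and>
    (\<forall>r\<in>d. wedge R I (fst (m1', m2')) (snd (m1', m2')) =
      r \<odot>\<^bsub>ext_square R I\<^esub> wedge R I (fst (m1, m2)) (snd (m1, m2)))"
  then obtain x where x: "x \<in> R" "d = F +>\<^bsub>ring_of R\<^esub> x" unfolding carrier by blast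
  then have "x \<in> d" by (simp add: in_a_r_coset_ring_of F_zero)
  with d have "of_int (D m1' m2') - x * of_int (D m1 m2) \<in> F"
    using wedge_eq_iff[OF m m' x(1)] by auto
  then show "d = F +>\<^bsub>ring_of R\<^esub> of_int e" using key[OF x(1)] F_coset_eq_iff x(2) by blast
qed

end

section \<open>Orbits and the determinant\<close>

lemma quotient_bij_betw:
  assumes E: "\<And>m m'. (m, m') \<in> E \<longleftrightarrow> m \<in> V \<and> m' \<in> V \<and> k m = k m'"
  obtains h where "bij_betw h (V // E) (k ` V)" "\<And>m. m \<in> V \<Longrightarrow> h (E `` {m}) = k m"
proof
  define h where "h Y = (SOME y. \<exists>m\<in>Y. y = k m)" for Y
  have cls: "E `` {m} = {m' \<in> V. k m' = k m}" if "m \<in> V" for m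
    using E that by auto
  show h: "h (E `` {m}) = k m" if m: "m \<in> V" for m
  proof -
    have "\<exists>m'\<in>E `` {m}. h (E `` {m}) = k m'"
      unfolding h_def by (rule someI_ex) (use cls[OF m] m in auto)
    then show ?thesis using cls[OF m] by auto
  qed
  have "inj_on h (V // E)"
  proof (rule inj_onI)
    fix X Y assume "X \<in> V // E" "Y \<in> V // E" "h X = h Y"
    then obtain m m' where "m \<in> V" "X = E `` {m}" "m' \<in> V" "Y = E `` {m'}"
      by (auto elim!: quotientE)
    moreover from this \<open>h X = h Y\<close> have "k m = k m'" using h by metis
    ultimately show "X = Y" by (simp add: cls)
  qed
  moreover have "h ` (V // E) = k ` V"
  proof (intro subset_antisym subsetI)
    fix y assume "y \<in> h ` (V // E)"
    then show "y \<in> k ` V" by (auto elim!: quotientE simp: h)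
  next
    fix y assume "y \<in> k ` V"
    then obtain m where "m \<in> V" "y = h (E `` {m})" by (auto simp: h)
    then show "y \<in> h ` (V // E)" by (auto intro: quotientI)
  qed
  ultimately show "bij_betw h (V // E) (k ` V)" by (simp add: bij_betw_def)
qed

text \<open>Both orbit spaces have this form, with \<open>\<delta>\<close> a determinant map onto
  the units modulo \<open>g\<close>: \<open>H\<close> consists of the determinants of units of
  \<open>S\<close> in the count for \<open>SL2\<close>, and of the images of units of
  \<open>R\<close> for \<open>GL2\<close>.\<close>

lemma (in group) quotient_rcosets_bij_betw:
  assumes H: "subgroup H G" and \<delta>: "\<delta> ` V = carrier G"
    and E: "\<And>m m'. (m, m') \<in> E \<longleftrightarrow> m \<in> V \<and> m' \<in> V \<and> (\<exists>h\<in>H. \<delta> m' = h \<otimes> \<delta> m)"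
  obtains h where "bij_betw h (V // E) (rcosets H)" "\<And>m. m \<in> V \<Longrightarrow> h (E `` {m}) = H #> \<delta> m"
proof -
  have "(m, m') \<in> E \<longleftrightarrow> m \<in> V \<and> m' \<in> V \<and> H #> \<delta> m = H #> \<delta> m'" for m m'
  proof -
    have "(\<exists>h\<in>H. \<delta> m' = h \<otimes> \<delta> m) \<longleftrightarrow> H #> \<delta> m = H #> \<delta> m'" if "m \<in> V" "m' \<in> V"
    proof -
      have c: "\<delta> m \<in> carrier G" "\<delta> m' \<in> carrier G" using that \<delta> by auto
      have "(\<exists>h\<in>H. \<delta> m' = h \<otimes> \<delta> m) \<longleftrightarrow> \<delta> m' \<in> H #> \<delta> m" by (auto simp: r_coset_def)
      also have "\<dots> \<longleftrightarrow> H #> \<delta> m = H #> \<delta> m'"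
        using repr_independence[OF _ c(1) H] repr_independenceD[OF H c(2)] by blast
      finally show ?thesis .
    qed
    then show ?thesis using E by blast
  qed
  then obtain h where h: "bij_betw h (V // E) ((\<lambda>m. H #> \<delta> m) ` V)" "\<And>m. m \<in> V \<Longrightarrow> h (E `` {m}) = H #> \<delta> m"
    using quotient_bij_betw[of E V "\<lambda>m. H #> \<delta> m"] by blast
  have "(\<lambda>m. H #> \<delta> m) ` V = (\<lambda>x. H #> x) ` (\<delta> ` V)" by (simp add: image_image)
  also have "\<dots> = rcosets H" unfolding \<delta> RCOSETS_def by auto
  finally show thesis using that h by simp
qed

lemma Units_ring_of: "u \<in> Units (ring_of T) \<longleftrightarrow> u \<in> T \<and> (\<exists>v\<in>T. u * v = 1)"
  by (auto simp: Units_def mult.commute)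

locale quad_ideal = quad_lattice +
  assumes I_subset: "I \<subseteq> R"
begin

section \<open>The ring R/F as the integers modulo \<open>g\<close>, and its units\<close>

definition Q :: "'a set ring" where "Q = ring_of R Quot F"

definition cls :: "int \<Rightarrow> 'a set" where "cls z = F +>\<^bsub>ring_of R\<^esub> of_int z"

lemma fitting_quot_eq: "fitting_quot R I = Q"
  unfolding fitting Q_def ..

lemma cls_eq_iff: "cls z = cls z' \<longleftrightarrow> g dvd z - z'"
  unfolding cls_def F_coset_eq_iff of_int_mem_F_iff[symmetric] by simp

lemma coset_eq_cls: "F +>\<^bsub>ring_of R\<^esub> r = cls z \<longleftrightarrow> r - of_int z \<in> F"
  unfolding cls_def F_coset_eq_iff ..

lemma carrier_Q: "carrier Q = range cls"
proof -
  have "carrier Q = (\<lambda>x. F +>\<^bsub>ring_of R\<^esub> x) ` R"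
    by (auto simp: Q_def FactRing_def A_RCOSETS_def')
  also have "\<dots> = range cls"
  proof (intro subset_antisym subsetI)
    fix y assume "y \<in> (\<lambda>x. F +>\<^bsub>ring_of R\<^esub> x) ` R"
    then obtain r where "r \<in> R" "y = F +>\<^bsub>ring_of R\<^esub> r" by blast
    then show "y \<in> range cls" using R_iff coset_eq_cls by blast
  qed (auto simp: cls_def R.of_int_mem)
  finally show ?thesis .
qed

lemma cls_mult: "cls z \<otimes>\<^bsub>Q\<^esub> cls z' = cls (z * z')"
  using ideal.rcoset_mult_add[OF ideal_F, of "of_int z" "of_int z'"]
  by (simp add: Q_def FactRing_def cls_def R.of_int_mem)

lemma one_Q: "\<one>\<^bsub>Q\<^esub> = cls 1"
  by (simp add: Q_def FactRing_def cls_def)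

lemma cring_Q: "cring Q"
  unfolding Q_def by (rule ideal.quotient_is_cring[OF ideal_F R.cring_ring_of])

lemma cls_Units_iff: "cls z \<in> Units Q \<longleftrightarrow> Rings.coprime z g"
proof -
  have "cls z \<in> Units Q \<longleftrightarrow> (\<exists>z'. g dvd z' * z - 1)"
    unfolding Units_def carrier_Q by (auto simp: cls_mult one_Q cls_eq_iff mult.commute[of z])
  also have "\<dots> \<longleftrightarrow> Rings.coprime z g"
  proof
    assume "\<exists>z'. g dvd z' * z - 1"
    then obtain z' k where "z' * z - 1 = g * k" by (auto elim: dvdE)
    then have "z' * z - g * k = 1" by simp
    then show "Rings.coprime z g" by (metis coprimeI dvd_diff dvd_mult dvd_mult2)
  next
    assume "Rings.coprime z g"
    then obtain u v where "u * z + v * g = 1" by (metis bezout_int coprime_imp_gcd_eq_1)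
    then have "u * z - 1 = g * (- v)" by (simp add: algebra_simps)
    then show "\<exists>z'. g dvd z' * z - 1" by (metis dvd_triv_left)
  qed
  finally show ?thesis .
qed

lemma Units_Q: "Units Q = cls ` {z. Rings.coprime z g}"
  using cls_Units_iff carrier_Q by (auto simp: Units_def[of Q]) 

sublocale UQ: comm_group "units_of Q"
  using comm_monoid.units_comm_group[OF cring.axioms(2)[OF cring_Q]] .

lemma UQ_simps [simp]:
  "carrier (units_of Q) = cls ` {z. Rings.coprime z g}"
  "cls z \<otimes>\<^bsub>units_of Q\<^esub> cls z' = cls (z * z')"
  "\<one>\<^bsub>units_of Q\<^esub> = cls 1"
  by (simp_all add: units_of_def Units_Q cls_mult one_Q)

lemma card_UQ: "card (carrier (units_of Q)) = totient (nat g)" and finite_UQ: "finite (carrier (units_of Q))"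
proof -
  have "bij_betw (\<lambda>k. cls (int k)) (totatives (nat g)) (carrier (units_of Q))"
    unfolding bij_betw_def
  proof
    show "inj_on (\<lambda>k. cls (int k)) (totatives (nat g))"
    proof (rule inj_onI)
      fix k l assume kl: "k \<in> totatives (nat g)" "l \<in> totatives (nat g)" "cls (int k) = cls (int l)"
      then have "g dvd int k - int l" "0 < int k" "int k \<le> g" "0 < int l" "int l \<le> g"
        using g_pos by (auto simp: cls_eq_iff in_totatives_iff)
      then have "int k - int l = 0" using dvd_imp_le_int[of "int k - int l" g] by linarith
      then show "k = l" by simp
    qed
    show "(\<lambda>k. cls (int k)) ` totatives (nat g) = carrier (units_of Q)"
    proof (intro subset_antisym subsetI)
      fix y assume "y \<in> (\<lambda>k. cls (int k)) ` totatives (nat g)"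
      then obtain k where k: "y = cls (int k)" "Rings.coprime k (nat g)" by (auto simp: in_totatives_iff)
      then have "Rings.coprime (int k) g" using g_pos by (simp flip: coprime_int_iff)
      with k show "y \<in> carrier (units_of Q)" by simp
    next
      fix y assume "y \<in> carrier (units_of Q)"
      then obtain z where z: "y = cls z" "Rings.coprime z g" by auto
      \<comment> \<open>Totatives of \<open>g\<close> lie between 1 and \<open>g\<close>, so the
        residue 0 is represented by \<open>g\<close>; among units it occurs for
        \<open>g = 1\<close>.\<close>
      define z' where "z' = (if z mod g = 0 then g else z mod g)"
      have "g dvd z - z'" by (auto simp: z'_def mod_eq_0_iff_dvd minus_mod_eq_mult_div)
      then have y: "y = cls z'" using z cls_eq_iff by simp
      have "0 < z'" "z' \<le> g"
        using g_pos pos_mod_bound[of g z] pos_mod_sign[of g z] by (auto simp: z'_def less_le)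
      moreover have "Rings.coprime z' g"
        using z(2) cls_Units_iff[of z] cls_Units_iff[of z'] y z(1) by simp
      ultimately have "nat z' \<in> totatives (nat g)"
        using g_pos by (simp add: in_totatives_iff flip: coprime_int_iff)
      with y \<open>0 < z'\<close> show "y \<in> (\<lambda>k. cls (int k)) ` totatives (nat g)"
        by (intro image_eqI[of _ _ "nat z'"]) auto
    qed
  qed
  then show "card (carrier (units_of Q)) = totient (nat g)" "finite (carrier (units_of Q))"
    using bij_betw_same_card bij_betw_finite by (fastforce simp: totient_def)+
qed

section \<open>Orbits of \<open>SL2\<close> and \<open>GL2\<close> in terms of
  \<open>D\<close>\<close>

lemma gen_pairs: "gen_pairs R I = {(m1, m2). gen m1 m2}"
  using gen_pairs_eq I_subset .

lemma SL2_iff: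
  assumes "gen m1 m2" "gen m1' m2'"
  shows "(\<exists>A\<in>SL2 R. (m1', m2') = row_mult (m1, m2) A) \<longleftrightarrow> g dvd D m1' m2' - D m1 m2"
proof
  assume "\<exists>A\<in>SL2 R. (m1', m2') = row_mult (m1, m2) A"
  then obtain A where A: "A \<in> carrier_mat 2 2" "elements_mat A \<subseteq> R" "det A = 1"
    and m': "m1' = m1 * A $$ (0, 0) + m2 * A $$ (1, 0)" "m2' = m1 * A $$ (0, 1) + m2 * A $$ (1, 1)"
    by (auto simp: SL2_def row_mult_def)
  have "A $$ (i, j) \<in> R" if "i < 2" "j < 2" for i j
    using elements_matI[OF A(1) that refl] A(2) by blast
  then have "of_int (D m1' m2') - (A $$ (0, 0) * A $$ (1, 1) - A $$ (0, 1) * A $$ (1, 0)) * of_int (D m1 m2) \<in> F"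
    unfolding m' by (intro D_row_mult) (use assms in \<open>auto simp: gen_def\<close>)
  then show "g dvd D m1' m2' - D m1 m2"
    using A(3) unfolding det_2x2[OF A(1)] of_int_mem_F_iff[symmetric] by simp
next
  assume "g dvd D m1' m2' - D m1 m2"
  then obtain p q r s where R: "p \<in> R" "q \<in> R" "r \<in> R" "s \<in> R" "p * s - q * r = 1"
    "m1' = m1 * p + m2 * r" "m2' = m1 * q + m2 * s"
    using SL2_transitive[OF assms] by blast
  define A where "A = Matrix.mat 2 2 (\<lambda>(i, j). if i = 0 then (if j = 0 then p else q) else (if j = 0 then r else s))"
  have "A \<in> SL2 R"
    using R det_2x2[of A] by (auto simp: SL2_def A_def elements_mat_def)
  moreover have "(m1', m2') = row_mult (m1, m2) A" using R by (simp add: row_mult_def A_def)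
  ultimately show "\<exists>A\<in>SL2 R. (m1', m2') = row_mult (m1, m2) A" by blast
qed

lemma GL2_iff:
  assumes "gen m1 m2" "gen m1' m2'"
  shows "(\<exists>A\<in>GL2 R. (m1', m2') = row_mult (m1, m2) A) \<longleftrightarrow>
    (\<exists>r\<in>Units (ring_of R). of_int (D m1' m2') - r * of_int (D m1 m2) \<in> F)"
proof
  assume "\<exists>A\<in>GL2 R. (m1', m2') = row_mult (m1, m2) A"
  then obtain A B where A: "A \<in> carrier_mat 2 2" "elements_mat A \<subseteq> R"
    and B: "B \<in> carrier_mat 2 2" "elements_mat B \<subseteq> R" "A * B = 1\<^sub>m 2"
    and m': "m1' = m1 * A $$ (0, 0) + m2 * A $$ (1, 0)" "m2' = m1 * A $$ (0, 1) + m2 * A $$ (1, 1)"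
    by (auto simp: GL2_def row_mult_def)
  have AR: "A $$ (i, j) \<in> R" "B $$ (i, j) \<in> R" if "i < 2" "j < 2" for i j
    using elements_matI[OF A(1) that refl] elements_matI[OF B(1) that refl] A(2) B(2) by blast+
  have "det A * det B = 1" using det_mult[OF A(1) B(1)] B(3) by simp
  moreover have "det A \<in> R" "det B \<in> R"
    using AR by (auto intro!: R.det_mem[OF A(1)] R.det_mem[OF B(1)])
  ultimately have "det A \<in> Units (ring_of R)" by (auto simp: Units_ring_of)
  moreover have "of_int (D m1' m2') - (A $$ (0, 0) * A $$ (1, 1) - A $$ (0, 1) * A $$ (1, 0)) * of_int (D m1 m2) \<in> F"
    unfolding m' by (intro D_row_mult) (use AR assms in \<open>auto simp: gen_def\<close>)
  ultimately show "\<exists>r\<in>Units (ring_of R). of_int (D m1' m2') - r * of_int (D m1 m2) \<in> F"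
    using det_2x2[OF A(1)] by auto
next
  assume "\<exists>r\<in>Units (ring_of R). of_int (D m1' m2') - r * of_int (D m1 m2) \<in> F"
  then obtain u v where u: "u \<in> R" "v \<in> R" "u * v = 1" "of_int (D m1' m2') - u * of_int (D m1 m2) \<in> F"
    by (auto simp: Units_ring_of)
  have mI: "m1 \<in> I" "m2 \<in> I" using assms by (auto simp: gen_def)
  \<comment> \<open>Scaling \<open>m1\<close> by the unit \<open>u\<close> makes the determinants
    congruent, so \<open>SL2_transitive\<close> applies. The scaling becomes the left factor diag(u,
    1) of \<open>A\<close>.\<close>
  have gen: "gen (u * m1) m2"
    using gen_row_mult[OF assms(1), of u 0 0 1 v] u R.zero_mem R.one_mem by (simp add: mult.commute)
  have "of_int (D (u * m1) m2) - u * of_int (D m1 m2) \<in> F" using u mI by (intro D_mult_left)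
  from F_diff[OF u(4) this] have "of_int (D m1' m2' - D (u * m1) m2) \<in> F" by simp
  then have "g dvd D m1' m2' - D (u * m1) m2" by (simp only: of_int_mem_F_iff)
  then obtain p q r s where R: "p \<in> R" "q \<in> R" "r \<in> R" "s \<in> R" "p * s - q * r = 1"
    "m1' = u * m1 * p + m2 * r" "m2' = u * m1 * q + m2 * s"
    using SL2_transitive[OF gen assms(2)] by metis
  define A where "A = Matrix.mat 2 2 (\<lambda>(i, j). if i = 0 then (if j = 0 then u * p else u * q) else (if j = 0 then r else s))"
  define B where "B = Matrix.mat 2 2 (\<lambda>(i, j). if i = 0 then (if j = 0 then v * s else - q) else (if j = 0 then - (v * r) else p))"
  have A: "A \<in> carrier_mat 2 2" "B \<in> carrier_mat 2 2" by (simp_all add: A_def B_def)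
  have "v * u = 1" using u by (simp add: mult.commute)
  then have uv: "u * (v * x) = x" "v * (u * x) = x" for x using u(3) by (simp_all flip: mult.assoc)
  have "A * B = 1\<^sub>m 2"
  proof (rule eq_matI)
    fix i j assume "i < dim_row (1\<^sub>m 2 :: 'a mat)" "j < dim_col (1\<^sub>m 2 :: 'a mat)"
    then have "i = 0 \<or> i = 1" "j = 0 \<or> j = 1" by auto
    then show "(A * B) $$ (i, j) = 1\<^sub>m 2 $$ (i, j)"
      using R(5) u(3) by (auto simp: A_def B_def scalar_prod_def numeral_2_eq_2 algebra_simps uv)
  qed (simp_all add: A_def B_def)
  moreover from this have "B * A = 1\<^sub>m 2" using A mat_mult_left_right_inverse by blast
  moreover have "elements_mat A \<subseteq> R" "elements_mat B \<subseteq> R"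
    using R u by (auto simp: A_def B_def elements_mat_def R.mult_mem R.uminus_mem)
  ultimately have "A \<in> GL2 R" using A by (auto simp: GL2_def)
  moreover have "(m1', m2') = row_mult (m1, m2) A" using R by (simp add: row_mult_def A_def mult_ac)
  ultimately show "\<exists>A\<in>GL2 R. (m1', m2') = row_mult (m1, m2) A" by blast
qed

section \<open>Determinants of units of the ring of multipliers\<close>

lemma S_units_eq: "S_units = Units (ring_of S)"
  by (auto simp: S_units_def Units_ring_of)

lemma one_S_units: "1 \<in> S_units"
  by (auto simp: S_units_def S.one_mem)

lemma S_units_mult: "u \<in> S_units \<Longrightarrow> u' \<in> S_units \<Longrightarrow> u * u' \<in> S_units"
proof -
  assume "u \<in> S_units" "u' \<in> S_units"
  then obtain v v' where "u \<in> S" "u' \<in> S" "v \<in> S" "v' \<in> S" "u * v = 1" "u' * v' = 1"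
    by (auto simp: S_units_def)
  moreover from this have "u * u' * (v * v') = 1" by (metis mult.left_commute mult.assoc mult.right_neutral)
  ultimately show ?thesis unfolding S_units_def using S.mult_mem by blast
qed

lemma det_unit_eq:
  assumes "u \<in> S_units"
  shows "det_unit R I u = cls (nrm u)"
proof -
  have "det_pair R I m (map_prod ((*) u) ((*) u) m) = cls (nrm u)" if m: "m \<in> gen_pairs R I" for m
  proof -
    obtain m1 m2 where m': "m = (m1, m2)" "gen m1 m2" using m by (auto simp: gen_pairs)
    have "D (u * m1) (u * m2) = nrm u * D m1 m2"
      using assms m' by (intro D_S_mult) (auto simp: S_units_def gen_def)
    then show ?thesis
      using det_pair_eq[OF m'(2) gen_unit_mult[OF assms m'(2)], of "nrm u"] by (simp add: m' cls_def)
  qed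
  moreover have "(al, al * t) \<in> gen_pairs R I" using gen_basis by (simp add: gen_pairs)
  ultimately show ?thesis
    unfolding det_unit_def by (intro the_equality) auto
qed

definition eps :: "'a set set" where "eps = (\<lambda>u. cls (nrm u)) ` S_units"

lemma eps_group_eq: "det_unit R I ` Units (ring_of S) = eps"
  unfolding eps_def S_units_eq[symmetric] by (intro image_cong refl det_unit_eq)

lemma cls_pm_one: "cls 1 \<in> carrier (units_of Q)" "cls (- 1) \<in> carrier (units_of Q)"
  by auto

lemma eps_subset: "eps \<subseteq> {cls 1, cls (- 1)}"
proof
  fix x assume "x \<in> eps"
  then obtain u where "u \<in> S_units" "x = cls (nrm u)" by (auto simp: eps_def)
  with nrm_unit[of u] show "x \<in> {cls 1, cls (- 1)}" by auto
qed

lemma subgroup_eps: "subgroup eps (units_of Q)"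
proof (rule UQ.subgroupI)
  show "eps \<subseteq> carrier (units_of Q)" using eps_subset cls_pm_one by blast
  show "eps \<noteq> {}" using one_S_units by (auto simp: eps_def)
  fix x assume x: "x \<in> eps"
  then obtain u where u: "u \<in> S_units" "x = cls (nrm u)" by (auto simp: eps_def)
  have "x \<otimes>\<^bsub>units_of Q\<^esub> x = \<one>\<^bsub>units_of Q\<^esub>"
    using nrm_unit[OF u(1)] u(2) by auto
  then have "inv\<^bsub>units_of Q\<^esub> x = x"
    using x eps_subset cls_pm_one by (intro UQ.inv_equality) auto
  with x show "inv\<^bsub>units_of Q\<^esub> x \<in> eps" by simp
next
  fix x y assume "x \<in> eps" "y \<in> eps"
  then obtain u u' where u: "u \<in> S_units" "x = cls (nrm u)" "u' \<in> S_units" "y = cls (nrm u')"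
    by (auto simp: eps_def)
  then have "x \<otimes>\<^bsub>units_of Q\<^esub> y = cls (nrm (u * u'))"
    by (simp add: nrm_mult S_units_def)
  then show "x \<otimes>\<^bsub>units_of Q\<^esub> y \<in> eps" using S_units_mult[OF u(1,3)] by (auto simp: eps_def)
qed

text \<open>The classes of 1 and - 1 coincide exactly if \<open>g\<close> divides 2; this is the
  origin of the condition \<open>f div f' > 2\<close> in \<open>eps_exponent\<close>.\<close>

lemma card_eps: "card eps = (if (\<exists>u\<in>S_units. nrm u = - 1) \<and> g > 2 then 2 else 1)"
proof -
  have 1: "cls 1 \<in> eps" using one_S_units by (force simp: eps_def)
  have eq: "cls 1 = cls (- 1) \<longleftrightarrow> g \<le> 2"
  proof -
    have "g dvd 2 \<longleftrightarrow> g \<le> 2"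
    proof
      assume "g \<le> 2"
      with g_pos have "g = 1 \<or> g = 2" by linarith
      then show "g dvd 2" by auto
    qed (simp add: zdvd_imp_le)
    then show ?thesis by (simp add: cls_eq_iff)
  qed
  show ?thesis
  proof (cases "(\<exists>u\<in>S_units. nrm u = - 1) \<and> g > 2")
    case True
    then have "cls (- 1) \<in> eps" by (force simp: eps_def)
    with 1 eps_subset have "eps = {cls 1, cls (- 1)}" by blast
    with True eq show ?thesis by simp
  next
    case False
    have "eps = {cls 1}"
    proof (cases "g \<le> 2")
      case True
      with 1 eps_subset eq show ?thesis by auto
    next
      case False
      then have "nrm u = 1" if "u \<in> S_units" for u
        using \<open>\<not> ((\<exists>u\<in>S_units. nrm u = - 1) \<and> g > 2)\<close> nrm_unit[OF that] that by auto
      with 1 show ?thesis by (auto simp: eps_def)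
    qed
    with False show ?thesis by auto
  qed
qed

lemma det_pair_basis:
  assumes "gen m1 m2"
  shows "det_pair R I (al, al * t) (m1, m2) = cls (D m1 m2)"
  using det_pair_eq[OF gen_basis assms, of "D m1 m2"] by (simp add: cls_def)

lemma det_pair_cls:
  assumes m: "gen m1 m2" and m': "gen m1' m2'" and i: "g dvd D m1 m2 * i - 1"
  shows "det_pair R I (m1, m2) (m1', m2') = cls (D m1' m2' * i)"
proof -
  have "D m1' m2' - D m1' m2' * i * D m1 m2 = - D m1' m2' * (D m1 m2 * i - 1)"
    by (simp add: algebra_simps)
  with i have "g dvd D m1' m2' - D m1' m2' * i * D m1 m2" by (metis dvd_mult)
  from det_pair_eq[OF m m' this] show ?thesis by (simp add: cls_def)
qed

lemma det_pair_surj: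
  assumes m: "m \<in> gen_pairs R I"
  shows "det_pair R I m ` gen_pairs R I = carrier (units_of Q)"
proof -
  obtain m1 m2 where m': "m = (m1, m2)" "gen m1 m2" using m by (auto simp: gen_pairs)
  obtain i where i: "g dvd D m1 m2 * i - 1" using D_unit[OF m'(2)] .
  then obtain k where "D m1 m2 * i - 1 = g * k" by (rule dvdE)
  then have k: "D m1 m2 * i - g * k = 1" by simp
  then have ci: "Rings.coprime i g" by (metis coprimeI dvd_diff dvd_mult dvd_mult2)
  show ?thesis
  proof (intro subset_antisym subsetI)
    fix y assume "y \<in> det_pair R I m ` gen_pairs R I"
    then obtain m1' m2' where "gen m1' m2'" "y = cls (D m1' m2' * i)"
      using det_pair_cls[OF m'(2) _ i] by (auto simp: gen_pairs m')
    with ci D_coprime show "y \<in> carrier (units_of Q)" by simp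
  next
    fix y assume "y \<in> carrier (units_of Q)"
    then obtain z where z: "y = cls z" "Rings.coprime z g" by auto
    \<comment> \<open>Determinants relative to \<open>m\<close> are quotients by
      \<open>D m1 m2\<close>, so the class of \<open>z\<close> is reached by a pair whose
      \<open>D\<close> is congruent to \<open>z * D m1 m2\<close>.\<close>
    then have "Rings.coprime (z * D m1 m2) g" using D_coprime[OF m'(2)] by simp
    then obtain m1' m2' where g': "gen m1' m2'" "g dvd D m1' m2' - z * D m1 m2"
      using gen_surj by blast
    then have "g dvd i * (D m1' m2' - z * D m1 m2) + z * (D m1 m2 * i - 1)" using i by simp
    moreover have "i * (D m1' m2' - z * D m1 m2) + z * (D m1 m2 * i - 1) = D m1' m2' * i - z"
      by (simp add: algebra_simps)
    ultimately have "y = cls (D m1' m2' * i)" by (simp add: z cls_eq_iff dvd_diff_commute)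
    then have "y = det_pair R I m (m1', m2')" using det_pair_cls[OF m'(2) g'(1) i] m' by simp
    then show "y \<in> det_pair R I m ` gen_pairs R I" using g'(1) by (auto simp: gen_pairs)
  qed
qed

text \<open>The reference pair \<open>(al, al * t)\<close> has \<open>D = 1\<close>, so its
  determinant map is the class of \<open>D\<close>. A unit \<open>u\<close> multiplies
  \<open>D\<close> by \<open>nrm u\<close>, and \<open>SL2\<close> connects exactly the pairs with
  congruent \<open>D\<close>.\<close>

theorem card_unit_SL2_orbits:
  "card (pairs_mod (unit_mults S) (gen_pairs R I) (SL2 R)) = card (rcosets\<^bsub>units_of Q\<^esub> eps)"
proof -
  let ?E = "orbit_rel (unit_mults S) (gen_pairs R I) (SL2 R)"
  let ?\<delta> = "det_pair R I (al, al * t)"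
  have E: "(m, m') \<in> ?E \<longleftrightarrow> m \<in> gen_pairs R I \<and> m' \<in> gen_pairs R I \<and>
      (\<exists>h\<in>eps. ?\<delta> m' = h \<otimes>\<^bsub>units_of Q\<^esub> ?\<delta> m)" for m m'
  proof -
    have "(\<exists>\<phi>\<in>unit_mults S. \<exists>A\<in>SL2 R. m' = row_mult (map_prod \<phi> \<phi> m) A)
      \<longleftrightarrow> (\<exists>h\<in>eps. ?\<delta> m' = h \<otimes>\<^bsub>units_of Q\<^esub> ?\<delta> m)"
      if "m \<in> gen_pairs R I" "m' \<in> gen_pairs R I"
    proof -
      obtain m1 m2 m1' m2' where eq: "m = (m1, m2)" "m' = (m1', m2')" by (metis surj_pair)
      with that have m: "m = (m1, m2)" "gen m1 m2" "m' = (m1', m2')" "gen m1' m2'"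
        by (simp_all add: gen_pairs)
      have "(\<exists>A\<in>SL2 R. (m1', m2') = row_mult (u * m1, u * m2) A) \<longleftrightarrow> g dvd D m1' m2' - nrm u * D m1 m2"
        if u: "u \<in> S_units" for u
        using SL2_iff[OF gen_unit_mult[OF u m(2)] m(4)] D_S_mult[of u m1 m2] m(2) u
        by (simp add: gen_def S_units_def)
      then have "(\<exists>\<phi>\<in>unit_mults S. \<exists>A\<in>SL2 R. m' = row_mult (map_prod \<phi> \<phi> m) A)
        \<longleftrightarrow> (\<exists>u\<in>S_units. g dvd D m1' m2' - nrm u * D m1 m2)"
        by (simp add: m unit_mults_def S_units_eq[symmetric])
      also have "\<dots> \<longleftrightarrow> (\<exists>h\<in>eps. ?\<delta> m' = h \<otimes>\<^bsub>units_of Q\<^esub> ?\<delta> m)"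
        by (simp add: eps_def m det_pair_basis cls_eq_iff)
      finally show ?thesis .
    qed
    then show ?thesis unfolding orbit_rel_def by blast
  qed
  have "(al, al * t) \<in> gen_pairs R I" using gen_basis by (simp add: gen_pairs)
  then obtain h where "bij_betw h (gen_pairs R I // ?E) (rcosets\<^bsub>units_of Q\<^esub> eps)"
    using UQ.quotient_rcosets_bij_betw[OF subgroup_eps det_pair_surj E] by blast
  then show ?thesis unfolding pairs_mod_def by (rule bij_betw_same_card)
qed

theorem card_rcosets_eps:
  "real (card (rcosets\<^bsub>units_of Q\<^esub> eps)) = real (totient (nat g)) /
    2 ^ (if (\<exists>u\<in>S_units. nrm u = - 1) \<and> g > 2 then 1 else 0)"
proof -
  have "card (rcosets\<^bsub>units_of Q\<^esub> eps) * card eps = totient (nat g)"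
    using UQ.lagrange_finite[OF finite_UQ subgroup_eps] card_UQ by (simp add: Coset.order_def)
  then have "real (card (rcosets\<^bsub>units_of Q\<^esub> eps)) * real (card eps) = real (totient (nat g))"
    by (simp flip: of_nat_mult)
  moreover have "real (card eps) = 2 ^ (if (\<exists>u\<in>S_units. nrm u = - 1) \<and> g > 2 then 1 else 0)"
    unfolding card_eps by (simp only: if_distrib[of real] if_distrib[of "(^) 2"]) simp
  ultimately show ?thesis by (simp only: eq_divide_eq) simp
qed

section \<open>Orbits of \<open>GL2\<close> and the action of automorphisms\<close>

lemma GL2_orbit_iff:
  "(m, m') \<in> orbit_rel {id} (gen_pairs R I) (GL2 R) \<longleftrightarrow> m \<in> gen_pairs R I \<and> m' \<in> gen_pairs R I \<and>
    (\<exists>r\<in>Units (ring_of R). of_int (D (fst m') (snd m')) - r * of_int (D (fst m) (snd m)) \<in> F)"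
proof -
  have "(\<exists>A\<in>GL2 R. m' = row_mult m A) \<longleftrightarrow>
    (\<exists>r\<in>Units (ring_of R). of_int (D (fst m') (snd m')) - r * of_int (D (fst m) (snd m)) \<in> F)"
    if "m \<in> gen_pairs R I" "m' \<in> gen_pairs R I"
    using GL2_iff[of "fst m" "snd m" "fst m'" "snd m'"] that
    by (simp add: gen_pairs case_prod_beta)
  then show ?thesis unfolding orbit_rel_def by (auto simp: map_prod.id)
qed

lemma pm_one_Units_R: "1 \<in> Units (ring_of R)" "- 1 \<in> Units (ring_of R)"
  unfolding Units_ring_of using R.one_mem R.uminus_mem[OF R.one_mem] by (auto intro: bexI[of _ "- 1"])

lemma Units_R_mult: "r \<in> Units (ring_of R) \<Longrightarrow> r' \<in> Units (ring_of R) \<Longrightarrow> r * r' \<in> Units (ring_of R)"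
  using monoid.Units_m_closed[OF cring.axioms(1)[OF R.cring_ring_of, THEN ring.axioms(2)]] by fastforce

lemma Units_R_subset: "Units (ring_of R) \<subseteq> R"
  by (auto simp: Units_ring_of)

lemma module_auts_unit:
  assumes "\<phi> \<in> module_auts R I"
  obtains u where "u \<in> S_units" "\<And>z. z \<in> I \<Longrightarrow> \<phi> z = u * z"
  using automorphism_unit[of \<phi>] assms unfolding module_auts_def by blast

text \<open>\<open>nrm u\<close> is 1 or - 1, thus a unit of \<open>R\<close>; it is absorbed into
  the unit \<open>r\<close> that relates the two determinants.\<close>

lemma unit_mult_GL2_orbit:
  assumes "(m, m') \<in> orbit_rel {id} (gen_pairs R I) (GL2 R)" "u \<in> S_units"
  shows "(map_prod ((*) u) ((*) u) m, m') \<in> orbit_rel {id} (gen_pairs R I) (GL2 R)"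
    and "(m, map_prod ((*) u) ((*) u) m') \<in> orbit_rel {id} (gen_pairs R I) (GL2 R)"
proof -
  obtain r where r: "m \<in> gen_pairs R I" "m' \<in> gen_pairs R I" "r \<in> Units (ring_of R)"
    "of_int (D (fst m') (snd m')) - r * of_int (D (fst m) (snd m)) \<in> F"
    using assms(1) unfolding GL2_orbit_iff by blast
  have gen: "map_prod ((*) u) ((*) u) n \<in> gen_pairs R I" if "n \<in> gen_pairs R I" for n
    using that gen_unit_mult[OF assms(2)] by (auto simp: gen_pairs)
  have D: "D (u * fst n) (u * snd n) = nrm u * D (fst n) (snd n)" if "n \<in> gen_pairs R I" for n
    using that assms(2) by (intro D_S_mult) (auto simp: gen_pairs gen_def S_units_def)
  have nrm: "nrm u * nrm u = 1" "of_int (nrm u) \<in> Units (ring_of R)"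
    using nrm_unit[OF assms(2)] pm_one_Units_R by auto
  have ru: "of_int (nrm u) * r \<in> Units (ring_of R)" using nrm r Units_R_mult by blast
  have "of_int (nrm u) * r * of_int (nrm u * D (fst m) (snd m)) = r * of_int (D (fst m) (snd m)) * of_int (nrm u * nrm u)"
    by (simp add: mult_ac)
  also have "\<dots> = r * of_int (D (fst m) (snd m))" unfolding nrm(1) by simp
  finally have "of_int (D (fst m') (snd m')) - of_int (nrm u) * r * of_int (nrm u * D (fst m) (snd m)) \<in> F"
    using r(4) by (simp only:)
  with ru r gen show "(map_prod ((*) u) ((*) u) m, m') \<in> orbit_rel {id} (gen_pairs R I) (GL2 R)"
    unfolding GL2_orbit_iff by (auto simp: D simp del: of_int_mult)
  have "of_int (nrm u) * (of_int (D (fst m') (snd m')) - r * of_int (D (fst m) (snd m))) \<in> F"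
    using r(4) by (intro F_mult S.of_int_mem)
  then have "of_int (nrm u * D (fst m') (snd m')) - of_int (nrm u) * r * of_int (D (fst m) (snd m)) \<in> F"
    by (simp add: algebra_simps)
  with ru r gen show "(m, map_prod ((*) u) ((*) u) m') \<in> orbit_rel {id} (gen_pairs R I) (GL2 R)"
    unfolding GL2_orbit_iff by (auto simp: D simp del: of_int_mult)
qed

lemma map_prod_module_aut:
  assumes "m \<in> gen_pairs R I" "\<And>z. z \<in> I \<Longrightarrow> \<phi> z = u * z"
  shows "map_prod \<phi> \<phi> m = map_prod ((*) u) ((*) u) m"
  using assms by (auto simp: gen_pairs gen_def)

text \<open>Already the orbit relations agree, since an automorphism is multiplication by a unit of
  \<open>S\<close> and changes \<open>D\<close> at most by a sign.\<close>

theorem pairs_mod_module_auts: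
  "pairs_mod (module_auts R I) (gen_pairs R I) (GL2 R) = pairs_mod {id} (gen_pairs R I) (GL2 R)"
proof -
  have "orbit_rel (module_auts R I) (gen_pairs R I) (GL2 R) = orbit_rel {id} (gen_pairs R I) (GL2 R)"
  proof (intro subset_antisym subsetI)
    fix x assume "x \<in> orbit_rel (module_auts R I) (gen_pairs R I) (GL2 R)"
    then obtain m m' \<phi> A where x: "x = (m, m')" "m \<in> gen_pairs R I" "m' \<in> gen_pairs R I"
      "\<phi> \<in> module_auts R I" "A \<in> GL2 R" "m' = row_mult (map_prod \<phi> \<phi> m) A"
      unfolding orbit_rel_def by blast
    obtain u where u: "u \<in> S_units" "\<And>z. z \<in> I \<Longrightarrow> \<phi> z = u * z" using module_auts_unit x(4) by blast
    have eq: "map_prod \<phi> \<phi> m = map_prod ((*) u) ((*) u) m" using map_prod_module_aut x(2) u(2) by blast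
    have "map_prod ((*) u) ((*) u) m \<in> gen_pairs R I"
      using x(2) gen_unit_mult[OF u(1)] by (auto simp: gen_pairs)
    with x eq have "(map_prod ((*) u) ((*) u) m, m') \<in> orbit_rel {id} (gen_pairs R I) (GL2 R)"
      unfolding orbit_rel_def by (auto simp: map_prod.id)
    then obtain r where r: "r \<in> Units (ring_of R)"
        "of_int (D (fst m') (snd m')) - r * of_int (D (u * fst m) (u * snd m)) \<in> F"
      unfolding GL2_orbit_iff by auto
    have D: "D (u * fst m) (u * snd m) = nrm u * D (fst m) (snd m)"
      using x(2) u(1) by (intro D_S_mult) (auto simp: gen_pairs gen_def S_units_def)
    have "of_int (nrm u) \<in> Units (ring_of R)"
      using nrm_unit[OF u(1)] pm_one_Units_R by auto
    then have "r * of_int (nrm u) \<in> Units (ring_of R)" by (rule Units_R_mult[OF r(1)])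
    moreover have "of_int (D (fst m') (snd m')) - r * of_int (nrm u) * of_int (D (fst m) (snd m)) \<in> F"
      using r(2) by (simp add: D mult.assoc)
    ultimately show "x \<in> orbit_rel {id} (gen_pairs R I) (GL2 R)"
      unfolding x(1) GL2_orbit_iff using x(2,3) by blast
  next
    fix x assume "x \<in> orbit_rel {id} (gen_pairs R I) (GL2 R)"
    moreover have "id \<in> module_auts R I" by (auto simp: module_auts_def)
    ultimately show "x \<in> orbit_rel (module_auts R I) (gen_pairs R I) (GL2 R)"
      unfolding orbit_rel_def by blast
  qed
  then show ?thesis by (simp add: pairs_mod_def)
qed

theorem module_auts_act_trivially:
  assumes \<phi>: "\<phi> \<in> module_auts R I" and Y: "Y \<in> pairs_mod {id} (gen_pairs R I) (GL2 R)"
  shows "map_prod \<phi> \<phi> ` Y = Y"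
proof -
  obtain u where u: "u \<in> S_units" "\<And>z. z \<in> I \<Longrightarrow> \<phi> z = u * z" using module_auts_unit \<phi> by blast
  obtain v where v: "v \<in> S" "u \<in> S" "u * v = 1" using u(1) by (auto simp: S_units_def)
  then have v': "v \<in> S_units" by (auto simp: S_units_def mult.commute)
  obtain m where m: "m \<in> gen_pairs R I" "Y = orbit_rel {id} (gen_pairs R I) (GL2 R) `` {m}"
    using Y unfolding pairs_mod_def by (auto elim: quotientE)
  have YV: "m' \<in> gen_pairs R I" if "m' \<in> Y" for m' using that m by (auto simp: GL2_orbit_iff)
  have closed: "map_prod ((*) s) ((*) s) m' \<in> Y" if "m' \<in> Y" "s \<in> S_units" for m' s
    using unit_mult_GL2_orbit(2)[OF _ that(2)] that(1) m(2) by blast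
  have eq: "map_prod \<phi> \<phi> m' = map_prod ((*) u) ((*) u) m'" if "m' \<in> Y" for m'
    using map_prod_module_aut YV[OF that] u(2) by blast
  show ?thesis
  proof (intro subset_antisym subsetI)
    fix y assume "y \<in> map_prod \<phi> \<phi> ` Y"
    then show "y \<in> Y" using eq closed u(1) by auto
  next
    fix y assume y: "y \<in> Y"
    have "map_prod \<phi> \<phi> (map_prod ((*) v) ((*) v) y) = map_prod ((*) u) ((*) u) (map_prod ((*) v) ((*) v) y)"
      using eq closed[OF y v'] by blast
    also have "\<dots> = y" using v by (cases y) (simp flip: mult.assoc)
    finally show "y \<in> map_prod \<phi> \<phi> ` Y" using closed[OF y v'] by (metis image_eqI)
  qed
qed

lemma unit_image_eq: "unit_image R I = (\<lambda>r. F +>\<^bsub>ring_of R\<^esub> r) ` Units (ring_of R)"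
  unfolding unit_image_def fitting ..

lemma coset_unit:
  assumes "r \<in> R"
  obtains x where "F +>\<^bsub>ring_of R\<^esub> r = cls x" "r - of_int x \<in> F"
  using assms R_iff coset_eq_cls by blast

lemma coset_mult:
  assumes "r \<in> R" "r' \<in> R"
  shows "(F +>\<^bsub>ring_of R\<^esub> r) \<otimes>\<^bsub>units_of Q\<^esub> (F +>\<^bsub>ring_of R\<^esub> r') = F +>\<^bsub>ring_of R\<^esub> (r * r')"
  using ideal.rcoset_mult_add[OF ideal_F, of r r'] assms
  by (simp add: units_of_def Q_def FactRing_def)

lemma subgroup_unit_image: "subgroup (unit_image R I) (units_of Q)"
  unfolding unit_image_eq
proof (rule UQ.subgroupI)
  have inv: "(F +>\<^bsub>ring_of R\<^esub> r) \<otimes>\<^bsub>units_of Q\<^esub> (F +>\<^bsub>ring_of R\<^esub> r') = \<one>\<^bsub>units_of Q\<^esub>"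
    if "r \<in> R" "r' \<in> R" "r * r' = 1" for r r'
    using coset_mult[OF that(1,2)] that(3) by (simp add: cls_def)
  show sub: "(\<lambda>r. F +>\<^bsub>ring_of R\<^esub> r) ` Units (ring_of R) \<subseteq> carrier (units_of Q)"
  proof
    fix y assume "y \<in> (\<lambda>r. F +>\<^bsub>ring_of R\<^esub> r) ` Units (ring_of R)"
    then obtain r r' where r: "y = F +>\<^bsub>ring_of R\<^esub> r" "r \<in> R" "r' \<in> R" "r * r' = 1"
      by (auto simp: Units_ring_of)
    obtain x x' where x: "F +>\<^bsub>ring_of R\<^esub> r = cls x" "F +>\<^bsub>ring_of R\<^esub> r' = cls x'"
      using coset_unit r by metis
    have "cls x \<otimes>\<^bsub>units_of Q\<^esub> cls x' = cls 1" using inv[OF r(2-4)] x by simp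
    then have "cls x \<in> Units Q" "cls x' \<in> carrier Q"
      using carrier_Q cls_mult one_Q by (auto simp: Units_def mult.commute)
    then show "y \<in> carrier (units_of Q)" using r x by (simp add: units_of_def)
  qed
  show "(\<lambda>r. F +>\<^bsub>ring_of R\<^esub> r) ` Units (ring_of R) \<noteq> {}" using pm_one_Units_R by blast
  fix y assume y: "y \<in> (\<lambda>r. F +>\<^bsub>ring_of R\<^esub> r) ` Units (ring_of R)"
  then obtain r r' where r: "y = F +>\<^bsub>ring_of R\<^esub> r" "r \<in> R" "r' \<in> R" "r * r' = 1" "r' * r = 1"
    by (auto simp: Units_ring_of mult.commute)
  then have r': "r' \<in> Units (ring_of R)" by (auto simp: Units_ring_of)
  then have "inv\<^bsub>units_of Q\<^esub> y = F +>\<^bsub>ring_of R\<^esub> r'"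
    using sub y inv[OF r(3,2,5)] r(1) by (intro UQ.inv_equality) auto
  with r' show "inv\<^bsub>units_of Q\<^esub> y \<in> (\<lambda>r. F +>\<^bsub>ring_of R\<^esub> r) ` Units (ring_of R)" by blast
  fix z assume "z \<in> (\<lambda>r. F +>\<^bsub>ring_of R\<^esub> r) ` Units (ring_of R)"
  with y show "y \<otimes>\<^bsub>units_of Q\<^esub> z \<in> (\<lambda>r. F +>\<^bsub>ring_of R\<^esub> r) ` Units (ring_of R)"
    using coset_mult Units_R_mult Units_R_subset by blast
qed

theorem GL2_orbits_bij:
  assumes m: "m \<in> gen_pairs R I"
  shows "\<exists>h. bij_betw h (pairs_mod {id} (gen_pairs R I) (GL2 R)) (carrier (units_of Q Mod unit_image R I)) \<and>
    (\<forall>m'\<in>gen_pairs R I. h (orbit_rel {id} (gen_pairs R I) (GL2 R) `` {m'}) =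
      unit_image R I #>\<^bsub>units_of Q\<^esub> det_pair R I m m')"
proof -
  let ?E = "orbit_rel {id} (gen_pairs R I) (GL2 R)"
  obtain m1 m2 where m': "m = (m1, m2)" "gen m1 m2" using m by (auto simp: gen_pairs)
  obtain i where i: "g dvd D m1 m2 * i - 1" using D_unit[OF m'(2)] .
  have \<delta>: "det_pair R I m n = cls (D (fst n) (snd n) * i)" if "n \<in> gen_pairs R I" for n
    using det_pair_cls[OF m'(2) _ i, of "fst n" "snd n"] that by (auto simp: gen_pairs m')
  have "(n, n') \<in> ?E \<longleftrightarrow> n \<in> gen_pairs R I \<and> n' \<in> gen_pairs R I \<and>
      (\<exists>h\<in>unit_image R I. det_pair R I m n' = h \<otimes>\<^bsub>units_of Q\<^esub> det_pair R I m n)" for n n'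
  proof -
    have "of_int (D (fst n') (snd n')) - r * of_int (D (fst n) (snd n)) \<in> F \<longleftrightarrow>
        det_pair R I m n' = (F +>\<^bsub>ring_of R\<^esub> r) \<otimes>\<^bsub>units_of Q\<^esub> det_pair R I m n"
      if n: "n \<in> gen_pairs R I" "n' \<in> gen_pairs R I" and r: "r \<in> Units (ring_of R)" for r
    proof -
      have rR: "r \<in> R" using r Units_R_subset by blast
      have ri: "of_int i \<in> R" "of_int (D m1 m2) \<in> S" "of_int i \<in> S"
        by (auto intro: R.of_int_mem S.of_int_mem)
      define d d' where "d = D (fst n) (snd n)" and "d' = D (fst n') (snd n')"
      have iF: "of_int (D m1 m2 * i - 1) \<in> F" using i of_int_mem_F_iff by blast
      define x where "x = of_int d' - r * of_int d"
      have xS: "x \<in> S" unfolding x_def using rR R_subset_S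
        by (intro S.diff_mem S.mult_mem S.of_int_mem) auto
      have "det_pair R I m n' = (F +>\<^bsub>ring_of R\<^esub> r) \<otimes>\<^bsub>units_of Q\<^esub> det_pair R I m n
        \<longleftrightarrow> F +>\<^bsub>ring_of R\<^esub> of_int (d' * i) = F +>\<^bsub>ring_of R\<^esub> (r * of_int (d * i))"
        unfolding \<delta>[OF n(1)] \<delta>[OF n(2)] cls_def coset_mult[OF rR R.of_int_mem] d_def d'_def ..
      also have "\<dots> \<longleftrightarrow> of_int i * x \<in> F"
        unfolding F_coset_eq_iff by (simp add: x_def algebra_simps)
      \<comment> \<open>\<open>i\<close> is invertible modulo \<open>g\<close>, with inverse
        \<open>D m1 m2\<close>, so it can be cancelled.\<close>
      also have "\<dots> \<longleftrightarrow> x \<in> F"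
      proof
        assume "of_int i * x \<in> F"
        then have "of_int (D m1 m2) * (of_int i * x) - x * of_int (D m1 m2 * i - 1) \<in> F"
          using iF ri xS F_diff F_mult by presburger
        moreover have "of_int (D m1 m2) * (of_int i * x) - x * of_int (D m1 m2 * i - 1) = x"
          by (simp add: algebra_simps)
        ultimately show "x \<in> F" by (simp only:)
      qed (use ri F_mult in blast)
      finally show ?thesis unfolding x_def d_def d'_def by blast
    qed
    then show ?thesis unfolding GL2_orbit_iff unit_image_eq by blast
  qed
  then obtain h where "bij_betw h (gen_pairs R I // ?E) (rcosets\<^bsub>units_of Q\<^esub> unit_image R I)"
    "\<And>n. n \<in> gen_pairs R I \<Longrightarrow> h (?E `` {n}) = unit_image R I #>\<^bsub>units_of Q\<^esub> det_pair R I m n"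
    using UQ.quotient_rcosets_bij_betw[OF subgroup_unit_image det_pair_surj[OF m]] by blast
  then show ?thesis by (auto simp: pairs_mod_def FactGroup_def)
qed

text \<open>The image of a unit \<open>r\<close> of \<open>R\<close> in \<open>\<int>/g\<close> has square \<open>nrm r = \<plusminus>1\<close>, whereas a residue class that is
  \<open>1\<close> modulo \<open>p\<close> and \<open>2\<close> modulo \<open>q\<close> does not have square \<open>\<plusminus>1\<close>.\<close>

theorem GL2_not_transitive:
  assumes trans: "\<forall>m\<in>gen_pairs R I. \<forall>m'\<in>gen_pairs R I. \<exists>A\<in>GL2 R. m' = row_mult m A"
  shows "card {p. prime p \<and> odd p \<and> p dvd nat g} < 3"
proof (rule ccontr)
  assume "\<not> ?thesis"
  moreover define P where "P = {p. prime p \<and> odd p \<and> p dvd nat g}"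
  ultimately have card: "card P \<ge> 3" by simp
  have square: "g dvd d * d - 1 \<or> g dvd d * d + 1" if d: "Rings.coprime d g" for d
  proof -
    obtain m1 m2 where m: "gen m1 m2" "g dvd D m1 m2 - d" using gen_surj[OF d] .
    have "\<exists>A\<in>GL2 R. (m1, m2) = row_mult (al, al * t) A"
      using trans m(1) gen_basis by (auto simp: gen_pairs)
    then obtain r where r: "r \<in> Units (ring_of R)" "of_int (D m1 m2) - r * of_int (D al (al * t)) \<in> F"
      using GL2_iff[OF gen_basis m(1)] by blast
    have "of_int (D m1 m2 - d) \<in> F" using m(2) of_int_mem_F_iff by blast
    from F_diff[OF this r(2)] have "r - of_int d \<in> F" by simp
    from nrm_R[OF this] have "g dvd nrm r - d * d" .
    moreover have "r \<in> S_units" using r(1) R_subset_S by (auto simp: S_units_def Units_ring_of)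
    ultimately show ?thesis using nrm_unit by (fastforce simp: dvd_diff_commute algebra_simps)
  qed
  \<comment> \<open>For \<open>d\<close> congruent to 2 modulo \<open>q\<close> and to 1 modulo
    \<open>p\<close>, \<open>d * d - 1\<close> is 3 modulo \<open>q\<close> and
    \<open>d * d + 1\<close> is 2 modulo \<open>p\<close>. Hence \<open>q\<close> is chosen
    different from 3, and \<open>p\<close> odd.\<close>
  have "card (P - {3}) \<ge> 2" using card diff_card_le_card_Diff[of "{3}" P] by simp
  then obtain q where q: "q \<in> P" "q \<noteq> 3" by (metis Diff_iff all_not_in_conv card.empty insertI1 not_numeral_le_zero)
  have "card (P - {q}) \<ge> 2" using card diff_card_le_card_Diff[of "{q}" P] by simp
  then obtain p where p: "p \<in> P" "p \<noteq> q" by (metis Diff_iff all_not_in_conv card.empty insertI1 not_numeral_le_zero)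
  have pq: "prime p" "prime q" "odd p" "odd q" "int p dvd g" "int q dvd g"
    using p q g_pos int_dvd_int_iff[of p "nat g"] int_dvd_int_iff[of q "nat g"]
    by (simp_all add: P_def)
  have "Rings.coprime (int p) (int q)" using pq p(2) by (simp add: primes_coprime)
  then obtain u v where uv: "u * int p + v * int q = 1" by (metis bezout_int coprime_imp_gcd_eq_1)
  define d0 where "d0 = 1 + u * int p"
  have d0: "d0 = 2 - v * int q" using uv by (simp add: d0_def)
  have "Rings.coprime d0 (int p)"
    unfolding d0_def using gcd_add_mult[of "int p" u 1] by (simp add: coprime_iff_gcd_eq_1 gcd.commute add.commute)
  moreover have "Rings.coprime d0 (int q)"
  proof -
    have "Rings.coprime 2 (int q)" using pq(4) by simp
    then show ?thesis
      unfolding d0 using gcd_add_mult[of "int q" "- v" 2] by (simp add: coprime_iff_gcd_eq_1 gcd.commute)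
  qed
  ultimately have "Rings.coprime d0 (int p * int q)" by simp
  \<comment> \<open>Shifting by a multiple of \<open>p q\<close> keeps both residues and makes the
    integer prime to \<open>g\<close>.\<close>
  then obtain k where k: "Rings.coprime (d0 + k * (int p * int q)) g"
    using coprime_shift[of d0 "int p * int q" g] g_pos by auto
  define d where "d = d0 + k * (int p * int q)"
  have dp: "d = 1 + int p * (u + k * int q)" unfolding d_def d0_def by (simp add: algebra_simps)
  have dq: "d = 2 + int q * (k * int p - v)" unfolding d_def d0 by (simp add: algebra_simps)
  from square[OF k] show False
    unfolding d_def[symmetric]
  proof
    assume "g dvd d * d - 1"
    then have "int q dvd d * d - 1" using pq(6) dvd_trans by blast
    moreover have "d * d - 1 = 3 + int q * ((k * int p - v) * (d + 2))" 
      by (subst (1 2) dq) (simp add: dq algebra_simps)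
    ultimately have "int q dvd 3" by (simp add: dvd_add_left_iff)
    then have "q dvd 3" by (metis int_dvd_int_iff of_nat_numeral)
    then have "q \<le> 3" by (rule dvd_imp_le) simp
    then have "q = 0 \<or> q = 1 \<or> q = 2 \<or> q = 3" by linarith
    then show False using q(2) pq(2,4) by auto
  next
    assume "g dvd d * d + 1"
    then have "int p dvd d * d + 1" using pq(5) dvd_trans by blast
    moreover have "d * d + 1 = 2 + int p * ((u + k * int q) * (d + 1))"
      by (subst (1 2) dp) (simp add: dp algebra_simps)
    ultimately have "int p dvd 2" by (simp add: dvd_add_left_iff)
    then have "p dvd 2" by (metis int_dvd_int_iff of_nat_numeral)
    then have "p \<le> 2" by (rule dvd_imp_le) simp
    then have "p = 0 \<or> p = 1 \<or> p = 2" by linarith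
    then show False using pq(1,3) by auto
  qed
qed

end

section \<open>Quadratic fields\<close>

lemma rat_square_Ints:
  fixes x :: rat
  assumes "x * x \<in> \<int>"
  shows "x \<in> \<int>"
proof (rule rational_algebraic_int_is_int)
  show "algebraic_int x"
  proof
    show "\<forall>i. coeff [:- (x * x), 0, 1:] i \<in> \<int>"
      using assms by (auto simp: coeff_pCons split: nat.splits)
  qed (auto simp: algebra_simps)
  show "x \<in> \<rat>"
    using Rats_of_rat[of x, where 'a = rat] by simp
qed

lemma rat_bounded_denominator_Ints:
  fixes x :: rat and N :: int
  assumes N: "N > 0" and bound: "\<And>k. of_int N * x ^ k \<in> \<int>"
  shows "x \<in> \<int>"
proof -
  obtain u v where uv: "x = of_int u / of_int v" "v > 0" "Rings.coprime u v"
    using quotient_of_div[of x] quotient_of_denom_pos[of x] quotient_of_coprime[of x]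
    by (metis surj_pair)
  \<comment> \<open>The denominator satisfies \<open>v ^ k \<le> N\<close> for every exponent; this
    one suffices because 2 to the power \<open>N\<close> exceeds \<open>N\<close>.\<close>
  define k where "k = nat N"
  obtain m where "of_int N * x ^ k = of_int m" using bound[of k] by (auto elim: Ints_cases)
  then have "of_int (N * u ^ k) = (of_int (m * v ^ k) :: rat)"
    using uv by (simp add: field_simps)
  then have "N * u ^ k = m * v ^ k" by (simp only: of_int_eq_iff)
  then have "v ^ k dvd N * u ^ k" by simp
  moreover have "Rings.coprime (v ^ k) (u ^ k)" using uv(3) by (simp add: coprime_commute)
  ultimately have "v ^ k dvd N" using coprime_dvd_mult_left_iff by blast
  then have "v ^ k \<le> N" using N by (simp add: zdvd_imp_le)
  have "v = 1"
  proof (rule ccontr)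
    assume "v \<noteq> 1"
    then have "2 ^ k \<le> v ^ k" using uv(2) by (intro power_mono) auto
    moreover have "int k < 2 ^ k" using of_nat_less_two_power[of k, where 'a = int] .
    ultimately show False using \<open>v ^ k \<le> N\<close> N by (simp add: k_def)
  qed
  then show ?thesis using uv by simp
qed

lemma int_subgroup_multiples:
  fixes M :: "int set"
  assumes 0: "0 \<in> M" and diff: "\<And>x y. x \<in> M \<Longrightarrow> y \<in> M \<Longrightarrow> x - y \<in> M"
  obtains c where "c \<ge> 0" "\<And>x. x \<in> M \<longleftrightarrow> c dvd x"
proof -
  have uminus: "- x \<in> M" if "x \<in> M" for x using diff[OF 0 that] by simp
  have add: "x + y \<in> M" if "x \<in> M" "y \<in> M" for x y using diff[OF that(1) uminus[OF that(2)]] by simp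
  have mult: "k * x \<in> M" if "x \<in> M" for k x
  proof (induction k rule: int_induct[where k = 0])
    case base show ?case using 0 by simp
  next
    case (step1 i) show ?case using add[OF step1(2) that] by (simp add: algebra_simps)
  next
    case (step2 i) show ?case using diff[OF step2(2) that] by (simp add: algebra_simps)
  qed
  show thesis
  proof (cases "M = {0}")
    case True
    then show thesis using that[of 0] by auto
  next
    case False
    then obtain x where "x \<in> M" "x \<noteq> 0" using 0 by blast
    then have "\<bar>x\<bar> \<in> M" using uminus[of x] by (cases "x \<ge> 0") auto
    then have ex: "\<exists>n. n > 0 \<and> int n \<in> M"
      using \<open>x \<noteq> 0\<close> by (intro exI[of _ "nat \<bar>x\<bar>"]) auto
    define c where "c = (LEAST n. n > 0 \<and> int n \<in> M)"
    have c: "c > 0" "int c \<in> M" using LeastI_ex[OF ex] by (auto simp: c_def)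
    have least: "n \<ge> c" if "n > 0" "int n \<in> M" for n
      unfolding c_def by (rule Least_le) (use that in auto)
    have "int c dvd y" if "y \<in> M" for y
    proof (rule ccontr)
      assume "\<not> int c dvd y"
      then have pos: "y mod int c > 0" using c(1)
        by (metis dvd_eq_mod_eq_0 of_nat_0_less_iff order_le_less pos_mod_sign)
      have "y mod int c = y - (y div int c) * int c" by (simp add: minus_div_mult_eq_mod)
      then have "y mod int c \<in> M" using diff[OF that mult[OF c(2)]] by simp
      then have "nat (y mod int c) \<ge> c" using pos by (intro least) auto
      moreover have "y mod int c < int c" using c(1) by simp
      ultimately show False using pos by linarith
    qed
    moreover have "y \<in> M" if "int c dvd y" for y
      using that mult[OF c(2)] by (auto elim!: dvdE simp: mult.commute)
    ultimately show thesis using that[of "int c"] by auto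
  qed
qed

locale quadratic_sqrt =
  fixes K :: "'a::field_char_0 set" and \<delta> :: 'a and d :: int
  assumes K_eq: "K = {of_rat p + of_rat q * \<delta> | p q. True}"
    and indep: "\<And>p q. of_rat p + of_rat q * \<delta> = 0 \<Longrightarrow> p = 0 \<and> q = 0"
    and square: "\<delta> * \<delta> = of_int d"

text \<open>A basis element with nonzero coefficient in the expression of 1 is exchanged for 1. The
  other one, \<open>\<theta>\<close>, is then a root of a monic rational quadratic, whose square is
  completed.\<close>

lemma quadratic_field_sqrt:
  fixes K :: "'a::field_char_0 set"
  assumes "quadratic_field K"
  obtains \<delta> d where "quadratic_sqrt K \<delta> d"
proof -
  obtain b1 b2 where K: "K = {of_rat p * b1 + of_rat q * b2 | p q. True}"
    and ind: "\<And>p q. of_rat p * b1 + of_rat q * b2 = 0 \<Longrightarrow> p = 0 \<and> q = 0"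
    and field: "subfield K (ring_of UNIV)"
    using assms unfolding quadratic_field_def rat_basis_def by blast
  interpret subfield K "ring_of (UNIV :: 'a set)" by (rule field)
  have K1: "1 \<in> K" using one_closed by simp
  have Km: "x * y \<in> K" if "x \<in> K" "y \<in> K" for x y using m_closed[OF that] by simp
  have "\<exists>\<theta>. K = {of_rat p + of_rat q * \<theta> | p q. True} \<and> (\<forall>p q. of_rat p + of_rat q * \<theta> = 0 \<longrightarrow> p = 0 \<and> q = 0)"
  proof -
    have *: "K = {of_rat p + of_rat q * b | p q. True} \<and> (\<forall>p q. of_rat p + of_rat q * b = 0 \<longrightarrow> p = 0 \<and> q = 0)"
      if K: "K = {of_rat p * b' + of_rat q * b | p q. True}"
        and ind: "\<And>p q. of_rat p * b' + of_rat q * b = 0 \<Longrightarrow> p = 0 \<and> q = 0"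
        and one: "1 = of_rat r * b' + of_rat s * b" and r: "r \<noteq> 0" for b' b :: 'a and r s
    proof -
      have b': "b' = of_rat (1 / r) + of_rat (- s / r) * b"
        using one r by (simp add: of_rat_divide of_rat_minus field_simps)
      have fwd: "of_rat p * b' + of_rat q * b = of_rat (p / r) + of_rat (q - p * s / r) * b" for p q
        unfolding b' by (simp add: of_rat_divide of_rat_minus of_rat_mult of_rat_diff field_simps)
      have bwd: "of_rat p + of_rat q * b = of_rat (p * r) * b' + of_rat (q + p * s) * b" for p q
        using r by (subst fwd) (simp add: field_simps)
      have "p = 0 \<and> q = 0" if "of_rat p + of_rat q * b = 0" for p q
        using ind[of "p * r" "q + p * s"] that r unfolding bwd by auto
      moreover have "K = {of_rat p + of_rat q * b | p q. True}"
        unfolding K using fwd bwd by blast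
      ultimately show ?thesis by blast
    qed
    obtain r s where one: "1 = of_rat r * b1 + of_rat s * b2" using K1 K by blast
    show ?thesis
    proof (cases "r = 0")
      case False
      then show ?thesis using *[OF K ind one] by blast
    next
      case True
      then have "s \<noteq> 0" using one by auto
      moreover have "K = {of_rat p * b2 + of_rat q * b1 | p q. True}"
        unfolding K by (subst add.commute) blast
      moreover have "\<And>p q. of_rat p * b2 + of_rat q * b1 = 0 \<Longrightarrow> p = 0 \<and> q = 0"
        using ind by (metis add.commute)
      moreover have "1 = of_rat s * b2 + of_rat r * b1" using one by (simp add: add.commute)
      ultimately show ?thesis using *[of b2 b1 s r] by blast
    qed
  qed
  then obtain \<theta> where \<theta>: "K = {of_rat p + of_rat q * \<theta> | p q. True}"
    "\<And>p q. of_rat p + of_rat q * \<theta> = 0 \<Longrightarrow> p = 0 \<and> q = 0" by blast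
  have "\<theta> \<in> K" unfolding \<theta>(1) by (intro CollectI exI[of _ 0] exI[of _ 1]) simp
  then obtain t s where ts: "\<theta> * \<theta> = of_rat t + of_rat s * \<theta>" using Km \<theta>(1) by blast
  \<comment> \<open>The discriminant of X^2 - s X - t, so that 2 \<theta> - s is a square root of
    it. The factor \<open>n\<close> in \<open>\<delta>\<close> clears the denominator: the square of
    \<open>\<delta>\<close> is n^2 e = n m.\<close>
  define e where "e = 4 * t + s * s"
  obtain m n where mn: "e = of_int m / of_int n" "n > 0"
    using quotient_of_div[of e] quotient_of_denom_pos[of e] by (metis surj_pair)
  define \<delta> where "\<delta> = of_int n * (2 * \<theta> - of_rat s)"
  have \<delta>: "\<delta> = of_rat (- of_int n * s) + of_rat (2 * of_int n) * \<theta>"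
    by (simp add: \<delta>_def of_rat_mult of_rat_minus algebra_simps)
  have "\<delta> * \<delta> = of_int (n * n) * (4 * (\<theta> * \<theta>) - 4 * of_rat s * \<theta> + of_rat s * of_rat s)"
    by (simp add: \<delta>_def algebra_simps)
  also have "\<dots> = of_int (n * n) * of_rat e"
    unfolding ts e_def by (simp add: of_rat_add of_rat_mult algebra_simps)
  also have "\<dots> = of_int (n * m)" using mn by (simp add: of_rat_divide)
  finally have sq: "\<delta> * \<delta> = of_int (n * m)" .
  have comb: "of_rat p + of_rat q * \<delta> = of_rat (p - q * of_int n * s) + of_rat (2 * q * of_int n) * \<theta>" for p q
    unfolding \<delta> by (simp add: of_rat_mult of_rat_minus of_rat_diff algebra_simps)
  have comb': "of_rat p + of_rat q * \<theta> = of_rat (p + q * s / 2) + of_rat (q / (2 * of_int n)) * \<delta>" for p q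
    unfolding comb using mn(2) by (simp add: field_simps)
  have "quadratic_sqrt K \<delta> (n * m)"
  proof
    show "K = {of_rat p + of_rat q * \<delta> | p q. True}"
      unfolding \<theta>(1) using comb comb' by blast
    show "p = 0 \<and> q = 0" if "of_rat p + of_rat q * \<delta> = 0" for p q
      using \<theta>(2)[of "p - q * of_int n * s" "2 * q * of_int n"] that mn(2) unfolding comb by auto
  qed (rule sq)
  then show thesis using that by blast
qed

context quadratic_sqrt
begin

section \<open>The ring of integers through trace and norm\<close>

lemma K_unique:
  assumes "of_rat p + of_rat q * \<delta> = of_rat p' + of_rat q' * \<delta>"
  shows "p = p' \<and> q = q'"
proof -
  have "of_rat (p - p') + of_rat (q - q') * \<delta> = 0" using assms by (simp add: of_rat_diff algebra_simps)
  from indep[OF this] show ?thesis by simp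
qed

lemma K_mult: "(of_rat p + of_rat q * \<delta>) * (of_rat p' + of_rat q' * \<delta>)
    = of_rat (p * p' + q * q' * of_int d) + of_rat (p * q' + q * p') * \<delta>"
proof -
  have "(of_rat p + of_rat q * \<delta>) * (of_rat p' + of_rat q' * \<delta>)
      = of_rat (p * p') + of_rat (q * q') * (\<delta> * \<delta>) + of_rat (p * q' + q * p') * \<delta>"
    by (simp add: of_rat_add of_rat_mult algebra_simps)
  then show ?thesis unfolding square by (simp add: of_rat_add of_rat_mult)
qed

lemma d_nonzero: "d \<noteq> 0"
proof
  assume "d = 0"
  then have "\<delta> = 0" using square by simp
  then show False using indep[of 0 1] by simp
qed

text \<open>For \<open>x\<close> in \<open>K\<close>, the existence of such an \<open>N > 0\<close> is equivalent to integrality of \<open>x\<close>; it forces the norm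
  of \<open>x\<close> to be an integer, and it passes from \<open>x\<close> to \<open>x + 1\<close>, which gives the integrality of the trace.\<close>

definition denominator_bound :: "int \<Rightarrow> 'a \<Rightarrow> bool" where
  "denominator_bound N x \<longleftrightarrow> (\<forall>k. \<exists>i j :: int. of_int N * x ^ k = of_int i + of_int j * \<delta>)"

definition Z\<delta> :: "'a set" where "Z\<delta> = {of_int i + of_int j * \<delta> | i j. True}"

lemma Z\<delta>_ring: "subset_ring Z\<delta>"
proof
  show "1 \<in> Z\<delta>" unfolding Z\<delta>_def by (intro CollectI exI[of _ 1] exI[of _ 0]) simp
  fix x y assume "x \<in> Z\<delta>" "y \<in> Z\<delta>"
  then obtain i j k l where xy: "x = of_int i + of_int j * \<delta>" "y = of_int k + of_int l * \<delta>"
    unfolding Z\<delta>_def by blast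
  have "x - y = of_int (i - k) + of_int (j - l) * \<delta>" by (simp add: xy algebra_simps)
  then show "x - y \<in> Z\<delta>" unfolding Z\<delta>_def by blast
  have "x * y = of_int (i * k) + of_int (j * l) * (\<delta> * \<delta>) + of_int (i * l + j * k) * \<delta>"
    by (simp add: xy algebra_simps)
  also have "\<dots> = of_int (i * k + j * l * d) + of_int (i * l + j * k) * \<delta>" unfolding square by simp
  finally show "x * y \<in> Z\<delta>" unfolding Z\<delta>_def by blast
qed

lemma denominator_bound_iff: "denominator_bound N x \<longleftrightarrow> (\<forall>k. of_int N * x ^ k \<in> Z\<delta>)"
  unfolding denominator_bound_def Z\<delta>_def by blast

lemma denominator_bound_add_one:
  assumes "denominator_bound N x"
  shows "denominator_bound N (x + 1)"
  unfolding denominator_bound_iff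
proof
  interpret Z: subset_ring Z\<delta> by (rule Z\<delta>_ring)
  fix k
  have "of_int N * (x + 1) ^ k = (\<Sum>i\<le>k. of_nat (k choose i) * (of_int N * x ^ i))"
    by (simp add: binomial_ring sum_distrib_left mult_ac)
  also have "\<dots> \<in> Z\<delta>"
    by (rule Z.sum_mem, rule Z.mult_mem[OF Z.of_nat_mem])
      (use assms in \<open>simp add: denominator_bound_iff\<close>)
  finally show "of_int N * (x + 1) ^ k \<in> Z\<delta>" .
qed

lemma K_common_denominator:
  assumes "x \<in> K"
  obtains N where "N > 0" "of_int N * x \<in> Z\<delta>"
proof -
  obtain p q where x: "x = of_rat p + of_rat q * \<delta>" using assms K_eq by blast
  obtain i m where p: "p = of_int i / of_int m" "m > 0"
    using quotient_of_div[of p] quotient_of_denom_pos[of p] by (metis surj_pair)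
  obtain j n where q: "q = of_int j / of_int n" "n > 0"
    using quotient_of_div[of q] quotient_of_denom_pos[of q] by (metis surj_pair)
  have "of_int (m * n) * x = of_int (i * n) + of_int (j * m) * \<delta>"
    unfolding x p(1) q(1) using p(2) q(2) by (simp add: of_rat_divide field_simps)
  moreover have "m * n > 0" using p q by simp
  ultimately show thesis using that unfolding Z\<delta>_def by blast
qed

lemma K_power: "x \<in> K \<Longrightarrow> x ^ k \<in> K"
proof (induction k)
  case 0
  show ?case unfolding K_eq by (intro CollectI exI[of _ 1] exI[of _ 0]) simp
next
  case (Suc k)
  then obtain p q p' q' where "x = of_rat p + of_rat q * \<delta>" "x ^ k = of_rat p' + of_rat q' * \<delta>"
    using K_eq by blast
  then have "x ^ Suc k = of_rat (p * p' + q * q' * of_int d) + of_rat (p * q' + q * p') * \<delta>"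
    using K_mult by simp
  then show ?case unfolding K_eq by blast
qed

text \<open>A common denominator of the powers below the degree serves for all powers, as the monic
  equation expresses each higher power by lower ones with integer coefficients.\<close>

lemma algebraic_int_denominator_bound:
  assumes x: "x \<in> K" "algebraic_int x"
  obtains N where "N > 0" "denominator_bound N x"
proof -
  interpret Z: subset_ring Z\<delta> by (rule Z\<delta>_ring)
  obtain P where P: "lead_coeff P = 1" "\<forall>i. coeff P i \<in> \<int>" "poly P x = 0"
    using x(2) by (auto elim: algebraic_int.cases)
  define n where "n = degree P"
  have "\<exists>N>0. \<forall>i<m. of_int N * x ^ i \<in> Z\<delta>" for m
  proof (induction m)
    case 0
    show ?case by (intro exI[of _ 1]) simp
  next
    case (Suc m)
    then obtain N where N: "N > 0" "\<forall>i<m. of_int N * x ^ i \<in> Z\<delta>" by blast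
    obtain M where M: "M > 0" "of_int M * x ^ m \<in> Z\<delta>"
      using K_common_denominator[OF K_power[OF x(1)]] by blast
    have "of_int (N * M) * x ^ i \<in> Z\<delta>" if "i < Suc m" for i
    proof (cases "i = m")
      case True
      then show ?thesis using Z.mult_mem[OF Z.of_int_mem[of N] M(2)] by (simp add: mult.assoc)
    next
      case False
      then have "of_int M * (of_int N * x ^ i) \<in> Z\<delta>"
        using N(2) that Z.mult_mem[OF Z.of_int_mem[of M], of "of_int N * x ^ i"] by simp
      then show ?thesis by (simp add: mult_ac)
    qed
    then show ?case using N M by (intro exI[of _ "N * M"]) simp
  qed
  then obtain N where N: "N > 0" "\<And>i. i < n \<Longrightarrow> of_int N * x ^ i \<in> Z\<delta>" by blast
  have "of_int N * x ^ k \<in> Z\<delta>" for k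
  proof (induction k rule: less_induct)
    case (less k)
    show ?case
    proof (cases "k < n")
      case True
      then show ?thesis using N by blast
    next
      case False
      have "0 = (\<Sum>i\<le>n. coeff P i * x ^ i)" using P(3) by (simp add: poly_altdef n_def)
      also have "\<dots> = (\<Sum>i<n. coeff P i * x ^ i) + x ^ n"
        using P(1) by (simp add: n_def lessThan_Suc_atMost[symmetric])
      finally have "x ^ n = - (\<Sum>i<n. coeff P i * x ^ i)" by (simp add: eq_neg_iff_add_eq_0 add.commute)
      then have "x ^ (k - n) * x ^ n = - (\<Sum>i<n. coeff P i * x ^ (k - n + i))"
        by (simp add: sum_distrib_left power_add mult_ac)
      moreover have "x ^ (k - n) * x ^ n = x ^ k" using False by (simp flip: power_add)
      ultimately have xk: "x ^ k = - (\<Sum>i<n. coeff P i * x ^ (k - n + i))" by (simp only:)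
      have "of_int N * x ^ k = - (\<Sum>i<n. coeff P i * (of_int N * x ^ (k - n + i)))"
        unfolding xk by (simp add: sum_distrib_left mult_ac)
      also have "\<dots> \<in> Z\<delta>"
      proof (rule Z.uminus_mem, rule Z.sum_mem, rule Z.mult_mem)
        fix i assume "i \<in> {..<n}"
        then show "of_int N * x ^ (k - n + i) \<in> Z\<delta>" using False by (intro less) auto
        show "coeff P i \<in> Z\<delta>" using P(2) Z.of_int_mem by (metis Ints_cases)
      qed
      finally show ?thesis .
    qed
  qed
  then show thesis using that N(1) by (simp add: denominator_bound_iff)
qed

text \<open>For x = p + q \<delta>, the norm of N x^k is an integer and equals N^2 times the k-th
  power of the norm of x. So the powers of this norm have bounded denominators.\<close>

lemma denominator_bound_norm:
  assumes N: "N > 0" and x: "denominator_bound N (of_rat p + of_rat q * \<delta>)"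
  shows "p * p - q * q * of_int d \<in> \<int>"
proof (rule rat_bounded_denominator_Ints)
  show "N * N > 0" using N by simp
  fix k
  have "\<exists>r s. (of_rat p + of_rat q * \<delta>) ^ k = of_rat r + of_rat s * \<delta> \<and>
      r * r - s * s * of_int d = (p * p - q * q * of_int d) ^ k"
  proof (induction k)
    case 0
    show ?case by (intro exI[of _ 1] exI[of _ 0]) simp
  next
    case (Suc k)
    then obtain r s where rs: "(of_rat p + of_rat q * \<delta>) ^ k = of_rat r + of_rat s * \<delta>"
      "r * r - s * s * of_int d = (p * p - q * q * of_int d) ^ k" by blast
    show ?case
    proof (intro exI conjI)
      show "(of_rat p + of_rat q * \<delta>) ^ Suc k
          = of_rat (p * r + q * s * of_int d) + of_rat (p * s + q * r) * \<delta>"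
        by (simp add: rs K_mult)
      show "(p * r + q * s * of_int d) * (p * r + q * s * of_int d)
          - (p * s + q * r) * (p * s + q * r) * of_int d = (p * p - q * q * of_int d) ^ Suc k"
        unfolding power_Suc rs(2)[symmetric] by (simp add: algebra_simps)
    qed
  qed
  then obtain r s where rs: "(of_rat p + of_rat q * \<delta>) ^ k = of_rat r + of_rat s * \<delta>"
    "r * r - s * s * of_int d = (p * p - q * q * of_int d) ^ k" by blast
  obtain i j where "of_int N * (of_rat p + of_rat q * \<delta>) ^ k = of_int i + of_int j * \<delta>"
    using x unfolding denominator_bound_def by blast
  then have "of_rat (of_int N * r) + of_rat (of_int N * s) * \<delta> = of_rat (of_int i) + of_rat (of_int j) * \<delta>"
    unfolding rs(1) by (simp add: of_rat_mult algebra_simps)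
  then have ij: "of_int N * r = of_int i" "of_int N * s = of_int j" using K_unique by blast+
  have "of_int (N * N) * (p * p - q * q * of_int d) ^ k
      = (of_int N * r) * (of_int N * r) - (of_int N * s) * (of_int N * s) * of_int d"
    unfolding rs(2)[symmetric] by (simp add: algebra_simps)
  also have "\<dots> = of_int (i * i - j * j * d)" unfolding ij by simp
  finally show "of_int (N * N) * (p * p - q * q * of_int d) ^ k \<in> \<int>" by simp
qed

lemma ring_of_integers_iff:
  "of_rat p + of_rat q * \<delta> \<in> ring_of_integers K \<longleftrightarrow> 2 * p \<in> \<int> \<and> p * p - q * q * of_int d \<in> \<int>"
proof
  assume "of_rat p + of_rat q * \<delta> \<in> ring_of_integers K"
  then obtain N where N: "N > 0" "denominator_bound N (of_rat p + of_rat q * \<delta>)"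
    using algebraic_int_denominator_bound unfolding ring_of_integers_def by blast
  have n: "p * p - q * q * of_int d \<in> \<int>" using denominator_bound_norm[OF N] .
  have eq: "of_rat (p + 1) + of_rat q * \<delta> = of_rat p + of_rat q * \<delta> + 1" by (simp add: of_rat_add)
  have "denominator_bound N (of_rat (p + 1) + of_rat q * \<delta>)"
    unfolding eq by (rule denominator_bound_add_one[OF N(2)])
  from denominator_bound_norm[OF N(1) this] have "(p + 1) * (p + 1) - q * q * of_int d \<in> \<int>" .
  from Ints_diff[OF this n] have "2 * p + 1 \<in> \<int>" by (simp add: algebra_simps)
  from Ints_diff[OF this Ints_1] have "2 * p \<in> \<int>" by simp
  with n show "2 * p \<in> \<int> \<and> p * p - q * q * of_int d \<in> \<int>" by blast
next
  assume "2 * p \<in> \<int> \<and> p * p - q * q * of_int d \<in> \<int>"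
  then obtain T n where T: "2 * p = of_int T" and n: "p * p - q * q * of_int d = of_int n"
    by (auto elim!: Ints_cases)
  define x where "x = of_rat p + of_rat q * \<delta>"
  have xx: "x * x = of_rat (p * p + q * q * of_int d) + of_rat (2 * p * q) * \<delta>"
    unfolding x_def K_mult by (simp add: algebra_simps)
  have "of_int n - of_int T * x + x * x
      = of_rat (of_int n) - of_rat (of_int T) * x + x * x" by simp
  also have "\<dots> = 0"
    unfolding xx T[symmetric] n[symmetric] by (simp add: x_def of_rat_mult of_rat_add of_rat_diff algebra_simps)
  finally have root: "of_int n - of_int T * x + x * x = 0" .
  have "algebraic_int x"
  proof
    show "\<forall>i. coeff [:of_int n, - of_int T, 1:] i \<in> (\<int> :: 'a set)"
      by (auto simp: coeff_pCons split: nat.splits)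
    show "poly [:of_int n, - of_int T, 1:] x = 0" using root by (simp add: algebra_simps)
  qed simp
  then show "of_rat p + of_rat q * \<delta> \<in> ring_of_integers K"
    unfolding ring_of_integers_def x_def K_eq by blast
qed

lemma ring_of_integers_E:
  assumes "x \<in> ring_of_integers K"
  obtains p q where "x = of_rat p + of_rat q * \<delta>" "2 * p \<in> \<int>" "p * p - q * q * of_int d \<in> \<int>"
  using assms K_eq ring_of_integers_iff unfolding ring_of_integers_def by blast

text \<open>If \<open>T = 2 p\<close> and \<open>n = p\<^sup>2 - d q\<^sup>2\<close> denote trace and norm, \<open>4 q q' d\<close> is an integer, as its square
  is \<open>(T\<^sup>2 - 4 n) (T'\<^sup>2 - 4 n')\<close>, and it has the parity of \<open>T T'\<close>.\<close>

lemma trace_conj_mult: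
  assumes "2 * p \<in> \<int>" "p * p - q * q * of_int d \<in> \<int>" "2 * p' \<in> \<int>" "p' * p' - q' * q' * of_int d \<in> \<int>"
  shows "2 * (p * p' + q * q' * of_int d) \<in> (\<int> :: rat set)" "2 * (p * p' - q * q' * of_int d) \<in> (\<int> :: rat set)"
proof -
  obtain T n T' n' where T: "2 * p = of_int T" "2 * p' = of_int T'"
    and n: "p * p - q * q * of_int d = of_int n" "p' * p' - q' * q' * of_int d = of_int n'"
    using assms by (auto elim!: Ints_cases)
  define A where "A = 4 * q * q' * of_int d"
  have "A * A = ((2 * p) * (2 * p) - 4 * (p * p - q * q * of_int d)) * ((2 * p') * (2 * p') - 4 * (p' * p' - q' * q' * of_int d))"
    by (simp add: A_def algebra_simps)
  also have "\<dots> = of_int ((T * T - 4 * n) * (T' * T' - 4 * n'))" unfolding T n by simp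
  finally have AA: "A * A = of_int ((T * T - 4 * n) * (T' * T' - 4 * n'))" .
  have "A \<in> \<int>" by (rule rat_square_Ints) (simp only: AA Ints_of_int)
  then obtain m where m: "A = of_int m" by (elim Ints_cases)
  have "of_int (m * m) = (of_int ((T * T - 4 * n) * (T' * T' - 4 * n')) :: rat)" using AA m by simp
  then have mm: "m * m = (T * T - 4 * n) * (T' * T' - 4 * n')" by (simp only: of_int_eq_iff)
  have "even (m * m) \<longleftrightarrow> even (T * T')" unfolding mm by simp
  then have "even m \<longleftrightarrow> even (T * T')" by simp
  then obtain k l where k: "T * T' + m = 2 * k" and l: "T * T' - m = 2 * l"
    by (metis even_add even_diff evenE)
  have "2 * (2 * (p * p' + q * q' * of_int d)) = (2 * p) * (2 * p') + A" by (simp add: A_def algebra_simps)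
  also have "\<dots> = of_int (T * T' + m)" unfolding T m by simp
  also have "\<dots> = 2 * of_int k" unfolding k by simp
  finally have "2 * (p * p' + q * q' * of_int d) = of_int k" by linarith
  then show "2 * (p * p' + q * q' * of_int d) \<in> \<int>" by (simp only: Ints_of_int)
  have "2 * (2 * (p * p' - q * q' * of_int d)) = (2 * p) * (2 * p') - A" by (simp add: A_def algebra_simps)
  also have "\<dots> = of_int (T * T' - m)" unfolding T m by simp
  also have "\<dots> = 2 * of_int l" unfolding l by simp
  finally have "2 * (p * p' - q * q' * of_int d) = of_int l" by linarith
  then show "2 * (p * p' - q * q' * of_int d) \<in> \<int>" by (simp only: Ints_of_int)
qed

text \<open>The norm of x - y is the sum of the norms minus the trace of x times the conjugate of y.
  For x y, the norm is multiplicative and \<open>trace_conj_mult\<close> bounds the trace.\<close>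

lemma ring_of_integers_ring: "subset_ring (ring_of_integers K)"
proof
  show "1 \<in> ring_of_integers K" using ring_of_integers_iff[of 1 0] by simp
  fix x y assume "x \<in> ring_of_integers K" "y \<in> ring_of_integers K"
  then obtain p q p' q' where x: "x = of_rat p + of_rat q * \<delta>" "2 * p \<in> \<int>" "p * p - q * q * of_int d \<in> \<int>"
    and y: "y = of_rat p' + of_rat q' * \<delta>" "2 * p' \<in> \<int>" "p' * p' - q' * q' * of_int d \<in> \<int>"
    by (metis ring_of_integers_E)
  note tr = trace_conj_mult[OF x(2,3) y(2,3)]
  have "(p - p') * (p - p') - (q - q') * (q - q') * of_int d
      = (p * p - q * q * of_int d) + (p' * p' - q' * q' * of_int d) - 2 * (p * p' - q * q' * of_int d)"
    by (simp add: algebra_simps)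
  also have "\<dots> \<in> \<int>" by (rule Ints_diff[OF Ints_add[OF x(3) y(3)] tr(2)])
  finally have "of_rat (p - p') + of_rat (q - q') * \<delta> \<in> ring_of_integers K"
    unfolding ring_of_integers_iff using Ints_diff[OF x(2) y(2)] by (simp add: algebra_simps)
  then show "x - y \<in> ring_of_integers K" by (simp add: x y of_rat_diff algebra_simps)
  have "(p * p' + q * q' * of_int d) * (p * p' + q * q' * of_int d)
      - (p * q' + q * p') * (p * q' + q * p') * of_int d
      = (p * p - q * q * of_int d) * (p' * p' - q' * q' * of_int d)"
    by (simp add: algebra_simps)
  also have "\<dots> \<in> \<int>" by (rule Ints_mult[OF x(3) y(3)])
  finally show "x * y \<in> ring_of_integers K"
    unfolding x y K_mult ring_of_integers_iff using tr by blast
qed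

text \<open>The \<open>\<delta>\<close>-coordinates of integers form a cyclic group, and
  \<open>\<omega>\<close> is an integer whose coordinate generates it. Subtracting a suitable
  multiple of \<open>\<omega>\<close> from an integer leaves a rational number that is
  integral.\<close>

lemma integral_basis:
  obtains \<omega> u v where "ring_of_integers K = {of_int x + of_int y * \<omega> | x y. True}"
    "K = {of_rat p + of_rat q * \<omega> | p q. True}"
    "\<And>p q. of_rat p + of_rat q * \<omega> = 0 \<Longrightarrow> p = 0 \<and> q = 0"
    "\<omega> * \<omega> = of_int u + of_int v * \<omega>"
proof -
  interpret O: subset_ring "ring_of_integers K" by (rule ring_of_integers_ring)
  \<comment> \<open>The denominator \<open>2 d\<close> is enough: for integral p + q \<delta> with
    trace T and norm n, the square of 2 q d is (T^2 - 4 n) d.\<close>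
  define M where "M = {m :: int. \<exists>p. of_rat p + of_rat (of_int m / (2 * of_int d)) * \<delta> \<in> ring_of_integers K}"
  have M0: "0 \<in> M" unfolding M_def using O.zero_mem by (intro CollectI exI[of _ 0]) simp
  have Mdiff: "m - n \<in> M" if "m \<in> M" "n \<in> M" for m n
  proof -
    obtain p where p: "of_rat p + of_rat (of_int m / (2 * of_int d)) * \<delta> \<in> ring_of_integers K"
      using \<open>m \<in> M\<close> unfolding M_def by blast
    obtain p' where p': "of_rat p' + of_rat (of_int n / (2 * of_int d)) * \<delta> \<in> ring_of_integers K"
      using \<open>n \<in> M\<close> unfolding M_def by blast
    from O.diff_mem[OF p p']
    have "of_rat (p - p') + of_rat (of_int (m - n) / (2 * of_int d)) * \<delta> \<in> ring_of_integers K"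
      by (simp add: of_rat_diff diff_divide_distrib algebra_simps)
    then show ?thesis unfolding M_def by blast
  qed
  obtain c where c: "c \<ge> 0" "\<And>m. m \<in> M \<longleftrightarrow> c dvd m" using int_subgroup_multiples[OF M0 Mdiff] by blast
  have "2 * d \<in> M"
    unfolding M_def using d_nonzero ring_of_integers_iff[of 0 1] by (intro CollectI exI[of _ 0]) simp
  then have "c \<noteq> 0" using c(2)[of "2 * d"] d_nonzero by auto
  obtain p0 where p0: "of_rat p0 + of_rat (of_int c / (2 * of_int d)) * \<delta> \<in> ring_of_integers K"
    using c(2)[of c] by (auto simp: M_def)
  define q0 where "q0 = of_int c / (2 * of_int d :: rat)"
  have q0: "q0 \<noteq> 0" using \<open>c \<noteq> 0\<close> d_nonzero by (simp add: q0_def)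
  define \<omega> where "\<omega> = of_rat p0 + of_rat q0 * \<delta>"
  have \<omega>: "\<omega> \<in> ring_of_integers K" using p0 by (simp add: \<omega>_def q0_def)
  have O: "ring_of_integers K = {of_int x + of_int y * \<omega> | x y. True}"
  proof (intro subset_antisym subsetI)
    fix x assume x: "x \<in> ring_of_integers K"
    then obtain p q where pq: "x = of_rat p + of_rat q * \<delta>" "2 * p \<in> \<int>" "p * p - q * q * of_int d \<in> \<int>"
      by (rule ring_of_integers_E)
    have "(2 * q * of_int d) * (2 * q * of_int d) = ((2 * p) * (2 * p) - 4 * (p * p - q * q * of_int d)) * of_int d"
      by (simp add: algebra_simps)
    also have "\<dots> \<in> \<int>"
      by (rule Ints_mult[OF Ints_diff[OF Ints_mult[OF pq(2) pq(2)] Ints_mult[OF Ints_numeral pq(3)]] Ints_of_int])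
    finally have "2 * q * of_int d \<in> \<int>" by (rule rat_square_Ints)
    then obtain m where m: "2 * q * of_int d = of_int m" by (elim Ints_cases)
    then have q: "q = of_int m / (2 * of_int d)" using d_nonzero by (simp add: field_simps)
    then have "m \<in> M" using x pq unfolding M_def by blast
    then obtain k where "m = c * k" using c(2) by (auto elim: dvdE)
    then have qk: "q = of_int k * q0" using q by (simp add: q0_def)
    have eq: "x - of_int k * \<omega> = of_rat (p - of_int k * p0) + of_rat 0 * \<delta>"
      unfolding pq(1) qk \<omega>_def by (simp add: of_rat_diff of_rat_mult algebra_simps)
    have "x - of_int k * \<omega> \<in> ring_of_integers K"
      using x \<omega> by (intro O.diff_mem O.mult_mem O.of_int_mem)
    then have "(p - of_int k * p0) * (p - of_int k * p0) \<in> \<int>"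
      unfolding eq ring_of_integers_iff by simp
    then have "p - of_int k * p0 \<in> \<int>" by (rule rat_square_Ints)
    then obtain l where "p - of_int k * p0 = of_int l" by (elim Ints_cases)
    with eq have "x = of_int l + of_int k * \<omega>" by (simp add: algebra_simps)
    then show "x \<in> {of_int x + of_int y * \<omega> | x y. True}" by blast
  next
    fix x assume "x \<in> {of_int x + of_int y * \<omega> | x y. True}"
    then show "x \<in> ring_of_integers K"
      using \<omega> by (auto intro!: O.add_mem O.mult_mem O.of_int_mem)
  qed
  have comb: "of_rat p + of_rat q * \<omega> = of_rat (p + q * p0) + of_rat (q * q0) * \<delta>" for p q
    by (simp add: \<omega>_def of_rat_add of_rat_mult algebra_simps)
  have comb': "of_rat p + of_rat q * \<delta> = of_rat (p - q / q0 * p0) + of_rat (q / q0) * \<omega>" for p q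
    unfolding comb using q0 by simp
  obtain u v where "\<omega> * \<omega> = of_int u + of_int v * \<omega>" using O.mult_mem[OF \<omega> \<omega>] O by blast
  moreover have "p = 0 \<and> q = 0" if "of_rat p + of_rat q * \<omega> = 0" for p q
    using that indep[of "p + q * p0" "q * q0"] q0 unfolding comb by auto
  moreover have "K = {of_rat p + of_rat q * \<omega> | p q. True}"
    unfolding K_eq using comb comb' by blast
  ultimately show thesis using that O by blast
qed

end

section \<open>Orders and ideals of quadratic fields\<close>

locale quadratic_integers =
  fixes K :: "'a::field_char_0 set" and \<omega> :: 'a and u v :: int
  assumes integers: "ring_of_integers K = {of_int x + of_int y * \<omega> | x y. True}"
    and K_eq: "K = {of_rat p + of_rat q * \<omega> | p q. True}"
    and indep: "\<And>p q. of_rat p + of_rat q * \<omega> = 0 \<Longrightarrow> p = 0 \<and> q = 0"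
    and square: "\<omega> * \<omega> = of_int u + of_int v * \<omega>"
begin

definition ord :: "int \<Rightarrow> 'a set" where "ord c = {of_int x + of_int y * (of_int c * \<omega>) | x y. True}"

section \<open>The orders Z + Z c \<omega>, their indices, and bases of their ideals\<close>

lemma rat_unique:
  assumes "of_rat p + of_rat q * \<omega> = of_rat p' + of_rat q' * \<omega>"
  shows "p = p' \<and> q = q'"
proof -
  have "of_rat (p - p') + of_rat (q - q') * \<omega> = 0" using assms by (simp add: of_rat_diff algebra_simps)
  from indep[OF this] show ?thesis by simp
qed

lemma int_unique:
  assumes "of_int x + of_int y * \<omega> = of_int x' + of_int y' * \<omega>"
  shows "x = x' \<and> y = y'"
  using rat_unique[of "of_int x" "of_int y" "of_int x'" "of_int y'"] assms by simp

lemma integersE: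
  assumes "r \<in> ring_of_integers K"
  obtains x y where "r = of_int x + of_int y * \<omega>"
  using assms integers by blast

lemma ord_iff: "of_int x + of_int y * \<omega> \<in> ord c \<longleftrightarrow> c dvd y"
proof
  assume "of_int x + of_int y * \<omega> \<in> ord c"
  then obtain x' y' where "of_int x + of_int y * \<omega> = of_int x' + of_int y' * (of_int c * \<omega>)"
    unfolding ord_def by blast
  then have "of_int x + of_int y * \<omega> = of_int x' + of_int (y' * c) * \<omega>" by simp
  from int_unique[OF this] show "c dvd y" by simp
next
  assume "c dvd y"
  then obtain k where "y = c * k" by (rule dvdE)
  then have "of_int x + of_int y * \<omega> = of_int x + of_int k * (of_int c * \<omega>)" by (simp add: mult_ac)
  then show "of_int x + of_int y * \<omega> \<in> ord c" unfolding ord_def by blast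
qed

lemma ord_1: "ord 1 = ring_of_integers K"
  by (simp add: ord_def integers)

lemma ord_ring: "subset_ring (ord c)"
proof
  show "1 \<in> ord c" unfolding ord_def by (intro CollectI exI[of _ 1] exI[of _ 0]) simp
  fix r s assume "r \<in> ord c" "s \<in> ord c"
  then obtain x y x' y' where rs: "r = of_int x + of_int y * (of_int c * \<omega>)" "s = of_int x' + of_int y' * (of_int c * \<omega>)"
    unfolding ord_def by blast
  have "r - s = of_int (x - x') + of_int (y - y') * (of_int c * \<omega>)" by (simp add: rs algebra_simps)
  then show "r - s \<in> ord c" unfolding ord_def by blast
  have "r * s = of_int (x * x') + of_int (x * y' + y * x') * (of_int c * \<omega>) + of_int (y * y' * c * c) * (\<omega> * \<omega>)"
    by (simp add: rs algebra_simps)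
  also have "\<dots> = of_int (x * x' + y * y' * c * c * u) + of_int (x * y' + y * x' + y * y' * c * v) * (of_int c * \<omega>)"
    unfolding square by (simp add: algebra_simps)
  finally show "r * s \<in> ord c" unfolding ord_def by blast
qed

lemma ord_subset: "ord c \<subseteq> ring_of_integers K"
proof
  fix r assume "r \<in> ord c"
  then obtain x y where "r = of_int x + of_int (y * c) * \<omega>" unfolding ord_def by (auto simp: mult.assoc)
  then show "r \<in> ring_of_integers K" unfolding integers by blast
qed

lemma subring_ord: "subring (ord c) (ring_of (ring_of_integers K))"
proof -
  interpret O: subset_ring "ring_of_integers K" using ord_ring[of 1] by (simp only: ord_1)
  interpret S: subset_ring "ord c" by (rule ord_ring)
  interpret ring "ring_of (ring_of_integers K)" using O.cring_ring_of by (rule cring.axioms(1))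
  show ?thesis
  proof (rule subringI)
    fix h assume h: "h \<in> ord c"
    then have "\<ominus>\<^bsub>ring_of (ring_of_integers K)\<^esub> h = - h" using ord_subset by (intro O.a_inv_ring_of) blast
    with S.uminus_mem[OF h] show "\<ominus>\<^bsub>ring_of (ring_of_integers K)\<^esub> h \<in> ord c" by simp
  qed (use ord_subset S.one_mem S.mult_mem S.add_mem in auto)
qed

text \<open>A subring contains the rational integers, hence is determined by the subgroup of those y
  with y \<omega> in it. The case \<open>c = 0\<close> is the ring of rational integers.\<close>

lemma subring_eq_ord:
  assumes "subring T (ring_of (ring_of_integers K))"
  obtains c where "c \<ge> 0" "T = ord c"
proof -
  interpret O: subset_ring "ring_of_integers K" using ord_ring[of 1] by (simp only: ord_1)
  note T = subringE[OF assms, simplified]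
  interpret T: subset_ring T
  proof
    show "1 \<in> T" by (rule T(3))
    fix x y assume xy: "x \<in> T" "y \<in> T"
    show "x * y \<in> T" by (rule T(6)[OF xy])
    have "\<ominus>\<^bsub>ring_of (ring_of_integers K)\<^esub> y = - y" using xy T(1) by (intro O.a_inv_ring_of) blast
    then have "- y \<in> T" using T(5)[OF xy(2)] by simp
    from T(7)[OF xy(1) this] show "x - y \<in> T" by simp
  qed
  define M where "M = {y. of_int y * \<omega> \<in> T}"
  have "0 \<in> M" by (simp add: M_def T.zero_mem)
  moreover have "x - y \<in> M" if "x \<in> M" "y \<in> M" for x y
    using T.diff_mem that by (simp add: M_def left_diff_distrib)
  ultimately obtain c where c: "c \<ge> 0" "\<And>x. x \<in> M \<longleftrightarrow> c dvd x" using int_subgroup_multiples by blast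
  have "r \<in> T \<longleftrightarrow> r \<in> ord c" if r_mem: "r \<in> ring_of_integers K" for r
  proof -
    obtain x y where r: "r = of_int x + of_int y * \<omega>" using integersE[OF r_mem] .
    have "r \<in> T \<longleftrightarrow> of_int y * \<omega> \<in> T"
      using T.add_mem[OF T.of_int_mem[of x], of "of_int y * \<omega>"] T.diff_mem[OF _ T.of_int_mem[of x], of r]
      by (auto simp: r)
    also have "\<dots> \<longleftrightarrow> c dvd y" using c(2) by (simp add: M_def)
    finally show ?thesis unfolding r ord_iff .
  qed
  then have "T = ord c" using T(1) ord_subset by blast
  then show thesis using that c(1) by blast
qed

lemma add_index_ord:
  assumes "c \<ge> 0"
  shows "add_index (ring_of_integers K) (ord c) = nat c"
proof -
  interpret S: subset_ring "ord c" by (rule ord_ring)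
  define cos where "cos y = ord c +>\<^bsub>ring_of (ring_of_integers K)\<^esub> (of_int y * \<omega>)" for y
  have mem: "of_int x + of_int y * \<omega> \<in> cos i \<longleftrightarrow> c dvd y - i" for x y i
  proof -
    have "of_int x + of_int y * \<omega> - of_int i * \<omega> = of_int x + of_int (y - i) * \<omega>"
      by (simp add: algebra_simps)
    then show ?thesis unfolding cos_def in_a_r_coset_ring_of by (simp only: ord_iff)
  qed
  have coset: "ord c +>\<^bsub>ring_of (ring_of_integers K)\<^esub> (of_int x + of_int y * \<omega>) = cos y" for x y
  proof -
    have "z - (of_int x + of_int y * \<omega>) \<in> ord c \<longleftrightarrow> z - of_int y * \<omega> \<in> ord c" for z
      using S.add_mem[OF _ S.of_int_mem[of x], of "z - (of_int x + of_int y * \<omega>)"]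
        S.diff_mem[OF _ S.of_int_mem[of x], of "z - of_int y * \<omega>"] by (auto simp: algebra_simps)
    then show ?thesis by (auto simp: cos_def in_a_r_coset_ring_of)
  qed
  have cos_eq: "cos y = cos y' \<longleftrightarrow> c dvd y - y'" for y y'
  proof
    assume "cos y = cos y'"
    then show "c dvd y - y'" using mem[of 0 y y] mem[of 0 y y'] by simp
  next
    assume d: "c dvd y - y'"
    have "of_int (y - y') * \<omega> \<in> ord c" using ord_iff[of 0 "y - y'" c] d by simp
    then have "z - of_int y * \<omega> \<in> ord c \<longleftrightarrow> z - of_int y' * \<omega> \<in> ord c" for z
      using S.add_mem[of "z - of_int y * \<omega>" "of_int (y - y') * \<omega>"]
        S.diff_mem[of "z - of_int y' * \<omega>" "of_int (y - y') * \<omega>"] by (auto simp: algebra_simps)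
    then show "cos y = cos y'" by (auto simp: cos_def in_a_r_coset_ring_of)
  qed
  have cosets: "a_rcosets\<^bsub>ring_of (ring_of_integers K)\<^esub> (ord c) = range cos"
  proof -
    have "a_rcosets\<^bsub>ring_of (ring_of_integers K)\<^esub> (ord c)
        = (\<lambda>r. ord c +>\<^bsub>ring_of (ring_of_integers K)\<^esub> r) ` ring_of_integers K"
      by (auto simp: A_RCOSETS_def')
    also have "\<dots> = range cos"
    proof (intro subset_antisym subsetI)
      fix Y assume "Y \<in> (\<lambda>r. ord c +>\<^bsub>ring_of (ring_of_integers K)\<^esub> r) ` ring_of_integers K"
      then obtain r where "r \<in> ring_of_integers K" "Y = ord c +>\<^bsub>ring_of (ring_of_integers K)\<^esub> r" by blast
      then show "Y \<in> range cos" using coset by (auto elim!: integersE)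
    next
      fix Y assume "Y \<in> range cos"
      then obtain y where "Y = cos y" by blast
      then have "Y = ord c +>\<^bsub>ring_of (ring_of_integers K)\<^esub> (of_int 0 + of_int y * \<omega>)" using coset by blast
      moreover have "of_int 0 + of_int y * \<omega> \<in> ring_of_integers K" unfolding integers by blast
      ultimately show "Y \<in> (\<lambda>r. ord c +>\<^bsub>ring_of (ring_of_integers K)\<^esub> r) ` ring_of_integers K" by blast
    qed
    finally show ?thesis .
  qed
  show ?thesis
  proof (cases "c = 0")
    \<comment> \<open>There are infinitely many cosets and \<open>card\<close> returns 0, in
      agreement with \<open>nat c\<close>.\<close>
    case True
    then have "inj cos" using cos_eq by (auto simp: inj_on_def)
    then have "infinite (range cos)" using infinite_UNIV_int finite_imageD by blast
    then show ?thesis unfolding add_index_def cosets using True by simp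
  next
    case False
    then have c: "c > 0" using assms by simp
    have "range cos = cos ` {0..<c}"
    proof (intro subset_antisym subsetI)
      fix Y assume "Y \<in> range cos"
      then obtain y where "Y = cos y" by blast
      also have "\<dots> = cos (y mod c)" unfolding cos_eq by (simp add: minus_mod_eq_mult_div)
      finally show "Y \<in> cos ` {0..<c}" using c by simp
    qed auto
    moreover have "inj_on cos {0..<c}"
    proof (rule inj_onI)
      fix x y assume xy: "x \<in> {0..<c}" "y \<in> {0..<c}" "cos x = cos y"
      then have "c dvd x - y" by (simp add: cos_eq)
      with xy have "x - y = 0" using dvd_imp_le_int[of "x - y" c] by force
      then show "x = y" by simp
    qed
    ultimately show ?thesis unfolding add_index_def cosets by (simp add: card_image)
  qed
qed

lemma quad_order_eq:
  assumes "f > 0"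
  shows "quad_order K f = ord (int f)"
  unfolding quad_order_def
proof (rule the_equality)
  show "subring (ord (int f)) (ring_of (ring_of_integers K)) \<and> add_index (ring_of_integers K) (ord (int f)) = f"
    using subring_ord add_index_ord by simp
  fix T assume T: "subring T (ring_of (ring_of_integers K)) \<and> add_index (ring_of_integers K) T = f"
  then obtain c where c: "c \<ge> 0" "T = ord c" using subring_eq_ord by blast
  then have "nat c = f" using T add_index_ord[OF c(1)] by simp
  then show "T = ord (int f)" using c by auto
qed

text \<open>This is the Hermite normal form: \<open>n\<close> generates the rational integers
  contained in \<open>I\<close>, and \<open>c0\<close> the group of
  \<open>\<omega>\<close>-coordinates of elements of \<open>I\<close>.\<close>

lemma ideal_basis:
  assumes I: "ideal I (ring_of (ord c))" "I \<noteq> {0}" and c: "c \<noteq> 0"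
  obtains n b0 c0 where "n \<noteq> 0" "c0 \<noteq> 0" "I = {of_int n * of_int x + of_int y * (of_int b0 + of_int c0 * \<omega>) | x y. True}"
proof -
  interpret R: subset_ring "ord c" by (rule ord_ring)
  have IR: "I \<subseteq> ord c" and I0: "0 \<in> I" and Iadd: "\<And>x y. x \<in> I \<Longrightarrow> y \<in> I \<Longrightarrow> x + y \<in> I"
    and Imult: "\<And>r x. r \<in> ord c \<Longrightarrow> x \<in> I \<Longrightarrow> r * x \<in> I"
    using I(1) unfolding R.ideal_ring_of_iff by blast+
  have Idiff: "x - y \<in> I" if "x \<in> I" "y \<in> I" for x y
    using Iadd[OF that(1) Imult[OF R.uminus_mem[OF R.one_mem] that(2)]] by simp
  have Iint: "of_int k * x \<in> I" if "x \<in> I" for k x using Imult[OF R.of_int_mem that] .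
  define L where "L = {x. of_int x \<in> I}"
  have "0 \<in> L" by (simp add: L_def I0)
  moreover have "x - y \<in> L" if "x \<in> L" "y \<in> L" for x y using Idiff that by (simp add: L_def)
  ultimately obtain n where n: "\<And>x. x \<in> L \<longleftrightarrow> n dvd x" using int_subgroup_multiples by metis
  define M where "M = {y. \<exists>x. of_int x + of_int y * \<omega> \<in> I}"
  have "0 \<in> M" unfolding M_def using I0 by (intro CollectI exI[of _ 0]) simp
  moreover have "y - y' \<in> M" if "y \<in> M" "y' \<in> M" for y y'
  proof -
    obtain x where x: "of_int x + of_int y * \<omega> \<in> I" using \<open>y \<in> M\<close> unfolding M_def by blast
    obtain x' where x': "of_int x' + of_int y' * \<omega> \<in> I" using \<open>y' \<in> M\<close> unfolding M_def by blast
    from Idiff[OF x x'] have "of_int (x - x') + of_int (y - y') * \<omega> \<in> I" by (simp add: algebra_simps)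
    then show ?thesis unfolding M_def by blast
  qed
  ultimately obtain c0 where c0: "\<And>x. x \<in> M \<longleftrightarrow> c0 dvd x" using int_subgroup_multiples by metis
  obtain \<gamma> where \<gamma>: "\<gamma> \<in> I" "\<gamma> \<noteq> 0" using I(2) I0 by blast
  then obtain x y where xy: "\<gamma> = of_int x + of_int y * \<omega>" using IR ord_subset integersE by blast
  define m where "m = x * x + x * y * v - y * y * u"
  \<comment> \<open>The conjugate of \<open>\<gamma>\<close>, with \<omega> replaced by v -
    \<omega>. As \<open>c \<gamma>'\<close> lies in the order, \<open>I\<close> contains the nonzero
    integer \<open>c m\<close>, and then also \<open>c c m \<omega>\<close>; this makes
    \<open>n\<close> and \<open>c0\<close> nonzero.\<close>
  define \<gamma>' where "\<gamma>' = of_int (x + y * v) - of_int y * \<omega>"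
  have "\<gamma> * \<gamma>' = of_int (x * (x + y * v)) + of_int (y * (x + y * v) - x * y) * \<omega> - of_int (y * y) * (\<omega> * \<omega>)"
    by (simp add: xy \<gamma>'_def algebra_simps)
  also have "\<dots> = of_int m" unfolding square by (simp add: m_def algebra_simps)
  finally have norm: "\<gamma> * \<gamma>' = of_int m" .
  have "m \<noteq> 0"
  proof
    assume "m = 0"
    with norm \<gamma>(2) have "\<gamma>' = 0" by simp
    then have "of_int (x + y * v) + of_int (- y) * \<omega> = of_int 0 + of_int 0 * \<omega>" by (simp add: \<gamma>'_def)
    from int_unique[OF this] have "y = 0" "x = 0" by auto
    then show False using \<gamma>(2) by (simp add: xy)
  qed
  have "of_int c * \<gamma>' = of_int (c * (x + y * v)) + of_int (- c * y) * \<omega>" by (simp add: \<gamma>'_def algebra_simps)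
  then have "of_int c * \<gamma>' \<in> ord c" using ord_iff[of "c * (x + y * v)" "- c * y" c] by simp
  from Imult[OF this \<gamma>(1)] have "of_int c * (\<gamma> * \<gamma>') \<in> I" by (simp only: mult_ac)
  then have cm: "of_int (c * m) \<in> I" unfolding norm by simp
  then have "n \<noteq> 0" using n[of "c * m"] c \<open>m \<noteq> 0\<close> by (auto simp: L_def)
  have "of_int c * \<omega> \<in> ord c" using ord_iff[of 0 c c] by simp
  from Imult[OF this cm] have "of_int 0 + of_int (c * c * m) * \<omega> \<in> I" by (simp add: mult_ac)
  then have "c * c * m \<in> M" unfolding M_def by blast
  then have "c0 \<noteq> 0" using c0[of "c * c * m"] c \<open>m \<noteq> 0\<close> by auto
  obtain b0 where b0: "of_int b0 + of_int c0 * \<omega> \<in> I" using c0[of c0] unfolding M_def by auto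
  have nI: "of_int n \<in> I" using n[of n] by (simp add: L_def)
  have "I = {of_int n * of_int x + of_int y * (of_int b0 + of_int c0 * \<omega>) | x y. True}"
  proof (intro subset_antisym subsetI)
    fix z assume z: "z \<in> I"
    then obtain x y where xy: "z = of_int x + of_int y * \<omega>" using IR ord_subset integersE by blast
    then have "y \<in> M" using z unfolding M_def by blast
    then obtain k where k: "y = c0 * k" using c0 by (auto elim: dvdE)
    have "z - of_int k * (of_int b0 + of_int c0 * \<omega>) \<in> I" using Idiff[OF z Iint[OF b0]] .
    moreover have eq: "z - of_int k * (of_int b0 + of_int c0 * \<omega>) = of_int (x - k * b0)"
      by (simp add: xy k algebra_simps)
    ultimately have "x - k * b0 \<in> L" by (simp add: L_def)
    then obtain l where "x - k * b0 = n * l" using n by (auto elim: dvdE)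
    with eq have "z = of_int n * of_int l + of_int k * (of_int b0 + of_int c0 * \<omega>)" by (simp add: algebra_simps)
    then show "z \<in> {of_int n * of_int x + of_int y * (of_int b0 + of_int c0 * \<omega>) | x y. True}" by blast
  next
    fix z assume "z \<in> {of_int n * of_int x + of_int y * (of_int b0 + of_int c0 * \<omega>) | x y. True}"
    then obtain x y where z: "z = of_int x * of_int n + of_int y * (of_int b0 + of_int c0 * \<omega>)"
      by (auto simp: mult.commute)
    show "z \<in> I" unfolding z by (intro Iadd Iint nI b0)
  qed
  then show thesis using that \<open>n \<noteq> 0\<close> \<open>c0 \<noteq> 0\<close> by blast
qed

text \<open>The proof computes \<open>\<Delta>(x b1, x b2)\<close> in two ways, where \<open>\<Delta>\<close> is the determinant of the coordinates with
  respect to \<open>1, \<omega>\<close>.\<close>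

lemma det_multiplication:
  assumes b: "rat_basis K b1 b2" and x: "x = of_rat p + of_rat q * \<omega>"
    and eq1: "x * b1 = of_rat a11 * b1 + of_rat a21 * b2"
    and eq2: "x * b2 = of_rat a12 * b1 + of_rat a22 * b2"
  shows "a11 * a22 - a12 * a21 = p * p + p * q * of_int v - q * q * of_int u"
proof -
  have ind: "\<And>p q. of_rat p * b1 + of_rat q * b2 = 0 \<Longrightarrow> p = 0 \<and> q = 0"
    and K: "K = {of_rat p * b1 + of_rat q * b2 | p q. True}"
    using b unfolding rat_basis_def by blast+
  have "b1 \<in> K" unfolding K by (intro CollectI exI[of _ 1] exI[of _ 0]) simp
  then obtain p1 q1 where b1: "b1 = of_rat p1 + of_rat q1 * \<omega>" using K_eq by blast
  have "b2 \<in> K" unfolding K by (intro CollectI exI[of _ 0] exI[of _ 1]) simp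
  then obtain p2 q2 where b2: "b2 = of_rat p2 + of_rat q2 * \<omega>" using K_eq by blast
  define \<Delta> where "\<Delta> = p1 * q2 - q1 * p2"
  have "\<Delta> \<noteq> 0"
  proof
    assume \<Delta>: "\<Delta> = 0"
    have "of_rat q2 * b1 + of_rat (- q1) * b2 = of_rat \<Delta>"
      by (simp add: b1 b2 \<Delta>_def of_rat_minus of_rat_diff of_rat_mult algebra_simps)
    then have q: "q1 = 0" "q2 = 0" using ind[of q2 "- q1"] \<Delta> by auto
    then have "of_rat p2 * b1 + of_rat (- p1) * b2 = 0" by (simp add: b1 b2 of_rat_minus mult.commute)
    then have "p1 = 0" using ind by force
    then show False using ind[of 1 0] q b1 by simp
  qed
  have mult: "x * (of_rat r + of_rat s * \<omega>)
      = of_rat (p * r + q * s * of_int u) + of_rat (p * s + q * r + q * s * of_int v) * \<omega>" for r s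
  proof -
    have "x * (of_rat r + of_rat s * \<omega>) = of_rat (p * r) + of_rat (p * s + q * r) * \<omega> + of_rat (q * s) * (\<omega> * \<omega>)"
      by (simp add: x of_rat_add of_rat_mult algebra_simps)
    then show ?thesis unfolding square by (simp add: of_rat_add of_rat_mult algebra_simps)
  qed
  have comb: "of_rat r * b1 + of_rat s * b2 = of_rat (r * p1 + s * p2) + of_rat (r * q1 + s * q2) * \<omega>" for r s
    by (simp add: b1 b2 of_rat_add of_rat_mult algebra_simps)
  have e1: "p * p1 + q * q1 * of_int u = a11 * p1 + a21 * p2" "p * q1 + q * p1 + q * q1 * of_int v = a11 * q1 + a21 * q2"
    using rat_unique eq1 unfolding comb b1[THEN arg_cong[where f = "(*) x"]] mult by blast+
  have e2: "p * p2 + q * q2 * of_int u = a12 * p1 + a22 * p2" "p * q2 + q * p2 + q * q2 * of_int v = a12 * q1 + a22 * q2"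
    using rat_unique eq2 unfolding comb b2[THEN arg_cong[where f = "(*) x"]] mult by blast+
  have "(a11 * a22 - a12 * a21) * \<Delta> = (a11 * p1 + a21 * p2) * (a12 * q1 + a22 * q2) - (a11 * q1 + a21 * q2) * (a12 * p1 + a22 * p2)"
    by (simp add: \<Delta>_def algebra_simps)
  also have "\<dots> = (p * p + p * q * of_int v - q * q * of_int u) * \<Delta>"
    unfolding e1[symmetric] e2[symmetric] by (simp add: \<Delta>_def algebra_simps)
  finally show ?thesis using \<open>\<Delta> \<noteq> 0\<close> by simp
qed

lemma field_norm_eq:
  assumes b: "rat_basis K b1 b2" and x: "x \<in> K"
    and eq1: "x * b1 = of_rat a11 * b1 + of_rat a21 * b2"
    and eq2: "x * b2 = of_rat a12 * b1 + of_rat a22 * b2"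
  shows "field_norm K x = a11 * a22 - a12 * a21"
  unfolding field_norm_def
proof (rule the_equality)
  obtain p q where pq: "x = of_rat p + of_rat q * \<omega>" using x K_eq by blast
  define A where "A = Matrix.mat 2 2 (\<lambda>(i, j). if i = 0 then (if j = 0 then a11 else a12) else (if j = 0 then a21 else a22))"
  have A: "A \<in> carrier_mat 2 2" "A $$ (0, 0) = a11" "A $$ (0, 1) = a12" "A $$ (1, 0) = a21" "A $$ (1, 1) = a22"
    by (simp_all add: A_def)
  then show "\<exists>b1 b2 A. rat_basis K b1 b2 \<and> A \<in> carrier_mat 2 2 \<and>
     x * b1 = of_rat (A $$ (0,0)) * b1 + of_rat (A $$ (1,0)) * b2 \<and>
     x * b2 = of_rat (A $$ (0,1)) * b1 + of_rat (A $$ (1,1)) * b2 \<and> a11 * a22 - a12 * a21 = det A"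
    using b eq1 eq2 det_2x2[OF A(1)] by (intro exI[of _ b1] exI[of _ b2] exI[of _ A]) simp
  fix n assume "\<exists>b1 b2 A. rat_basis K b1 b2 \<and> A \<in> carrier_mat 2 2 \<and>
     x * b1 = of_rat (A $$ (0,0)) * b1 + of_rat (A $$ (1,0)) * b2 \<and>
     x * b2 = of_rat (A $$ (0,1)) * b1 + of_rat (A $$ (1,1)) * b2 \<and> n = det A"
  then obtain b1' b2' B where B: "rat_basis K b1' b2'" "B \<in> carrier_mat 2 2"
    "x * b1' = of_rat (B $$ (0,0)) * b1' + of_rat (B $$ (1,0)) * b2'"
    "x * b2' = of_rat (B $$ (0,1)) * b1' + of_rat (B $$ (1,1)) * b2'" "n = det B" by blast
  have "n = B $$ (0,0) * B $$ (1,1) - B $$ (0,1) * B $$ (1,0)" using B(5) det_2x2[OF B(2)] by simp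
  also have "\<dots> = p * p + p * q * of_int v - q * q * of_int u" by (rule det_multiplication[OF B(1) pq B(3,4)])
  also have "\<dots> = a11 * a22 - a12 * a21" by (rule det_multiplication[OF b pq eq1 eq2, symmetric])
  finally show "n = a11 * a22 - a12 * a21" .
qed

end

section \<open>Passage from an ideal of an order to a lattice\<close>

lemma quadratic_field_integers:
  fixes K :: "'a::field_char_0 set"
  assumes "quadratic_field K"
  obtains \<omega> u v where "quadratic_integers K \<omega> u v"
proof -
  obtain \<delta> d where "quadratic_sqrt K \<delta> d" using quadratic_field_sqrt[OF assms] .
  then interpret quadratic_sqrt K \<delta> d .
  obtain \<omega> u v where "ring_of_integers K = {of_int x + of_int y * \<omega> | x y. True}"
    "K = {of_rat p + of_rat q * \<omega> | p q. True}"
    "\<And>p q. of_rat p + of_rat q * \<omega> = 0 \<Longrightarrow> p = 0 \<and> q = 0"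
    "\<omega> * \<omega> = of_int u + of_int v * \<omega>" using integral_basis by blast
  then have "quadratic_integers K \<omega> u v" by unfold_locales
  then show thesis by (rule that)
qed

lemma primitive_int_polynomial:
  fixes A B C :: int and t :: "'a::field_char_0"
  assumes A: "A \<noteq> 0" and root: "of_int A * t\<^sup>2 + of_int B * t + of_int C = 0"
  obtains a b c where "of_int a * t\<^sup>2 + of_int b * t + of_int c = 0" "\<exists>u v w. u * a + v * b + w * c = 1"
proof -
  define h where "h = gcd (gcd A B) C"
  have h: "h \<noteq> 0" using A by (simp add: h_def)
  obtain a b c where abc: "A = h * a" "B = h * b" "C = h * c"
    unfolding h_def by (meson dvdE dvd_trans gcd_dvd1 gcd_dvd2)
  obtain x y where xy: "x * A + y * B = gcd A B" using bezout_int by blast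
  obtain x' y' where "x' * gcd A B + y' * C = h" using bezout_int[of "gcd A B" C] unfolding h_def by blast
  then have "x' * (x * A + y * B) + y' * C = h" unfolding xy .
  moreover have "x' * (x * A + y * B) + y' * C = h * (x' * x * a + x' * y * b + y' * c)"
    unfolding abc by (simp add: algebra_simps)
  ultimately have "h * (x' * x * a + x' * y * b + y' * c) = h * 1" by simp
  then have "x' * x * a + x' * y * b + y' * c = 1" using h by (simp only: mult_cancel_left) simp
  moreover have "of_int h * (of_int a * t\<^sup>2 + of_int b * t + of_int c) = 0"
    using root unfolding abc by (simp add: algebra_simps)
  then have "of_int a * t\<^sup>2 + of_int b * t + of_int c = 0" using h by simp
  ultimately show thesis using that by blast
qed

context quadratic_integers
begin

text \<open>Dividing the Hermite basis of \<open>I\<close> by \<open>n\<close> gives the basis 1,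
  \<open>t\<close>. Once \<open>S\<close> is identified with the ring of multipliers, which is Z + Z
  f' \<omega>, the ring Z + g S is Z + Z f \<omega>.\<close>

lemma ideal_quad_ideal:
  assumes f: "f > 0" "f' > 0" and I: "ideal I (ring_of (quad_order K f))" "I \<noteq> {0}"
    and mult: "multiplier_ring K I = quad_order K f'"
  obtains al t a b c where "quad_ideal al t a b c (int (f div f'))"
    "quad_lattice.I al t = I" "quad_lattice.R t a (int (f div f')) = quad_order K f"
    "quad_lattice.S t a = multiplier_ring K I"
    "\<And>s. s \<in> quad_lattice.S t a \<Longrightarrow> field_norm K s = of_int (quad_lattice.nrm al t s)"
proof -
  have R: "quad_order K f = ord (int f)" and S: "quad_order K f' = ord (int f')"
    using quad_order_eq f by blast+
  interpret R: subset_ring "ord (int f)" by (rule ord_ring)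
  interpret O: subset_ring "ring_of_integers K" using ord_ring[of 1] by (simp only: ord_1)
  have I': "ideal I (ring_of (ord (int f)))" using I(1) R by simp
  have IR: "I \<subseteq> ord (int f)" using I' unfolding R.ideal_ring_of_iff by blast
  have "int f \<noteq> 0" using f by simp
  then obtain n b0 c0 where n: "n \<noteq> 0" and c0: "c0 \<noteq> 0"
    and Ieq: "I = {of_int n * of_int x + of_int y * (of_int b0 + of_int c0 * \<omega>) | x y. True}"
    by (rule ideal_basis[OF I' I(2)])
  define al :: 'a where "al = of_int n"
  define t where "t = (of_int b0 + of_int c0 * \<omega>) / of_int n"
  have al: "al \<noteq> 0" using n by (simp add: al_def)
  have nt: "of_int n * t = of_int b0 + of_int c0 * \<omega>" using n by (simp add: t_def)
  \<comment> \<open>The polynomial is the norm of n X - (b0 + c0 \<omega>): its coefficients come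
    from the trace 2 b0 + c0 v and the norm of b0 + c0 \<omega>.\<close>
  have "of_int (n * n) * t\<^sup>2 + of_int (- 2 * n * b0 - c0 * v * n) * t + of_int (b0 * b0 + c0 * v * b0 - c0 * c0 * u)
      = (of_int n * t) * (of_int n * t) - of_int (2 * b0 + c0 * v) * (of_int n * t) + of_int (b0 * b0 + c0 * v * b0 - c0 * c0 * u)"
    by (simp add: power2_eq_square algebra_simps)
  also have "\<dots> = of_int (c0 * c0) * (\<omega> * \<omega> - of_int u - of_int v * \<omega>)"
    unfolding nt by (simp add: algebra_simps)
  also have "\<dots> = 0" by (simp add: square)
  finally obtain a b c where abc: "of_int a * t\<^sup>2 + of_int b * t + of_int c = 0" "\<exists>u v w. u * a + v * b + w * c = 1"
    using primitive_int_polynomial[of "n * n" t] n by (metis mult_eq_0_iff)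
  have irr: "y = 0" if xy: "of_int x + of_int y * t = 0" for x y
  proof -
    have "of_int (n * x + y * b0) + of_int (y * c0) * \<omega> = of_int n * of_int x + of_int y * (of_int n * t)"
      unfolding nt by (simp add: algebra_simps)
    also have "\<dots> = of_int n * (of_int x + of_int y * t)" by (simp add: algebra_simps)
    also have "\<dots> = of_int 0 + of_int 0 * \<omega>" unfolding xy by simp
    finally show ?thesis using int_unique c0 by fastforce
  qed
  define g where "g = int (f div f')"
  have Rmult: "r \<in> multiplier_ring K I" if "r \<in> ord (int f)" for r
    using that I' ord_subset unfolding multiplier_ring_def R.ideal_ring_of_iff by blast
  \<comment> \<open>f \<omega> lies in the order, hence multiplies \<open>I\<close> into itself;
    membership in the order of index f' then means that f' divides f.\<close>
  have "of_int 0 + of_int (int f) * \<omega> \<in> ord (int f)" unfolding ord_iff by simp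
  then have "of_int 0 + of_int (int f) * \<omega> \<in> ord (int f')" using Rmult mult S by blast
  then have "f' dvd f" unfolding ord_iff by simp
  then have fg: "int f = int f' * g" by (simp add: g_def flip: of_nat_mult)
  have g: "g > 0"
    using f dvd_imp_le[OF \<open>f' dvd f\<close>] by (simp add: g_def div_greater_zero_iff)
  interpret L: quad_lattice al t a b c g
    by unfold_locales (use al abc irr g in auto)
  have LI: "L.I = I"
  proof -
    have "al * (of_int x + of_int y * t) = of_int n * of_int x + of_int y * (of_int b0 + of_int c0 * \<omega>)" for x y
      unfolding nt[symmetric] by (simp add: al_def algebra_simps)
    then show ?thesis unfolding L.I_def Ieq by simp
  qed
  have wK: "L.w \<in> K"
  proof -
    have "L.w = of_rat (of_int (a * b0) / of_int n) + of_rat (of_int (a * c0) / of_int n) * \<omega>"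
      unfolding L.w_def unfolding t_def using n by (simp add: of_rat_divide of_rat_mult field_simps)
    then show ?thesis unfolding K_eq by blast
  qed
  \<comment> \<open>\<open>multiplier_ring\<close> admits only integers of \<open>K\<close>, whereas
    \<open>L.multiplier_iff\<close> ranges over the ambient field. The integrality of
    \<open>L.w\<close> reconciles the two.\<close>
  have "algebraic_int L.w"
  proof
    show "\<forall>i. coeff [:of_int (a * c), of_int b, 1:] i \<in> (\<int> :: 'a set)"
      by (auto simp: coeff_pCons split: nat.splits)
    have "poly [:of_int (a * c), of_int b, 1:] L.w = L.w * L.w + of_int b * L.w + of_int (a * c)"
      by (simp add: algebra_simps)
    also have "\<dots> = 0" unfolding L.w_mult_w by simp
    finally show "poly [:of_int (a * c), of_int b, 1:] L.w = 0" .
  qed simp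
  then have "L.w \<in> ring_of_integers K" using wK by (simp add: ring_of_integers_def)
  then have "L.S \<subseteq> ring_of_integers K"
    unfolding L.S_def by (auto intro!: O.add_mem O.mult_mem O.of_int_mem)
  then have LS: "L.S = multiplier_ring K I"
    unfolding multiplier_ring_def using L.multiplier_iff LI by blast
  have "r \<in> L.R \<longleftrightarrow> r \<in> ord (int f)" for r
  proof -
    have "r \<in> L.R \<longleftrightarrow> (\<exists>x. \<exists>s\<in>L.S. r - of_int x = of_int g * s)"
      unfolding L.R_iff L.F_def by blast
    also have "\<dots> \<longleftrightarrow> (\<exists>x. \<exists>s\<in>ord (int f'). r - of_int x = of_int g * s)" using LS mult S by simp
    also have "\<dots> \<longleftrightarrow> r \<in> ord (int f)"
    proof
      assume "\<exists>x. \<exists>s\<in>ord (int f'). r - of_int x = of_int g * s"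
      then obtain x y z where "r - of_int x = of_int g * (of_int y + of_int z * (of_int (int f') * \<omega>))"
        unfolding ord_def[of "int f'"] by blast
      then have "r = of_int (x + g * y) + of_int z * (of_int (int f' * g) * \<omega>)" by (simp add: algebra_simps)
      then show "r \<in> ord (int f)" unfolding ord_def fg by blast
    next
      assume "r \<in> ord (int f)"
      then obtain x y where "r = of_int x + of_int y * (of_int (int f' * g) * \<omega>)" unfolding ord_def fg by blast
      then have "r - of_int x = of_int g * (of_int 0 + of_int y * (of_int (int f') * \<omega>))" by (simp add: algebra_simps)
      then show "\<exists>x. \<exists>s\<in>ord (int f'). r - of_int x = of_int g * s" unfolding ord_def by blast
    qed
    finally show ?thesis .
  qed
  then have LR: "L.R = quad_order K f" using R by blast
  have "quad_ideal al t a b c g"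
    using IR LI LR R L.quad_lattice_axioms by (simp add: quad_ideal_def quad_ideal_axioms_def)
  moreover have "field_norm K s = of_int (L.nrm s)" if s: "s \<in> L.S" for s
  proof -
    have sK: "s \<in> K" using s LS by (auto simp: multiplier_ring_def ring_of_integers_def)
    have comb: "of_rat p * al + of_rat q * (al * t)
        = of_rat (p * of_int n + q * of_int b0) + of_rat (q * of_int c0) * \<omega>" for p q
    proof -
      have "of_rat p * al + of_rat q * (al * t) = of_rat p * of_int n + of_rat q * (of_int n * t)"
        by (simp add: al_def)
      then show ?thesis unfolding nt by (simp add: of_rat_add of_rat_mult algebra_simps)
    qed
    have comb': "of_rat p + of_rat q * \<omega>
        = of_rat ((p - q / of_int c0 * of_int b0) / of_int n) * al + of_rat (q / of_int c0) * (al * t)" for p q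
      unfolding comb using n c0 by simp
    have basis: "rat_basis K al (al * t)"
      unfolding rat_basis_def
    proof (intro conjI allI impI)
      show "K = {of_rat p * al + of_rat q * (al * t) | p q. True}"
        unfolding K_eq using comb comb' by blast
      fix p q assume "of_rat p * al + of_rat q * (al * t) = 0"
      then show "p = 0" "q = 0"
        using indep[of "p * of_int n + q * of_int b0" "q * of_int c0"] n c0 unfolding comb by auto
    qed
    \<comment> \<open>The coordinates of \<open>s al\<close> and \<open>s al t\<close> are the
      columns of the multiplication matrix, so \<open>field_norm\<close> and \<open>L.nrm\<close>
      are the same determinant.\<close>
    have coord: "s * z = of_rat (of_int (L.coord1 (s * z))) * al + of_rat (of_int (L.coord2 (s * z))) * (al * t)"
      if "z \<in> L.I" for z
      using L.coord_I[OF L.I_mult[OF s that]] by (simp add: algebra_simps)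
    show ?thesis
      using field_norm_eq[OF basis sK coord[OF L.I_basis(1)] coord[OF L.I_basis(2)]]
      by (simp add: L.nrm_def L.D_def mult.commute)
  qed
  ultimately show thesis using that LI LR LS unfolding g_def by blast
qed

end

theorem proposition6p8:
  fixes K R I :: "'a::field_char_0 set" and f f' :: nat
  assumes "quadratic_field K"
    and "f > 0" and "R = quad_order K f"
    and "ideal I (ring_of R)" and "I \<noteq> {0}"
    and "f' > 0" and "multiplier_ring K I = quad_order K f'"
  shows
    "(card (pairs_mod (unit_mults (multiplier_ring K I)) (gen_pairs R I) (SL2 R)) =
        card (rcosets\<^bsub>units_of (fitting_quot R I)\<^esub> (eps_group K R I)) \<and>
      real (card (rcosets\<^bsub>units_of (fitting_quot R I)\<^esub> (eps_group K R I))) =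
        real (totient (f div f')) / 2 ^ eps_exponent K f f')
     \<and>
     (pairs_mod (module_auts R I) (gen_pairs R I) (GL2 R) =
        pairs_mod {id} (gen_pairs R I) (GL2 R) \<and>
      (\<forall>\<phi>\<in>module_auts R I. \<forall>Y\<in>pairs_mod {id} (gen_pairs R I) (GL2 R).
         map_prod \<phi> \<phi> ` Y = Y) \<and>
      (\<forall>m\<in>gen_pairs R I. \<exists>h.
         bij_betw h (pairs_mod {id} (gen_pairs R I) (GL2 R))
           (carrier (units_of (fitting_quot R I) Mod unit_image R I)) \<and>
         (\<forall>m'\<in>gen_pairs R I.
            h (orbit_rel {id} (gen_pairs R I) (GL2 R) `` {m'}) =
              unit_image R I #>\<^bsub>units_of (fitting_quot R I)\<^esub> det_pair R I m m')))
     \<and>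
     (card {p. prime p \<and> odd p \<and> p dvd f div f'} \<ge> 3 \<longrightarrow>
        \<not> (\<forall>m\<in>gen_pairs R I. \<forall>m'\<in>gen_pairs R I. \<exists>A\<in>GL2 R. m' = row_mult m A))"
proof -
  obtain \<omega> u v where "quadratic_integers K \<omega> u v" using quadratic_field_integers[OF assms(1)] .
  then interpret quadratic_integers K \<omega> u v .
  obtain al t a b c where L: "quad_ideal al t a b c (int (f div f'))"
    and I: "quad_lattice.I al t = I" and R: "quad_lattice.R t a (int (f div f')) = R"
    and S: "quad_lattice.S t a = multiplier_ring K I"
    and norm: "\<And>s. s \<in> quad_lattice.S t a \<Longrightarrow> field_norm K s = of_int (quad_lattice.nrm al t s)"
    using ideal_quad_ideal[OF assms(2,6) _ assms(5,7)] assms(3,4) by metis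
  interpret L: quad_ideal al t a b c "int (f div f')" by (rule L)
  have Q: "fitting_quot R I = L.Q" using L.fitting_quot_eq unfolding I R .
  have eps: "eps_group K R I = L.eps"
    using L.eps_group_eq unfolding eps_group_def S[symmetric] I R .
  have "(\<exists>u\<in>Units (ring_of (quad_order K f')). field_norm K u = - 1) \<longleftrightarrow> (\<exists>u\<in>L.S_units. L.nrm u = - 1)"
  proof -
    have "field_norm K u = - 1 \<longleftrightarrow> L.nrm u = - 1" if "u \<in> L.S_units" for u
    proof -
      have "field_norm K u = of_int (L.nrm u)" using that by (intro norm) (simp add: L.S_units_def)
      also have "\<dots> = - 1 \<longleftrightarrow> L.nrm u = - 1" by (metis of_int_1 of_int_eq_iff of_int_minus)
      finally show ?thesis .
    qed
    then show ?thesis unfolding assms(7)[symmetric] S[symmetric] L.S_units_eq[symmetric] by blast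
  qed
  then have exponent: "eps_exponent K f f' = (if (\<exists>u\<in>L.S_units. L.nrm u = - 1) \<and> int (f div f') > 2 then 1 else 0)"
    unfolding eps_exponent_def by auto
  note facts = L.card_unit_SL2_orbits L.card_rcosets_eps L.pairs_mod_module_auts
    L.module_auts_act_trivially L.GL2_orbits_bij L.GL2_not_transitive
  note facts' = facts[unfolded I R S nat_int]
  show ?thesis
    unfolding Q eps exponent
  proof (intro conjI ballI impI)
    show "\<exists>h. bij_betw h (pairs_mod {id} (gen_pairs R I) (GL2 R)) (carrier (units_of L.Q Mod unit_image R I)) \<and>
        (\<forall>m'\<in>gen_pairs R I. h (orbit_rel {id} (gen_pairs R I) (GL2 R) `` {m'}) =
          unit_image R I #>\<^bsub>units_of L.Q\<^esub> det_pair R I m m')"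
      if "m \<in> gen_pairs R I" for m
      using facts'(5)[OF that] .
    show "map_prod \<phi> \<phi> ` Y = Y"
      if "\<phi> \<in> module_auts R I" "Y \<in> pairs_mod {id} (gen_pairs R I) (GL2 R)" for \<phi> Y
      using facts'(4)[OF that] .
    show "\<not> (\<forall>m\<in>gen_pairs R I. \<forall>m'\<in>gen_pairs R I. \<exists>A\<in>GL2 R. m' = row_mult m A)"
      if "3 \<le> card {p. prime p \<and> odd p \<and> p dvd f div f'}"
      using facts'(6) that by (meson not_le)
  qed (fact facts'(1) facts'(2) facts'(3))+
qed

end
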